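(* Let $u,v\in\mathfrak S_n$ with $u<v$. The group $\mathfrak F_{3,u,v}$ is a dihedral group. Moreover, for every $3$-flipclass $F$ of paths from $u$ to $v$: (1) the unlabelled support graph $S^u_F$ and the unlabelled time-support graph $TS^u_F$ are both isomorphic (as directed graphs) to a $k$-crown for some $k\in\{2,3,4,5\}$; (2) this $k$ equals the order of the permutation $f_2f_1$ restricted to $F$; (3) the maps $i_{S_F}$ and $i_{TS_F}$ are bijections (i.e. every path of length $3$ from the source to the sink in $S_F$, respectively in $TS_F$, comes from a path of $F$), and they send increasing paths to increasing paths, with respect to any reflection ordering; (4) $c(F)=1$ if $k\in\{2,3,4\}$ and $c(F)=2$ if $k=5$.
   Context: $\mathfrak S_n$ is the symmetric group on $[n]$, $T$ its transpositions, $\ell$ the length w.r.t. simple transpositions. The Bruhat graph $B(\mathfrak S_n)$ has an edge $x\xrightarrow{t}y$ iff $yx^{-1}=t\in T$ and $\ell(x)<\ell(y)$; Bruhat order: $u\le v$ iff there is a directed path from $u$ to $v$. $P_h(u,v)$ denotes the paths $u=x_0\to\cdots\to x_h=v$ of length $h$. Between two fixed vertices there are $0$ or $2$ paths of length $2$; each is the flip of the other. The $i$-th flip operator $f_i$ ($i\in[h-1]$) on $P_h(u,v)$ replaces $x_{i-1}\to x_i\to x_{i+1}$ by its flip; $\mathfrak F_{h,u,v}$ is the subgroup of the symmetric group on $P_h(u,v)$ generated by $f_1,\dots,f_{h-1}$, and its orbits are the $h$-flipclasses of paths from $u$ to $v$. For such an $F$: the support graph $S_F$ is the edge-labelled subgraph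 of $B(\mathfrak S_n)$ consisting of all vertices and edges lying on some path of $F$; the time-support graph $TS_F$ has vertices $(a,i)$, $0\le i\le h$, such that some path $(x_0,\dots,x_h)\in F$ has $x_i=a$, and edges $(a,i)\xrightarrow{t}(b,i+1)$ whenever some path of $F$ contains the edge $x_i=a\xrightarrow{t}b=x_{i+1}$. $S^u_F$, $TS^u_F$ are these graphs with labels forgotten. $i_{S_F}$ sends a path of $F$ to the same path in $S_F$; $i_{TS_F}$ sends $(x_0,\dots,x_h)$ to $((x_0,0),\dots,(x_h,h))$; they are maps into the set of paths of length $h$ from $u$ to $v$ in $S_F$, resp. from $(u,0)$ to $(v,h)$ in $TS_F$. A $k$-crown is the directed graph with vertices $\hat0,a_1,\dots,a_k,b_1,\dots,b_k,\hat1$ and edges $\hat0\to a_j$, $a_j\to b_j$, $a_j\to b_{j+1}$ (indices mod $k$), $b_j\to\hat1$ for all $j$. A reflection ordering is a total order $\preceq$ on $T$ such that for $a<b<c$ either $(a,b)\preceq(a,c)\preceq(b,c)$ or $(b,c)\preceq(a,c)\preceq(a,b)$; a path (in any of these edge-labelled graphs) with labels $t_1,\dots,t_h$ is increasing if $t_1\preceq\cdots\preceq t_h$; $c(F)$ is the number of increasing paths in $F$ (independent of the reflection ordering).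
   Formalization: The group is shown to be dihedral or trivial; the trivial case is needed because when there are no paths of length 3 from u to v (e.g. n=2, u the identity, v the transposition) the group is trivial, and it occurs only then. *)

theory Defs
  imports "HOL-Combinatorics.Permutations" "HOL-Algebra.Bij" "HOL-Algebra.Generated_Groups"
begin

text \<open>Permutations of [n] = {1..n} are functions nat => nat with p permutes {1..n}.
  Transpositions (a,b), 1 <= a < b <= n, are encoded by the pair (a,b).\<close>

definition refl_T :: "nat \<Rightarrow> (nat \<times> nat) set" where
  "refl_T n = {(a, b). 1 \<le> a \<and> a < b \<and> b \<le> n}"

definition blen :: "nat \<Rightarrow> (nat \<Rightarrow> nat) \<Rightarrow> nat" where
  "blen n x = (LEAST k. \<exists>ss. length ss = k \<and> set ss \<subseteq> {1..<n} \<and>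
       x = foldr (\<lambda>i f. transpose i (Suc i) \<circ> f) ss id)"

definition bedge :: "nat \<Rightarrow> (nat \<Rightarrow> nat) \<Rightarrow> nat \<times> nat \<Rightarrow> (nat \<Rightarrow> nat) \<Rightarrow> bool" where
  "bedge n x t y \<longleftrightarrow> x permutes {1..n} \<and> y permutes {1..n} \<and> t \<in> refl_T n \<and>
     y = transpose (fst t) (snd t) \<circ> x \<and> blen n x < blen n y"

definition bgraph_edge :: "nat \<Rightarrow> (nat \<Rightarrow> nat) \<Rightarrow> (nat \<Rightarrow> nat) \<Rightarrow> bool" where
  "bgraph_edge n x y \<longleftrightarrow> (\<exists>t. bedge n x t y)"

definition elabel :: "nat \<Rightarrow> (nat \<Rightarrow> nat) \<Rightarrow> (nat \<Rightarrow> nat) \<Rightarrow> nat \<times> nat" where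
  "elabel n x y = (THE t. bedge n x t y)"

definition bruhat_le :: "nat \<Rightarrow> (nat \<Rightarrow> nat) \<Rightarrow> (nat \<Rightarrow> nat) \<Rightarrow> bool" where
  "bruhat_le n u v \<longleftrightarrow> u permutes {1..n} \<and> v permutes {1..n} \<and> (bgraph_edge n)\<^sup>*\<^sup>* u v"

definition bruhat_less :: "nat \<Rightarrow> (nat \<Rightarrow> nat) \<Rightarrow> (nat \<Rightarrow> nat) \<Rightarrow> bool" where
  "bruhat_less n u v \<longleftrightarrow> bruhat_le n u v \<and> u \<noteq> v"

definition bpaths :: "nat \<Rightarrow> nat \<Rightarrow> (nat \<Rightarrow> nat) \<Rightarrow> (nat \<Rightarrow> nat) \<Rightarrow> (nat \<Rightarrow> nat) list set" where
  "bpaths n h u v = {xs. length xs = Suc h \<and> xs ! 0 = u \<and> xs ! h = v \<and>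
      (\<forall>i<h. bgraph_edge n (xs ! i) (xs ! Suc i))}"

definition flip :: "nat \<Rightarrow> (nat \<Rightarrow> nat) \<Rightarrow> (nat \<Rightarrow> nat) \<Rightarrow> (nat \<Rightarrow> nat) \<Rightarrow> (nat \<Rightarrow> nat)" where
  "flip n x y z = (THE y'. y' \<noteq> y \<and> bgraph_edge n x y' \<and> bgraph_edge n y' z)"

definition flip_op :: "nat \<Rightarrow> nat \<Rightarrow> (nat \<Rightarrow> nat) list \<Rightarrow> (nat \<Rightarrow> nat) list" where
  "flip_op n i xs = xs[i := flip n (xs ! (i - 1)) (xs ! i) (xs ! Suc i)]"

definition flip_perm :: "nat \<Rightarrow> nat \<Rightarrow> (nat \<Rightarrow> nat) \<Rightarrow> (nat \<Rightarrow> nat) \<Rightarrow> nat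
    \<Rightarrow> (nat \<Rightarrow> nat) list \<Rightarrow> (nat \<Rightarrow> nat) list" where
  "flip_perm n h u v i = restrict (flip_op n i) (bpaths n h u v)"

definition flip_group where
  "flip_group n h u v =
     (BijGroup (bpaths n h u v))\<lparr>carrier :=
        generate (BijGroup (bpaths n h u v)) (flip_perm n h u v ` {1..<h})\<rparr>"

definition flipclasses :: "nat \<Rightarrow> nat \<Rightarrow> (nat \<Rightarrow> nat) \<Rightarrow> (nat \<Rightarrow> nat) \<Rightarrow> (nat \<Rightarrow> nat) list set set" where
  "flipclasses n h u v =
     {(\<lambda>g. g p) ` carrier (flip_group n h u v) | p. p \<in> bpaths n h u v}"

text \<open>Dihedral group of order 2m (m >= 1): elements r^a s^e encoded as (a, e).\<close>
definition dihedral_group :: "nat \<Rightarrow> (nat \<times> bool) monoid" where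
  "dihedral_group m =
     \<lparr>carrier = {0..<m} \<times> UNIV,
      mult = (\<lambda>(a, e) (b, f). ((if e then a + m - b else a + b) mod m, e \<noteq> f)),
      one = (0, False)\<rparr>"

definition is_dihedral :: "('a, 'b) monoid_scheme \<Rightarrow> bool" where
  "is_dihedral G \<longleftrightarrow> (\<exists>m\<ge>1. G \<cong> dihedral_group m) \<or> carrier G = {\<one>\<^bsub>G\<^esub>}"

definition S_V :: "(nat \<Rightarrow> nat) list set \<Rightarrow> (nat \<Rightarrow> nat) set" where
  "S_V F = {xs ! i | xs i. xs \<in> F \<and> i < length xs}"

definition S_E :: "nat \<Rightarrow> (nat \<Rightarrow> nat) list set
    \<Rightarrow> ((nat \<Rightarrow> nat) \<times> (nat \<times> nat) \<times> (nat \<Rightarrow> nat)) set" where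
  "S_E n F = {(xs ! i, elabel n (xs ! i) (xs ! Suc i), xs ! Suc i) | xs i.
                 xs \<in> F \<and> Suc i < length xs}"

definition TS_V :: "(nat \<Rightarrow> nat) list set \<Rightarrow> ((nat \<Rightarrow> nat) \<times> nat) set" where
  "TS_V F = {(xs ! i, i) | xs i. xs \<in> F \<and> i < length xs}"

definition TS_E :: "nat \<Rightarrow> (nat \<Rightarrow> nat) list set
    \<Rightarrow> (((nat \<Rightarrow> nat) \<times> nat) \<times> (nat \<times> nat) \<times> ((nat \<Rightarrow> nat) \<times> nat)) set" where
  "TS_E n F = {((xs ! i, i), elabel n (xs ! i) (xs ! Suc i), (xs ! Suc i, Suc i)) | xs i.
                 xs \<in> F \<and> Suc i < length xs}"

definition unlab :: "('v \<times> 'l \<times> 'v) set \<Rightarrow> ('v \<times> 'v) set" where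
  "unlab E = (\<lambda>(a, t, b). (a, b)) ` E"

definition lpaths :: "('v \<times> 'l \<times> 'v) set \<Rightarrow> nat \<Rightarrow> 'v \<Rightarrow> 'v \<Rightarrow> ('v \<times> 'l \<times> 'v) list set" where
  "lpaths E h s t = {es. length es = h \<and> set es \<subseteq> E \<and>
      (h = 0 \<longrightarrow> s = t) \<and>
      (h > 0 \<longrightarrow> fst (es ! 0) = s \<and> snd (snd (es ! (h - 1))) = t) \<and>
      (\<forall>i. Suc i < h \<longrightarrow> snd (snd (es ! i)) = fst (es ! Suc i))}"

definition i_S :: "nat \<Rightarrow> (nat \<Rightarrow> nat) list \<Rightarrow> ((nat \<Rightarrow> nat) \<times> (nat \<times> nat) \<times> (nat \<Rightarrow> nat)) list" where
  "i_S n xs = map (\<lambda>i. (xs ! i, elabel n (xs ! i) (xs ! Suc i), xs ! Suc i)) [0..<length xs - 1]"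

definition i_TS :: "nat \<Rightarrow> (nat \<Rightarrow> nat) list
    \<Rightarrow> (((nat \<Rightarrow> nat) \<times> nat) \<times> (nat \<times> nat) \<times> ((nat \<Rightarrow> nat) \<times> nat)) list" where
  "i_TS n xs = map (\<lambda>i. ((xs ! i, i), elabel n (xs ! i) (xs ! Suc i), (xs ! Suc i, Suc i)))
                 [0..<length xs - 1]"

definition elabels :: "('v \<times> 'l \<times> 'v) list \<Rightarrow> 'l list" where
  "elabels es = map (\<lambda>e. fst (snd e)) es"

definition vlabels :: "nat \<Rightarrow> (nat \<Rightarrow> nat) list \<Rightarrow> (nat \<times> nat) list" where
  "vlabels n xs = map (\<lambda>i. elabel n (xs ! i) (xs ! Suc i)) [0..<length xs - 1]"

definition reflection_ordering :: "nat \<Rightarrow> ((nat \<times> nat) \<times> (nat \<times> nat)) set \<Rightarrow> bool" where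
  "reflection_ordering n r \<longleftrightarrow> r \<subseteq> refl_T n \<times> refl_T n \<and> linear_order_on (refl_T n) r \<and>
     (\<forall>a b c. 1 \<le> a \<and> a < b \<and> b < c \<and> c \<le> n \<longrightarrow>
        (((a, b), (a, c)) \<in> r \<and> ((a, c), (b, c)) \<in> r) \<or>
        (((b, c), (a, c)) \<in> r \<and> ((a, c), (a, b)) \<in> r))"

definition increasing :: "('l \<times> 'l) set \<Rightarrow> 'l list \<Rightarrow> bool" where
  "increasing r ts \<longleftrightarrow> (\<forall>i. Suc i < length ts \<longrightarrow> (ts ! i, ts ! Suc i) \<in> r)"

definition cF :: "nat \<Rightarrow> ((nat \<times> nat) \<times> (nat \<times> nat)) set \<Rightarrow> (nat \<Rightarrow> nat) list set \<Rightarrow> nat" where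
  "cF n r F = card {p \<in> F. increasing r (vlabels n p)}"

text \<open>k-crown: 0hat = (0,0), a_j = (1,j), b_j = (2,j), 1hat = (3,0), j < k.\<close>
definition crown_V :: "nat \<Rightarrow> (nat \<times> nat) set" where
  "crown_V k = {(0, 0), (3, 0)} \<union> {(1, j) | j. j < k} \<union> {(2, j) | j. j < k}"

definition crown_E :: "nat \<Rightarrow> ((nat \<times> nat) \<times> (nat \<times> nat)) set" where
  "crown_E k = {((0, 0), (1, j)) | j. j < k} \<union> {((1, j), (2, j)) | j. j < k}
     \<union> {((1, j), (2, (Suc j) mod k)) | j. j < k} \<union> {((2, j), (3, 0)) | j. j < k}"

definition digraph_iso :: "'a set \<Rightarrow> ('a \<times> 'a) set \<Rightarrow> 'b set \<Rightarrow> ('b \<times> 'b) set \<Rightarrow> bool" where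
  "digraph_iso V1 E1 V2 E2 \<longleftrightarrow> (\<exists>f. bij_betw f V1 V2 \<and>
      (\<forall>x\<in>V1. \<forall>y\<in>V1. (x, y) \<in> E1 \<longleftrightarrow> (f x, f y) \<in> E2))"

definition perm_order_on :: "'a set \<Rightarrow> ('a \<Rightarrow> 'a) \<Rightarrow> nat" where
  "perm_order_on F g = (LEAST k. k > 0 \<and> (\<forall>p\<in>F. (g ^^ k) p = p))"

end

theory Submission
  imports Defs "HOL-Algebra.Multiplicative_Group"
begin

text \<open>The length of a permutation is its number of inversions, so the edge x \<rightarrow> (a b) x is present iff
  the value a precedes the value b in x. A path of length 3 from u is thus a triple of reflections
  whose validity, and whose flips, depend only on the relative positions in u of the at most six
  values that these reflections move; flips stay in the reflection subgroup they generate.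
  Since each flip is a fixed point free involution changing one middle vertex, a flipclass is a cycle in the
  bipartite graph on the middle vertices, which is a crown, and two involutions without fixed points
  generate a dihedral group. It remains to compute the length of the cycle and the number of
  increasing paths on it. If the reflections commute, or one commutes with both others, then
  k = 3 and both are done by hand, as exactly one of two flipped paths in a dihedral subgroup is increasing.
  Otherwise only three or four values move, and the finitely many words on four letters
  together with the sixteen reflection orderings of S_4 are checked exhaustively.\<close>

section \<open>Length and inversions\<close>

text \<open>The case distinction comes from the graph on the values whose three edges are the labels
  of a path: if it is connected, it has at most four vertices; otherwise one label is disjoint from
  the other two and commutes with them. Four letters suffice in the connected case because flips and
  ascents only compare values with values and positions with positions, so an order-preserving
  relabelling carries the whole flipclass along, and a reflection ordering restricts to the chosen
  values. The difficulty is that a flipclass is an orbit of a group, which cannot be evaluated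
  directly. It is replaced by a certificate: the iterates of the product of the two flips return to
  the starting path after \<open>k\<close> steps, with distinct first labels and distinct last
  labels on the way. The first label determines the vertex after \<open>u\<close>, the last one the
  vertex before \<open>v\<close>, so the certificate gives a cycle without repetitions; being closed
  under both flips, it is the whole class. The value \<open>k = 5\<close> and its count 2 come out
  of the finite check.\<close>

text \<open>The position of a value in the one-line notation of a permutation.\<close>
abbreviation pos :: "(nat \<Rightarrow> nat) \<Rightarrow> nat \<Rightarrow> nat" where
  "pos x \<equiv> inv_into UNIV x"

text \<open>Stated for position functions: multiplying a permutation by a transposition of values
  from the left composes its position function with that transposition on the right.\<close>

definition inversions :: "nat \<Rightarrow> (nat \<Rightarrow> nat) \<Rightarrow> (nat \<times> nat) set" where
  "inversions n q = {(a, b). 1 \<le> a \<and> a < b \<and> b \<le> n \<and> q b < q a}"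

lemma finite_inversions: "finite (inversions n q)"
  by (rule finite_subset[of _ "{1..n} \<times> {1..n}"]) (auto simp: inversions_def)

text \<open>Inversions contained in the interval from a to b stay inversions after the swap; the other ones
  are moved to inversions by it.\<close>
lemma card_inversions_transpose_less:
  assumes ab: "1 \<le> a" "a < b" "b \<le> n" and q: "inj q" "q a < q b"
  shows "card (inversions n q) < card (inversions n (q \<circ> transpose a b))"
proof -
  define t where "t = transpose a b"
  define f where "f = (\<lambda>(i, j). if a \<le> i \<and> j \<le> b then (i, j) else (t i, t j))"
  have t: "t a = b" "t b = a" "\<And>c. c \<noteq> a \<Longrightarrow> c \<noteq> b \<Longrightarrow> t c = c"
    by (auto simp: t_def)
  \<comment> \<open>\<open>f\<close> is its own inverse here, hence injective, and its image misses
    \<open>(a, b)\<close>, which is an inversion only after the swap. That pair makes the inequality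
    strict.\<close>
  have inv: "f (i, j) \<in> inversions n (q \<circ> t) - {(a, b)} \<and> f (f (i, j)) = (i, j)"
    if ij: "(i, j) \<in> inversions n q" for i j
  proof -
    have "i < j" "1 \<le> i" "j \<le> n" "q j < q i"
      using ij by (auto simp: inversions_def)
    then show ?thesis
      using ab q(2) t(1,2) t(3)[of i] t(3)[of j] unfolding f_def inversions_def
      by (cases "i = a"; cases "i = b"; cases "j = a"; cases "j = b") auto
  qed
  have "inj_on f (inversions n q)"
    by (rule inj_on_inverseI[of _ f]) (use inv in auto)
  then have "card (inversions n q) = card (f ` inversions n q)"
    by (simp add: card_image)
  also have "\<dots> < card (inversions n (q \<circ> t))"
  proof (rule psubset_card_mono[OF finite_inversions])
    have "(a, b) \<in> inversions n (q \<circ> t)"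
      using ab q t by (auto simp: inversions_def)
    then show "f ` inversions n q \<subset> inversions n (q \<circ> t)"
      using inv by (intro psubsetI subsetI notI) (auto, force)
  qed
  finally show ?thesis by (simp add: t_def)
qed

text \<open>An adjacent swap changes the relative order of no pair of indices except
  \<open>(i, Suc i)\<close>, so every other inversion is the image of an old one.\<close>

lemma card_inversions_simple_le:
  assumes "1 \<le> i" "i < n"
  shows "card (inversions n (q \<circ> transpose i (Suc i))) \<le> Suc (card (inversions n q))"
proof -
  let ?t = "transpose i (Suc i)"
  let ?f = "\<lambda>(a, b). (?t a, ?t b)"
  have "inversions n (q \<circ> ?t) \<subseteq> insert (i, Suc i) (?f ` inversions n q)"
  proof
    fix p assume p: "p \<in> inversions n (q \<circ> ?t)"
    obtain a b where ab: "p = (a, b)" by (cases p)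
    show "p \<in> insert (i, Suc i) (?f ` inversions n q)"
    proof (cases "(a, b) = (i, Suc i)")
      case False
      then have "(?t a, ?t b) \<in> inversions n q"
        using p ab assms by (auto simp: inversions_def transpose_def split: if_splits)
      then show ?thesis
        using ab by (auto intro!: image_eqI[of _ _ "(?t a, ?t b)"])
    qed (simp add: ab)
  qed
  then have "card (inversions n (q \<circ> ?t)) \<le> card (insert (i, Suc i) (?f ` inversions n q))"
    by (intro card_mono) (auto simp: finite_inversions)
  also have "\<dots> \<le> Suc (card (inversions n q))"
    using card_image_le[OF finite_inversions, of ?f n q] by (simp add: card_insert_if finite_inversions)
  finally show ?thesis .
qed

section \<open>Words in simple transpositions and the length function\<close>

definition simple_word :: "nat list \<Rightarrow> nat \<Rightarrow> nat" where
  "simple_word ss = foldr (\<lambda>i f. transpose i (Suc i) \<circ> f) ss id"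

lemma simple_word_simps [simp]:
  "simple_word [] = id" "simple_word (i # ss) = transpose i (Suc i) \<circ> simple_word ss"
  by (simp_all only: simple_word_def foldr.simps o_apply id_apply)

lemma simple_word_permutes: "set ss \<subseteq> {1..<n} \<Longrightarrow> simple_word ss permutes {1..n}"
proof (induction ss)
  case (Cons i ss)
  then have "set ss \<subseteq> {1..<n}" and i: "i \<in> {1..n}" "Suc i \<in> {1..n}" by auto
  then have "transpose i (Suc i) \<circ> simple_word ss permutes {1..n}"
    by (intro permutes_compose[OF Cons.IH] permutes_swap_id)
  then show ?case by (simp only: simple_word_simps)
qed (simp only: simple_word_simps permutes_id)

lemma inv_transpose_comp:
  assumes "x permutes S"
  shows "pos (transpose a b \<circ> x) = pos x \<circ> transpose a b"
  using permutes_bij[OF assms] by (simp add: o_inv_distrib)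

lemma card_inversions_le_length:
  "set ss \<subseteq> {1..<n} \<Longrightarrow> card (inversions n (pos (simple_word ss))) \<le> length ss"
proof (induction ss)
  case Nil
  have "inversions n id = {}" by (auto simp: inversions_def)
  then show ?case by (simp only: simple_word_simps inv_id card.empty list.size)
next
  case (Cons i ss)
  then have i: "1 \<le> i" "i < n" and le: "card (inversions n (pos (simple_word ss))) \<le> length ss"
    and ss: "set ss \<subseteq> {1..<n}" by auto
  have "card (inversions n (pos (simple_word (i # ss)))) \<le> Suc (card (inversions n (pos (simple_word ss))))"
    unfolding simple_word_simps inv_transpose_comp[OF simple_word_permutes[OF ss]]
    by (rule card_inversions_simple_le[OF i])
  then show ?case using le by (simp del: simple_word_simps)
qed

text \<open>Without descents \<open>q\<close> is strictly increasing, so \<open>i \<le> q i\<close>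
  by induction from \<open>q 1 \<ge> 1\<close>; a permutation that lowers no point is the
  identity.\<close>

lemma permutes_no_descent_id:
  assumes q: "q permutes {1..n}" and asc: "\<And>i. 1 \<le> i \<Longrightarrow> i < n \<Longrightarrow> q i < q (Suc i)"
  shows "q = id"
proof (rule permutes_natset_ge[OF q], rule ballI)
  fix i assume "i \<in> {1..n}"
  then show "i \<le> q i"
  proof (induction i)
    case (Suc i)
    show ?case
    proof (cases "i = 0")
      case True
      then show ?thesis using permutes_in_image[OF q, of 1] Suc.prems by auto
    next
      case False
      then show ?thesis using Suc asc[of i] by auto
    qed
  qed simp
qed

text \<open>Sorting by adjacent swaps: as long as the position function has a descent, one letter
  removes it and at least one inversion disappears, so the word is no longer than the number of
  inversions.\<close>

lemma ex_simple_word: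
  "x permutes {1..n} \<Longrightarrow>
    \<exists>ss. set ss \<subseteq> {1..<n} \<and> x = simple_word ss \<and> length ss \<le> card (inversions n (pos x))"
proof (induction "card (inversions n (pos x))" arbitrary: x rule: less_induct)
  case less
  define q where "q = pos x"
  have q: "q permutes {1..n}" unfolding q_def by (rule permutes_inv[OF less.prems])
  show ?case
  proof (cases "\<exists>i. 1 \<le> i \<and> i < n \<and> q (Suc i) < q i")
    case False
    then have "q = id"
      using permutes_inj[OF q] by (intro permutes_no_descent_id[OF q]) (metis injD n_not_Suc_n nat_neq_iff)
    then have "x = id" using permutes_inv_inv[OF less.prems] by (simp add: q_def)
    then show ?thesis by (intro exI[of _ "[]"]) simp
  next
    case True
    then obtain i where i: "1 \<le> i" "i < n" "q (Suc i) < q i" by blast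
    define y where "y = transpose i (Suc i) \<circ> x"
    have y: "y permutes {1..n}" unfolding y_def
      using i by (intro permutes_compose[OF less.prems] permutes_swap_id) auto
    have qy: "pos y = q \<circ> transpose i (Suc i)"
      unfolding y_def q_def by (rule inv_transpose_comp[OF less.prems])
    \<comment> \<open>The strict inequality is applied to \<open>y\<close>, in which
      \<open>i\<close> precedes \<open>Suc i\<close>; swapping these back gives
      \<open>q\<close>.\<close>
    have "card (inversions n (pos y)) < card (inversions n (pos y \<circ> transpose i (Suc i)))"
      using i permutes_inj[OF permutes_inv[OF y]]
      by (intro card_inversions_transpose_less) (auto simp: qy)
    also have "pos y \<circ> transpose i (Suc i) = q" by (simp add: qy comp_assoc)
    finally have less': "card (inversions n (pos y)) < card (inversions n q)" .
    then obtain ss where ss: "set ss \<subseteq> {1..<n}" "y = simple_word ss"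
        "length ss \<le> card (inversions n (pos y))"
      using less.hyps[of y] y by (auto simp: q_def)
    have "x = transpose i (Suc i) \<circ> y" by (simp add: y_def fun_eq_iff)
    then show ?thesis
      using ss less' i by (intro exI[of _ "i # ss"]) (auto simp: q_def)
  qed
qed

lemma blen_eq_card_inversions:
  assumes "x permutes {1..n}"
  shows "blen n x = card (inversions n (pos x))"
  unfolding blen_def simple_word_def[symmetric]
proof (rule Least_equality)
  obtain ss where "set ss \<subseteq> {1..<n}" "x = simple_word ss" "length ss \<le> card (inversions n (pos x))"
    using ex_simple_word[OF assms] by blast
  then show "\<exists>ss. length ss = card (inversions n (pos x)) \<and> set ss \<subseteq> {1..<n} \<and> x = simple_word ss"
    using card_inversions_le_length[of ss n] by auto
qed (use card_inversions_le_length in auto)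

text \<open>If \<open>b\<close> precedes \<open>a\<close> in \<open>x\<close>, then \<open>a\<close>
  precedes \<open>b\<close> in \<open>y\<close>, and the same strict inequality read from
  \<open>y\<close> to \<open>x\<close> shows that the length drops.\<close>

lemma bedge_iff:
  "bedge n x (a, b) y \<longleftrightarrow> x permutes {1..n} \<and> 1 \<le> a \<and> a < b \<and> b \<le> n \<and>
     y = transpose a b \<circ> x \<and> pos x a < pos x b"
proof (cases "x permutes {1..n} \<and> 1 \<le> a \<and> a < b \<and> b \<le> n \<and> y = transpose a b \<circ> x")
  case True
  then have x: "x permutes {1..n}" and ab: "1 \<le> a" "a < b" "b \<le> n" and y: "y = transpose a b \<circ> x"
    by auto
  have yp: "y permutes {1..n}"
    unfolding y using ab by (intro permutes_compose[OF x] permutes_swap_id) auto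
  have iy: "pos y = pos x \<circ> transpose a b" unfolding y by (rule inv_transpose_comp[OF x])
  have inj: "inj (pos x)" "inj (pos y)" using x yp by (auto intro: permutes_inj permutes_inv)
  have "blen n x < blen n y \<longleftrightarrow> pos x a < pos x b"
  proof
    assume "pos x a < pos x b"
    then show "blen n x < blen n y"
      using card_inversions_transpose_less[OF ab inj(1)]
      unfolding blen_eq_card_inversions[OF x] blen_eq_card_inversions[OF yp] iy by simp
  next
    assume len: "blen n x < blen n y"
    show "pos x a < pos x b"
    proof (rule ccontr)
      assume "\<not> pos x a < pos x b"
      then have "pos y a < pos y b" using injD[OF inj(1), of a b] ab by (force simp: iy)
      then have "blen n y < blen n x"
        using card_inversions_transpose_less[OF ab inj(2)]
        unfolding blen_eq_card_inversions[OF x] blen_eq_card_inversions[OF yp]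
        by (simp add: iy comp_assoc)
      then show False using len by simp
    qed
  qed
  then show ?thesis using True yp by (auto simp: bedge_def refl_T_def)
qed (auto simp: bedge_def refl_T_def)

section \<open>Flips of reflection pairs\<close>

type_synonym refl = "nat \<times> nat"

abbreviation swap :: "refl \<Rightarrow> nat \<Rightarrow> nat" where
  "swap t \<equiv> transpose (fst t) (snd t)"

definition ascent :: "(nat \<Rightarrow> nat) \<Rightarrow> refl \<Rightarrow> bool" where
  "ascent q t \<longleftrightarrow> fst t < snd t \<and> q (fst t) < q (snd t)"

text \<open>The pair (s, t) stands for the path q, q \<circ> s, q \<circ> s \<circ> t of position functions. For three values
  a < b < c the only ambiguous pairs are (ab, bc) and (bc, ab), where q decides.\<close>
fun gflip :: "(nat \<Rightarrow> nat) \<Rightarrow> refl \<Rightarrow> refl \<Rightarrow> refl \<times> refl" where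
  "gflip q (a, b) (c, d) =
    (if a = c then (if b < d then ((b, d), (a, b)) else ((a, d), (d, b)))
     else if b = d then (if a < c then ((c, b), (a, c)) else ((c, a), (a, b)))
     else if b = c then (if q b < q d then ((b, d), (a, d)) else ((a, d), (a, b)))
     else if a = d then (if q c < q a then ((c, a), (c, b)) else ((c, b), (a, b)))
     else ((c, d), (a, b)))"

definition ascent2 :: "(nat \<Rightarrow> nat) \<Rightarrow> refl \<Rightarrow> refl \<Rightarrow> bool" where
  "ascent2 q s t \<longleftrightarrow> ascent q s \<and> ascent (q \<circ> swap s) t"

lemma swap_inject:
  assumes "fst s < snd s" "fst t < snd t"
  shows "swap s = swap t \<longleftrightarrow> s = t"
proof
  assume "swap s = swap t"
  from fun_cong[OF this, of "fst s"] fun_cong[OF this, of "snd s"] assms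
  show "s = t" by (cases s; cases t) (auto simp: transpose_def split: if_splits)
qed simp

lemma ascent2_neq: "ascent2 q s t \<Longrightarrow> s \<noteq> t"
  by (auto simp: ascent2_def ascent_def)

lemma ascent2_iff:
  "ascent2 q (a, b) (c, d) \<longleftrightarrow>
     a < b \<and> q a < q b \<and> c < d \<and> q (transpose a b c) < q (transpose a b d)"
  by (simp add: ascent2_def ascent_def)

text \<open>Two distinct reflections with a common letter multiply to a 3-cycle, which has three
  factorizations into reflections; \<open>gflip\<close> passes to another ascending one. Disjoint
  reflections commute and are exchanged. The cases follow the branches of \<open>gflip\<close>. That
  the letters stay the same keeps flips inside [n] and inside the supports considered later.\<close>

lemma gflip_ascent2:
  assumes "inj q" "ascent2 q s t" "gflip q s t = (s', t')"
  shows "ascent2 q s' t' \<and> swap t' \<circ> swap s' = swap t \<circ> swap s \<and> s' \<noteq> s \<and> t' \<noteq> t \<and>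
    gflip q s' t' = (s, t) \<and>
    {fst s', snd s', fst t', snd t'} = {fst s, snd s, fst t, snd t}"
proof -
  obtain a b c d where st: "s = (a, b)" "t = (c, d)" by (cases s; cases t)
  have q: "q x = q y \<longleftrightarrow> x = y" for x y using assms(1) by (simp add: inj_eq)
  have lt: "a < b" "c < d" using assms(2) by (auto simp: st ascent2_iff)
  have nlt: "\<not> q x < q y \<longleftrightarrow> x = y \<or> q y < q x" for x y using q[of x y] by (metis nat_neq_iff order.asym)
  note asm = assms(2,3)[unfolded st ascent2_iff gflip.simps]
  consider "a = c" "b < d" | "a = c" "d < b" | "b = d" "a < c" | "b = d" "c < a" | "a \<noteq> c" "b \<noteq> d" "b = c"
    | "a \<noteq> c" "b \<noteq> d" "b \<noteq> c" "a = d" | "a \<noteq> c" "b \<noteq> d" "b \<noteq> c" "a \<noteq> d"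
    using ascent2_neq[OF assms(2)] st by force
  then show ?thesis
  proof cases
    case 1
    then have ne: "a \<noteq> b" "a \<noteq> d" "b \<noteq> d" and s't': "s' = (b, d)" "t' = (a, b)" using asm lt by auto
    then show ?thesis using asm 1 lt by (auto simp: st ascent2_iff transpose_def fun_eq_iff)
  next
    case 2
    then have ne: "a \<noteq> b" "a \<noteq> d" "b \<noteq> d" and s't': "s' = (a, d)" "t' = (d, b)" using asm lt by auto
    then show ?thesis using asm 2 lt by (auto simp: st ascent2_iff transpose_def fun_eq_iff)
  next
    case 3
    then have ne: "a \<noteq> b" "a \<noteq> c" "b \<noteq> c" and s't': "s' = (c, b)" "t' = (a, c)" using asm lt by auto
    then show ?thesis using asm 3 lt by (auto simp: st ascent2_iff transpose_def fun_eq_iff)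
  next
    case 4
    then have ne: "a \<noteq> b" "a \<noteq> c" "b \<noteq> c" and s't': "s' = (c, a)" "t' = (a, b)" using asm lt by auto
    then show ?thesis using asm 4 lt by (auto simp: st ascent2_iff transpose_def fun_eq_iff)
  next
    case 5
    then have ne: "a \<noteq> b" "a \<noteq> d" "b \<noteq> d" and
      s't': "s' = (if q b < q d then (b, d) else (a, d))" "t' = (if q b < q d then (a, d) else (a, b))" 
      using asm lt by auto
    then show ?thesis using asm 5 lt nlt[of b d] 
      by (cases "q b < q d") (auto simp: st ascent2_iff transpose_def fun_eq_iff)
  next
    case 6
    then have ne: "a \<noteq> b" "a \<noteq> c" "b \<noteq> c" and
      s't': "s' = (if q c < q a then (c, a) else (c, b))" "t' = (if q c < q a then (c, b) else (a, b))" 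
      using asm lt by auto
    then show ?thesis using asm 6 lt nlt[of c a] 
      by (cases "q c < q a") (auto simp: st ascent2_iff transpose_def fun_eq_iff)
  next
    case 7
    then have ne: "a \<noteq> b" "c \<noteq> d" and s't': "s' = (c, d)" "t' = (a, b)" using asm lt by auto
    then show ?thesis using asm 7 lt by (auto simp: st ascent2_iff transpose_def fun_eq_iff)
  qed
qed

text \<open>Used to recover the letters of a pair from its product alone. A point is fixed by the
  product iff both swaps send it to the same place, and distinct swaps disagree on each of their
  letters.\<close>

lemma swap_swap_moves:
  assumes "fst s < snd s" "fst t < snd t" "s \<noteq> t"
  shows "{x. (swap t \<circ> swap s) x \<noteq> x} = {fst s, snd s, fst t, snd t}"
proof -
  obtain a b c d where st: "s = (a, b)" "t = (c, d)" by (cases s; cases t)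
  have "transpose c d (transpose a b x) \<noteq> x \<longleftrightarrow> x \<in> {a, b, c, d}" for x
  proof -
    have "transpose c d (transpose a b x) = x \<longleftrightarrow> transpose a b x = transpose c d x"
      by (metis transpose_involutory)
    moreover have "a < b" "c < d" "a = c \<Longrightarrow> b \<noteq> d" using assms by (auto simp: st)
    ultimately show ?thesis
      by (cases "x = a"; cases "x = b"; cases "x = c"; cases "x = d") (auto simp: transpose_def)
  qed
  then show ?thesis by (auto simp: st)
qed

text \<open>Of the six ordered pairs of distinct reflections on three letters, three multiply to
  each 3-cycle; the image of \<open>x\<close> tells the two 3-cycles apart.\<close>

lemma swap_swap_three_points:
  assumes xyz: "x < y" "y < z" and lt: "fst s < snd s" "fst t < snd t" "s \<noteq> t"
    and sub: "{fst s, snd s, fst t, snd t} = {x, y, z}"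
  shows "swap t (swap s x) = y \<and> (s, t) \<in> {((x, y), (x, z)), ((y, z), (x, y)), ((x, z), (y, z))} \<or>
         swap t (swap s x) = z \<and> (s, t) \<in> {((x, y), (y, z)), ((y, z), (x, z)), ((x, z), (x, y))}"
proof -
  have pair: "p \<in> {(x, y), (x, z), (y, z)}"
    if "fst p \<in> {x, y, z}" "snd p \<in> {x, y, z}" "fst p < snd p" for p
    using that xyz by (cases p) auto
  have "fst s \<in> {x, y, z}" "snd s \<in> {x, y, z}" "fst t \<in> {x, y, z}" "snd t \<in> {x, y, z}"
    unfolding sub[symmetric] by simp_all
  then have "s \<in> {(x, y), (x, z), (y, z)}" "t \<in> {(x, y), (x, z), (y, z)}"
    using pair lt by blast+
  moreover have "x \<noteq> y" "y \<noteq> z" "x \<noteq> z" using xyz by auto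
  ultimately show ?thesis using lt(3)
    by (elim insertE emptyE) (simp_all add: transpose_def)
qed

lemma overlapping_reflections:
  assumes "fst s < snd s" "fst t < snd t" "s \<noteq> t" "{fst s, snd s} \<inter> {fst t, snd t} \<noteq> {}"
  obtains x y z :: nat where "x < y" "y < z" "{fst s, snd s, fst t, snd t} = {x, y, z}"
proof -
  obtain a b c d where st: "s = (a, b)" "t = (c, d)" by (cases s; cases t)
  have lt: "a < b" "c < d" using assms by (auto simp: st)
  consider "a = c" "b < d" | "a = c" "d < b" | "b = d" "a < c" | "b = d" "c < a" | "b = c" | "a = d"
    using assms(3,4) unfolding st by (auto simp: neq_iff)
  then show ?thesis
  proof cases
    case 1 then show ?thesis using lt by (intro that[of a b d]) (auto simp: st)
  next
    case 2 then show ?thesis using lt by (intro that[of a d b]) (auto simp: st)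
  next
    case 3 then show ?thesis using lt by (intro that[of a c b]) (auto simp: st)
  next
    case 4 then show ?thesis using lt by (intro that[of c a b]) (auto simp: st)
  next
    case 5 then show ?thesis using lt by (intro that[of a b d]) (auto simp: st)
  next
    case 6 then show ?thesis using lt by (intro that[of c a b]) (auto simp: st)
  qed
qed

text \<open>Of the three factorizations of a 3-cycle at most two ascend for the same
  \<open>q\<close>: if the first two do, then \<open>q x < q y < q z\<close>, and the third would
  need one of these inequalities reversed.\<close>

lemma gflip_unique_overlapping:
  assumes "x < y" "y < z" "ascent2 q s t" "ascent2 q s' t'"
    and "(s, t) \<in> {((x, y), (x, z)), ((y, z), (x, y)), ((x, z), (y, z))} \<and>
         (s', t') \<in> {((x, y), (x, z)), ((y, z), (x, y)), ((x, z), (y, z))} \<or>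
         (s, t) \<in> {((x, y), (y, z)), ((y, z), (x, z)), ((x, z), (x, y))} \<and>
         (s', t') \<in> {((x, y), (y, z)), ((y, z), (x, z)), ((x, z), (x, y))}"
  shows "(s', t') = (s, t) \<or> (s', t') = gflip q s t"
proof -
  have ne: "x \<noteq> y" "x \<noteq> z" "y \<noteq> z" "\<not> z < y" "\<not> y < x" "\<not> z < x" using assms(1,2) by auto
  have st: "ascent2 q (fst (s, t)) (snd (s, t))" "ascent2 q (fst (s', t')) (snd (s', t'))"
    using assms(3,4) by auto
  have "(s', t') = (s, t) \<or> (s', t') = gflip q (fst (s, t)) (snd (s, t))"
    using assms(5,1,2) ne st
    apply (elim disjE conjE insertE emptyE)
    apply (simp_all only: fst_conv snd_conv)
    apply (simp_all add: ascent2_iff transpose_def)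
    done
  then show ?thesis by simp
qed

text \<open>The product determines its moved letters. If there are three, both pairs factor the same
  3-cycle. If there are four, the product consists of two disjoint swaps and factors only into
  these, in either order.\<close>

lemma gflip_unique:
  assumes q: "ascent2 q s t" "ascent2 q s' t'"
    and eq: "swap t' \<circ> swap s' = swap t \<circ> swap s"
  shows "(s', t') = (s, t) \<or> (s', t') = gflip q s t"
proof -
  have lt: "fst s < snd s" "fst t < snd t" "s \<noteq> t" "fst s' < snd s'" "fst t' < snd t'" "s' \<noteq> t'"
    using q ascent2_neq[OF q(1)] ascent2_neq[OF q(2)] unfolding ascent2_def ascent_def by blast+
  have sets: "{fst s', snd s', fst t', snd t'} = {fst s, snd s, fst t, snd t}"
    using swap_swap_moves[OF lt(4-6)] swap_swap_moves[OF lt(1-3)] unfolding eq by (rule trans[OF sym])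
  have ev: "swap t' (swap s' x) = swap t (swap s x)" for x using fun_cong[OF eq, of x] by simp
  show ?thesis
  proof (cases "{fst s, snd s} \<inter> {fst t, snd t} = {}")
    case False
    obtain x y z where xyz: "x < y" "y < z" "{fst s, snd s, fst t, snd t} = {x, y, z}"
      using overlapping_reflections[OF lt(1-3) False] .
    \<comment> \<open>\<open>w\<close> is the image of \<open>x\<close> under the common product; it
      cannot be both \<open>y\<close> and \<open>z\<close>, so both pairs fall into the same list of
      three factorizations.\<close>
    have combine: "A \<and> C \<or> B \<and> D"
      if "w = y \<and> A \<or> w = z \<and> B" "w = y \<and> C \<or> w = z \<and> D" for A B C D w
      using that xyz(2) by blast
    show ?thesis
      by (rule gflip_unique_overlapping[OF xyz(1,2) q], rule combine,
          rule swap_swap_three_points[OF xyz(1,2) lt(1-3) xyz(3)],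
          rule swap_swap_three_points[OF xyz(1,2) lt(4-6) sets[unfolded xyz(3)], unfolded ev])
  next
    case True
    obtain a b c d where st: "s = (a, b)" "t = (c, d)" by (cases s; cases t)
    obtain i j k l where st': "s' = (i, j)" "t' = (k, l)" by (cases s'; cases t')
    have ne: "a \<noteq> b" "c \<noteq> d" "a \<noteq> c" "a \<noteq> d" "b \<noteq> c" "b \<noteq> d" "i \<noteq> j" "k \<noteq> l"
      using True lt by (auto simp: st st')
    have "{i, j, k, l} = {a, b, c, d}" using sets by (simp add: st st')
    moreover have "card {a, b, c, d} = 4" using ne by simp
    \<comment> \<open>Four entries that cover a set of four elements are distinct, so the second
      pair is disjoint as well.\<close>
    ultimately have "distinct [i, j, k, l]" by (intro card_distinct) simp
    then have ik: "i \<noteq> k" "i \<noteq> l" "j \<noteq> k" "j \<noteq> l" by simp_all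
    have swap_val: "(m, transpose c d (transpose a b m)) \<in> {(a, b), (b, a), (c, d), (d, c)}"
      if "m \<in> {a, b, c, d}" for m
      using that ne[symmetric] ne by (elim insertE emptyE) (simp_all only: transpose_def if_True if_False refl simp_thms insert_iff)
    have "transpose c d (transpose a b i) = j"
      using ev[of i] ik ne by (simp add: st st')
    moreover have "transpose c d (transpose a b k) = l"
      using ev[of k] ik ne by (simp add: st st')
    moreover have "i \<in> {a, b, c, d}" "k \<in> {a, b, c, d}" using sets unfolding st st' by auto
    ultimately have "s' \<in> {(a, b), (b, a), (c, d), (d, c)}" "t' \<in> {(a, b), (b, a), (c, d), (d, c)}"
      using swap_val[of i] swap_val[of k] unfolding st' by metis+
    then have "s' \<in> {s, t}" "t' \<in> {s, t}" using lt(1,2,4,5) by (auto simp: st)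
    then have "s' = s \<and> t' = t \<or> s' = t \<and> t' = s" using lt(6) by blast
    moreover have "gflip q s t = (t, s)" using ne by (simp add: st)
    ultimately show ?thesis by auto
  qed
qed

section \<open>Paths as sequences of reflections\<close>

type_synonym refl3 = "refl \<times> refl \<times> refl"

text \<open>The condition on the middle label is contained in both \<open>ascent2\<close> conjuncts,
  so that either flip finds its hypothesis as it stands.\<close>

fun label_path :: "nat \<Rightarrow> (nat \<Rightarrow> nat) \<Rightarrow> refl3 \<Rightarrow> bool" where
  "label_path n q (r, s, t) \<longleftrightarrow> r \<in> refl_T n \<and> s \<in> refl_T n \<and> t \<in> refl_T n \<and>
     ascent2 q r s \<and> ascent2 (q \<circ> swap r) s t"

fun vertex_path :: "(nat \<Rightarrow> nat) \<Rightarrow> refl3 \<Rightarrow> (nat \<Rightarrow> nat) list" where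
  "vertex_path u (r, s, t) =
     [u, swap r \<circ> u, swap s \<circ> (swap r \<circ> u), swap t \<circ> (swap s \<circ> (swap r \<circ> u))]"

fun flip1 :: "(nat \<Rightarrow> nat) \<Rightarrow> refl3 \<Rightarrow> refl3" where
  "flip1 q (r, s, t) = (fst (gflip q r s), snd (gflip q r s), t)"

fun flip2 :: "(nat \<Rightarrow> nat) \<Rightarrow> refl3 \<Rightarrow> refl3" where
  "flip2 q (r, s, t) = (r, fst (gflip (q \<circ> swap r) s t), snd (gflip (q \<circ> swap r) s t))"

lemma inj_pos: "x permutes S \<Longrightarrow> inj (pos x)"
  by (intro permutes_inj permutes_inv)

lemma pos_swap_comp: "x permutes S \<Longrightarrow> pos (swap t \<circ> x) = pos x \<circ> swap t"
  by (rule inv_transpose_comp)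

lemma swap_comp_permutes: "x permutes {1..n} \<Longrightarrow> t \<in> refl_T n \<Longrightarrow> swap t \<circ> x permutes {1..n}"
  by (intro permutes_compose permutes_swap_id) (auto simp: refl_T_def)

lemma bedge_iff_ascent:
  "bedge n x t y \<longleftrightarrow> x permutes {1..n} \<and> t \<in> refl_T n \<and> ascent (pos x) t \<and> y = swap t \<circ> x"
  using bedge_iff[of n x "fst t" "snd t" y] by (auto simp: refl_T_def ascent_def)

lemma swap_comp_inject:
  assumes "x permutes S" "fst s < snd s" "fst t < snd t" "swap s \<circ> x = swap t \<circ> x"
  shows "s = t"
proof -
  have "swap s = swap t"
    using assms(4) surj_fun_eq[of x UNIV "swap s" "swap t"] permutes_surj[OF assms(1)]
    by metis
  then show ?thesis using swap_inject assms(2,3) by blast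
qed

lemma elabel_swap:
  assumes "x permutes {1..n}" "t \<in> refl_T n" "ascent (pos x) t"
  shows "elabel n x (swap t \<circ> x) = t"
  unfolding elabel_def bedge_iff_ascent
  using assms by (intro the_equality) (auto intro!: swap_comp_inject[of x "{1..n}"] simp: ascent_def)

lemma gflip_refl_T:
  assumes "x permutes {1..n}" "s \<in> refl_T n" "t \<in> refl_T n" "ascent2 (pos x) s t"
  shows "fst (gflip (pos x) s t) \<in> refl_T n \<and> snd (gflip (pos x) s t) \<in> refl_T n"
proof -
  obtain s' t' where g: "gflip (pos x) s t = (s', t')" by (cases "gflip (pos x) s t")
  have "ascent2 (pos x) s' t'" "{fst s', snd s', fst t', snd t'} = {fst s, snd s, fst t, snd t}"
    using gflip_ascent2[OF inj_pos[OF assms(1)] assms(4) g] by auto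
  moreover have "{fst s, snd s, fst t, snd t} \<subseteq> {1..n}" using assms(2,3) by (auto simp: refl_T_def)
  ultimately have "ascent2 (pos x) s' t'" "{fst s', snd s', fst t', snd t'} \<subseteq> {1..n}" by simp_all
  then show ?thesis unfolding g by (cases s'; cases t') (auto simp: refl_T_def ascent2_iff)
qed

text \<open>The other middle vertex exists by \<open>gflip_ascent2\<close> and is unique by
  \<open>gflip_unique\<close>; together they evaluate the definite description in
  \<open>flip\<close>.\<close>

lemma flip_swap:
  assumes x: "x permutes {1..n}" and st: "s \<in> refl_T n" "t \<in> refl_T n" "ascent2 (pos x) s t"
    and g: "gflip (pos x) s t = (s', t')"
  shows "flip n x (swap s \<circ> x) (swap t \<circ> (swap s \<circ> x)) = swap s' \<circ> x"
  unfolding flip_def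
proof (rule the_equality)
  have st': "s' \<in> refl_T n" "t' \<in> refl_T n" using gflip_refl_T[OF x st] g by auto
  have fl: "ascent2 (pos x) s' t'" "swap t' \<circ> swap s' = swap t \<circ> swap s" "s' \<noteq> s"
    using gflip_ascent2[OF inj_pos[OF x] st(3) g] by auto
  have lt: "fst s < snd s" "fst s' < snd s'"
    using st(3) fl(1) by (auto simp: ascent2_def ascent_def)
  have "swap s' \<circ> x \<noteq> swap s \<circ> x" using swap_comp_inject[OF x lt(2,1)] fl(3) by blast
  moreover have "bedge n x s' (swap s' \<circ> x)"
    using x st' fl(1) unfolding bedge_iff_ascent ascent2_def by blast
  moreover have "swap t \<circ> (swap s \<circ> x) = swap t' \<circ> (swap s' \<circ> x)"
    using fl(2) by (metis comp_assoc)
  then have "bedge n (swap s' \<circ> x) t' (swap t \<circ> (swap s \<circ> x))"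
    using x st' fl(1) swap_comp_permutes[OF x st'(1)]
    unfolding bedge_iff_ascent ascent2_def pos_swap_comp[OF x] by blast
  ultimately show "swap s' \<circ> x \<noteq> swap s \<circ> x \<and> bgraph_edge n x (swap s' \<circ> x) \<and>
      bgraph_edge n (swap s' \<circ> x) (swap t \<circ> (swap s \<circ> x))"
    unfolding bgraph_edge_def by blast
next
  fix y assume y: "y \<noteq> swap s \<circ> x \<and> bgraph_edge n x y \<and> bgraph_edge n y (swap t \<circ> (swap s \<circ> x))"
  then obtain i j where i: "i \<in> refl_T n" "ascent (pos x) i" "y = swap i \<circ> x"
    and j: "ascent (pos y) j" "swap t \<circ> (swap s \<circ> x) = swap j \<circ> y"
    unfolding bgraph_edge_def bedge_iff_ascent by blast
  have asc: "ascent2 (pos x) i j"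
    using i j(1) unfolding ascent2_def by (simp only: pos_swap_comp[OF x] simp_thms)
  have "swap j \<circ> swap i = swap t \<circ> swap s"
  proof
    fix a
    obtain b where "a = x b" using permutes_surj[OF x] by (metis surjD)
    then show "(swap j \<circ> swap i) a = (swap t \<circ> swap s) a"
      using fun_cong[OF j(2), of b] i(3) by simp
  qed
  from gflip_unique[OF st(3) asc this] show "y = swap s' \<circ> x"
    using y i(3) by (auto simp: g)
qed

lemma label_path_flip1:
  assumes "u permutes {1..n}" "label_path n (pos u) p"
  shows "label_path n (pos u) (flip1 (pos u) p)"
    and "flip_op n 1 (vertex_path u p) = vertex_path u (flip1 (pos u) p)"
    and "flip1 (pos u) (flip1 (pos u) p) = p"
    and "fst (flip1 (pos u) p) \<noteq> fst p"
    and "snd (snd (flip1 (pos u) p)) = snd (snd p)"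
proof -
  obtain r s t where p: "p = (r, s, t)" by (cases p)
  obtain r' s' where g: "gflip (pos u) r s = (r', s')" by (cases "gflip (pos u) r s")
  have lp: "r \<in> refl_T n" "s \<in> refl_T n" "t \<in> refl_T n" "ascent2 (pos u) r s"
      "ascent2 (pos u \<circ> swap r) s t"
    using assms(2) unfolding p by auto
  have fl: "ascent2 (pos u) r' s'" "swap s' \<circ> swap r' = swap s \<circ> swap r" "r' \<noteq> r"
    "gflip (pos u) r' s' = (r, s)"
    using gflip_ascent2[OF inj_pos[OF assms(1)] lp(4) g] by auto
  have T: "r' \<in> refl_T n" "s' \<in> refl_T n" using gflip_refl_T[OF assms(1) lp(1,2,4)] g by auto
  \<comment> \<open>Position functions compose on the other side, so the equality of products is
    inverted; each swap is its own inverse.\<close>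
  have inv: "swap r \<circ> swap s = swap r' \<circ> swap s'"
    using arg_cong[OF fl(2), of "inv_into UNIV"] by (simp add: o_inv_distrib del: o_apply)
  have "pos u \<circ> swap r \<circ> swap s = pos u \<circ> swap r' \<circ> swap s'"
    using inv by (metis comp_assoc)
  then have "ascent2 (pos u \<circ> swap r') s' t" using lp(5) fl(1) unfolding ascent2_def by simp
  then show "label_path n (pos u) (flip1 (pos u) p)"
    using T fl lp by (simp add: p g)
  have "swap s' \<circ> (swap r' \<circ> u) = swap s \<circ> (swap r \<circ> u)" using fl(2) by (metis comp_assoc)
  then show "flip_op n 1 (vertex_path u p) = vertex_path u (flip1 (pos u) p)"
    using flip_swap[OF assms(1) lp(1,2,4) g] by (simp add: p g flip_op_def)
  show "flip1 (pos u) (flip1 (pos u) p) = p" by (simp add: p g fl)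
  show "fst (flip1 (pos u) p) \<noteq> fst p" by (simp add: p g fl)
  show "snd (snd (flip1 (pos u) p)) = snd (snd p)" by (simp add: p)
qed

lemma label_path_flip2:
  assumes "u permutes {1..n}" "label_path n (pos u) p"
  shows "label_path n (pos u) (flip2 (pos u) p)"
    and "flip_op n 2 (vertex_path u p) = vertex_path u (flip2 (pos u) p)"
    and "flip2 (pos u) (flip2 (pos u) p) = p"
    and "snd (snd (flip2 (pos u) p)) \<noteq> snd (snd p)"
    and "fst (flip2 (pos u) p) = fst p"
proof -
  obtain r s t where p: "p = (r, s, t)" by (cases p)
  define x where "x = swap r \<circ> u"
  have lp: "r \<in> refl_T n" "s \<in> refl_T n" "t \<in> refl_T n" "ascent2 (pos u) r s"
      "ascent2 (pos u \<circ> swap r) s t"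
    using assms(2) unfolding p by auto
  have x: "x permutes {1..n}" unfolding x_def by (rule swap_comp_permutes[OF assms(1) lp(1)])
  have pos: "pos u \<circ> swap r = pos x" unfolding x_def by (rule pos_swap_comp[OF assms(1), symmetric])
  obtain s' t' where g: "gflip (pos x) s t = (s', t')" by (cases "gflip (pos x) s t")
  note lp = lp[unfolded pos]
  have fl: "ascent2 (pos x) s' t'" "swap t' \<circ> swap s' = swap t \<circ> swap s" "t' \<noteq> t"
    "gflip (pos x) s' t' = (s, t)"
    using gflip_ascent2[OF inj_pos[OF x] lp(5) g] by auto
  have T: "s' \<in> refl_T n" "t' \<in> refl_T n" using gflip_refl_T[OF x lp(2,3,5)] g by auto
  have "ascent2 (pos u) r s'" using lp(4) fl(1) unfolding ascent2_def pos by simp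
  then show "label_path n (pos u) (flip2 (pos u) p)"
    using T fl lp by (simp add: p g pos)
  have "swap t' \<circ> (swap s' \<circ> x) = swap t \<circ> (swap s \<circ> x)" using fl(2) by (metis comp_assoc)
  then show "flip_op n 2 (vertex_path u p) = vertex_path u (flip2 (pos u) p)"
    using flip_swap[OF x lp(2,3,5) g] by (simp add: p g pos flip_op_def x_def[symmetric] eval_nat_numeral)
  show "flip2 (pos u) (flip2 (pos u) p) = p" by (simp add: p g fl pos)
  show "snd (snd (flip2 (pos u) p)) \<noteq> snd (snd p)" by (simp add: p g fl pos)
  show "fst (flip2 (pos u) p) = fst p" by (simp add: p)
qed

text \<open>The position function of each later vertex is \<open>pos u\<close> composed with the
  labels so far, so conditions along the path become conditions on \<open>pos u\<close>
  alone.\<close>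

lemma bpaths_3_eq:
  assumes u: "u permutes {1..n}"
  shows "bpaths n 3 u v = {vertex_path u p |p. label_path n (pos u) p \<and> last (vertex_path u p) = v}"
proof (intro equalityI subsetI)
  fix xs assume xs: "xs \<in> bpaths n 3 u v"
  then obtain x y z where xyz: "xs = [u, x, y, z]" "z = v"
    by (auto simp: bpaths_def eval_nat_numeral length_Suc_conv)
  have e: "bgraph_edge n u x" "bgraph_edge n x y" "bgraph_edge n y z"
    using xs by (auto simp: bpaths_def xyz(1) eval_nat_numeral less_Suc_eq all_conj_distrib)
  then obtain r s t where b: "bedge n u r x" "bedge n x s y" "bedge n y t z"
    by (auto simp: bgraph_edge_def)
  have x: "x permutes {1..n}" "x = swap r \<circ> u" "pos x = pos u \<circ> swap r"
    using b unfolding bedge_iff_ascent using pos_swap_comp[OF u] by auto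
  have y: "y permutes {1..n}" "y = swap s \<circ> x" "pos y = pos u \<circ> swap r \<circ> swap s"
    using b x(3) unfolding bedge_iff_ascent using pos_swap_comp[OF x(1)] by auto
  have "label_path n (pos u) (r, s, t)"
    using b x y unfolding bedge_iff_ascent ascent2_def label_path.simps by auto
  moreover have "xs = vertex_path u (r, s, t)"
    using b unfolding bedge_iff_ascent by (simp add: xyz(1) x y)
  moreover have last_v: "last xs = v" using xyz by simp
  ultimately show "xs \<in> {vertex_path u p |p. label_path n (pos u) p \<and> last (vertex_path u p) = v}"
    using last_v by blast
next
  fix xs assume "xs \<in> {vertex_path u p |p. label_path n (pos u) p \<and> last (vertex_path u p) = v}"
  then obtain r s t where lp: "label_path n (pos u) (r, s, t)" and xs: "xs = vertex_path u (r, s, t)"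
    and v: "last (vertex_path u (r, s, t)) = v" by auto
  have x: "swap r \<circ> u permutes {1..n}" using lp by (intro swap_comp_permutes u) auto
  have y: "swap s \<circ> (swap r \<circ> u) permutes {1..n}" using lp by (intro swap_comp_permutes x) auto
  have "bedge n u r (swap r \<circ> u)" "bedge n (swap r \<circ> u) s (swap s \<circ> (swap r \<circ> u))"
    "bedge n (swap s \<circ> (swap r \<circ> u)) t (swap t \<circ> (swap s \<circ> (swap r \<circ> u)))"
    using lp u x y unfolding bedge_iff_ascent pos_swap_comp[OF x] pos_swap_comp[OF u]
    by (auto simp: ascent2_def)
  then have "bgraph_edge n u (swap r \<circ> u)" "bgraph_edge n (swap r \<circ> u) (swap s \<circ> (swap r \<circ> u))"
    "bgraph_edge n (swap s \<circ> (swap r \<circ> u)) (swap t \<circ> (swap s \<circ> (swap r \<circ> u)))"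
    unfolding bgraph_edge_def by blast+
  then show "xs \<in> bpaths n 3 u v"
    using v by (auto simp: bpaths_def xs eval_nat_numeral less_Suc_eq all_conj_distrib)
qed

lemma vertex_path_inject:
  assumes u: "u permutes {1..n}" and p: "label_path n (pos u) p" "label_path n (pos u) p'"
    and eq: "vertex_path u p = vertex_path u p'"
  shows "p = p'"
proof -
  obtain r s t r' s' t' where pp: "p = (r, s, t)" "p' = (r', s', t')" by (cases p; cases p')
  have lt: "fst r < snd r" "fst s < snd s" "fst t < snd t" "fst r' < snd r'" "fst s' < snd s'" "fst t' < snd t'"
    using p by (auto simp: pp refl_T_def)
  have r: "r = r'" using eq swap_comp_inject[OF u lt(1,4)] by (auto simp: pp)
  have x: "swap r \<circ> u permutes {1..n}" using p by (intro swap_comp_permutes u) (auto simp: pp)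
  have s: "s = s'" using eq swap_comp_inject[OF x lt(2,5)] by (auto simp: pp r)
  have y: "swap s \<circ> (swap r \<circ> u) permutes {1..n}" using p by (intro swap_comp_permutes x) (auto simp: pp)
  have "t = t'" using eq swap_comp_inject[OF y lt(3,6)] by (auto simp: pp r s)
  then show ?thesis by (simp add: pp r s)
qed

lemma vlabels_vertex_path:
  assumes u: "u permutes {1..n}" and p: "label_path n (pos u) (r, s, t)"
  shows "vlabels n (vertex_path u (r, s, t)) = [r, s, t]"
proof -
  have x: "swap r \<circ> u permutes {1..n}" using p by (intro swap_comp_permutes u) auto
  have y: "swap s \<circ> (swap r \<circ> u) permutes {1..n}" using p by (intro swap_comp_permutes x) auto
  have "elabel n u (swap r \<circ> u) = r"
    "elabel n (swap r \<circ> u) (swap s \<circ> (swap r \<circ> u)) = s"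
    "elabel n (swap s \<circ> (swap r \<circ> u)) (swap t \<circ> (swap s \<circ> (swap r \<circ> u))) = t"
    using p by (auto intro!: elabel_swap u x y simp: pos_swap_comp[OF x] pos_swap_comp[OF u] ascent2_def
      simp del: o_apply)
  then show ?thesis by (simp add: vlabels_def upt_rec eval_nat_numeral)
qed

section \<open>Groups generated by two involutions\<close>

text \<open>The rotation is \<open>a \<otimes> b\<close>; it is inverted by \<open>b\<close>, so
  every element is a power of it, possibly times \<open>b\<close>. Nontriviality of \<open>a\<close>
  and \<open>b\<close> keeps \<open>b\<close> out of the rotations, which makes the order exactly
  \<open>2 m\<close>. The case \<open>a = b\<close> is covered with \<open>m = 1\<close>.\<close>

lemma (in group) is_dihedral_generate:
  assumes fin: "finite (carrier G)" and ab: "a \<in> carrier G" "b \<in> carrier G"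
    and inv: "a \<otimes> a = \<one>" "b \<otimes> b = \<one>" and ne: "a \<noteq> \<one>" "b \<noteq> \<one>"
  shows "is_dihedral (G\<lparr>carrier := generate G {a, b}\<rparr>)"
proof -
  define \<rho> where "\<rho> = a \<otimes> b"
  define m where "m = ord \<rho>"
  have \<rho>: "\<rho> \<in> carrier G" using ab by (simp add: \<rho>_def)
  have m: "m \<ge> 1" unfolding m_def by (rule ord_ge_1[OF fin \<rho>])
  have \<rho>m: "\<rho> [^] m = \<one>" unfolding m_def using \<rho> by simp
  have pow: "\<rho> [^] (i::nat) \<in> carrier G" for i using \<rho> by simp
  have powmod: "\<rho> [^] (i mod m) = \<rho> [^] i" for i
  proof -
    have "\<rho> [^] i = \<rho> [^] (m * (i div m) + i mod m)" by simp
    also have "\<dots> = (\<rho> [^] m) [^] (i div m) \<otimes> \<rho> [^] (i mod m)"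
      using \<rho> by (simp only: nat_pow_mult[symmetric] nat_pow_pow)
    finally show ?thesis using \<rho>m pow by simp
  qed
  have bb: "b \<otimes> (b \<otimes> x) = x" if "x \<in> carrier G" for x
    using that ab inv by (simp add: m_assoc[symmetric])
  have brho: "\<rho> \<otimes> b \<otimes> \<rho> = b"
  proof -
    have "\<rho> \<otimes> b \<otimes> \<rho> = a \<otimes> (b \<otimes> b) \<otimes> (a \<otimes> b)" using ab by (simp add: \<rho>_def m_assoc)
    also have "\<dots> = (a \<otimes> a) \<otimes> b" using ab inv(2) by (simp add: m_assoc)
    finally show ?thesis using ab inv(1) by simp
  qed
  \<comment> \<open>This says that \<open>b\<close> inverts the powers of \<open>\<rho>\<close>,
    written without inverses so that the induction can use \<open>brho\<close> directly.\<close>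
  have conj: "\<rho> [^] (i::nat) \<otimes> (b \<otimes> \<rho> [^] i) = b" for i
  proof (induction i)
    case (Suc i)
    have com: "\<rho> [^] i \<otimes> \<rho> = \<rho> \<otimes> \<rho> [^] i" using nat_pow_Suc2[OF \<rho>, of i] by simp
    have "\<rho> [^] Suc i \<otimes> (b \<otimes> \<rho> [^] Suc i) = (\<rho> [^] i \<otimes> \<rho>) \<otimes> (b \<otimes> (\<rho> \<otimes> \<rho> [^] i))"
      by (simp add: com)
    also have "\<dots> = \<rho> [^] i \<otimes> (\<rho> \<otimes> b \<otimes> \<rho>) \<otimes> \<rho> [^] i"
      using \<rho> ab pow by (simp add: m_assoc)
    also have "\<dots> = b" using Suc ab pow by (simp add: brho m_assoc)
    finally show ?case .
  qed (use ab in simp)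
  have brefl: "b \<otimes> \<rho> [^] j = \<rho> [^] (m - j) \<otimes> b" if "j < m" for j
  proof -
    have "\<rho> [^] (m - j) \<otimes> b = \<rho> [^] (m - j) \<otimes> (\<rho> [^] j \<otimes> (b \<otimes> \<rho> [^] j))" by (simp add: conj)
    also have "\<dots> = \<rho> [^] (m - j + j) \<otimes> (b \<otimes> \<rho> [^] j)"
      using pow ab \<rho> by (simp only: nat_pow_mult[symmetric] m_assoc m_closed)
    also have "\<dots> = b \<otimes> \<rho> [^] j" using that ab pow by (simp add: \<rho>m)
    finally show ?thesis by simp
  qed
  define \<phi> where "\<phi> = (\<lambda>(i::nat, e). \<rho> [^] i \<otimes> (if e then b else \<one>))"
  let ?D = "dihedral_group m"
  have D: "carrier ?D = {0..<m} \<times> UNIV" by (simp add: dihedral_group_def)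
  have \<phi>_closed: "\<phi> p \<in> carrier G" for p using pow ab by (cases p) (auto simp: \<phi>_def)
  have D_closed: "p \<otimes>\<^bsub>?D\<^esub> q \<in> carrier ?D" if "p \<in> carrier ?D" "q \<in> carrier ?D" for p q
    using m that by (cases p; cases q) (auto simp: dihedral_group_def)
  have \<phi>_mult: "\<phi> (p \<otimes>\<^bsub>?D\<^esub> q) = \<phi> p \<otimes> \<phi> q" if p: "p \<in> carrier ?D" and q: "q \<in> carrier ?D" for p q
  proof -
    obtain i e j f where pq: "p = (i, e)" "q = (j, f)" by (cases p; cases q)
    have j: "j < m" "i < m" using p q by (auto simp: D pq)
    show ?thesis
    proof (cases e)
      case False
      then show ?thesis using pow ab \<rho>
        by (simp add: pq dihedral_group_def \<phi>_def powmod nat_pow_mult[symmetric] m_assoc)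
    next
      case True
      have split_pow: "\<rho> [^] (i + m - j) = \<rho> [^] i \<otimes> \<rho> [^] (m - j)"
        using nat_pow_mult[OF \<rho>, of i "m - j"] j by simp
      have "\<phi> p \<otimes> \<phi> q = \<rho> [^] i \<otimes> (b \<otimes> \<rho> [^] j) \<otimes> (if f then b else \<one>)"
        using True pow ab by (simp add: pq \<phi>_def m_assoc)
      also have "\<dots> = \<rho> [^] (i + m - j) \<otimes> (b \<otimes> (if f then b else \<one>))"
        using j pow ab \<rho> by (simp add: brefl m_assoc split_pow)
      also have "\<dots> = \<phi> (p \<otimes>\<^bsub>?D\<^esub> q)"
        using True j pow ab inv by (simp add: pq dihedral_group_def \<phi>_def powmod)
      finally show ?thesis by simp
    qed
  qed
  \<comment> \<open>A power of \<open>\<rho>\<close> commutes with \<open>\<rho>\<close>, while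
    \<open>b\<close> inverts it. So \<open>\<rho>\<close> would square to one, and \<open>b\<close>
    would be \<open>\<one>\<close> or \<open>\<rho>\<close>, the latter forcing
    \<open>a = \<one>\<close>.\<close>
  have bnot: "b \<noteq> \<rho> [^] (k::nat)" for k
  proof
    assume b: "b = \<rho> [^] k"
    then have "b \<otimes> \<rho> = \<rho> \<otimes> b" using \<rho> by (simp add: nat_pow_mult nat_pow_Suc2[symmetric])
    then have "\<rho> \<otimes> (\<rho> \<otimes> b) = b" using brho \<rho> ab by (simp add: m_assoc)
    then have "(\<rho> \<otimes> \<rho>) \<otimes> b = \<one> \<otimes> b" using \<rho> ab by (simp add: m_assoc)
    then have "\<rho> \<otimes> \<rho> = \<one>" using \<rho> ab by (metis m_closed one_closed right_cancel)
    then have "\<rho> [^] (2::nat) = \<one>" using \<rho> by (simp add: numeral_2_eq_2)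
    then have "\<rho> [^] k = \<rho> [^] (k mod 2)"
    proof -
      have "\<rho> [^] k = \<rho> [^] (2 * (k div 2) + k mod 2)" by simp
      also have "\<dots> = (\<rho> [^] (2::nat)) [^] (k div 2) \<otimes> \<rho> [^] (k mod 2)"
        using \<rho> by (simp only: nat_pow_mult[symmetric] nat_pow_pow)
      finally show ?thesis using \<open>\<rho> [^] (2::nat) = \<one>\<close> pow by simp
    qed
    then have "b = \<one> \<or> b = \<rho>" using b \<rho> by (cases "k mod 2 = 0") (auto simp: mod2_eq_if)
    then have "b = a \<otimes> b" using ne by (simp add: \<rho>_def)
    then have "\<one> \<otimes> b = a \<otimes> b" using ab by simp
    then have "\<one> = a" using ab by (metis one_closed right_cancel)
    then show False using ne by simp
  qed
  have \<phi>_inj: "inj_on \<phi> (carrier ?D)"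
  proof (rule inj_onI)
    fix p q assume pq: "p \<in> carrier ?D" "q \<in> carrier ?D" "\<phi> p = \<phi> q"
    obtain i e j f where p: "p = (i, e)" and q: "q = (j, f)" by (cases p; cases q)
    have ij: "i < m" "j < m" using pq by (auto simp: D p q)
    have eq: "\<rho> [^] i \<otimes> (if e then b else \<one>) = \<rho> [^] j \<otimes> (if f then b else \<one>)"
      using pq(3) by (simp add: p q \<phi>_def)
    have bnot': "\<rho> [^] i' \<otimes> b \<noteq> \<rho> [^] j'" if "i' < m" for i' j' :: nat
    proof
      assume "\<rho> [^] i' \<otimes> b = \<rho> [^] j'"
      then have "\<rho> [^] (m - i') \<otimes> (\<rho> [^] i' \<otimes> b) = \<rho> [^] (m - i' + j')"
        using \<rho> by (simp add: nat_pow_mult)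
      moreover have "\<rho> [^] (m - i') \<otimes> (\<rho> [^] i' \<otimes> b) = b"
        using that \<rho> ab pow \<rho>m by (simp add: m_assoc[symmetric] nat_pow_mult)
      ultimately show False using bnot by simp
    qed
    have ef: "e = f" using eq bnot'[of i j] bnot'[of j i] ij pow by (cases e; cases f) auto
    then have "\<rho> [^] i = \<rho> [^] j" using eq pow ab by (cases e) auto
    moreover have "i \<in> {0..ord \<rho> - 1}" "j \<in> {0..ord \<rho> - 1}" using ij by (auto simp: m_def)
    ultimately have "i = j" using inj_onD[OF ord_inj[OF \<rho>]] by blast
    then show "p = q" using ef by (simp add: p q)
  qed
  have img: "\<phi> ` carrier ?D = generate G {a, b}"
  proof
    have b_gen: "b \<in> generate G {a, b}" and a_gen: "a \<in> generate G {a, b}"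
      by (auto intro: generate.incl)
    have \<rho>_gen: "\<rho> [^] (i::nat) \<in> generate G {a, b}" for i
      by (induction i) (auto intro: generate.one generate.eng b_gen a_gen simp: \<rho>_def)
    show "\<phi> ` carrier ?D \<subseteq> generate G {a, b}"
      by (auto simp: \<phi>_def intro!: generate.eng \<rho>_gen b_gen generate.one)
    have b_img: "b \<in> \<phi> ` carrier ?D"
      using m ab by (intro image_eqI[of _ _ "(0, True)"]) (auto simp: \<phi>_def D)
    have a_img: "a \<in> \<phi> ` carrier ?D"
    \<comment> \<open>\<open>a\<close> is \<open>\<rho> \<otimes> b\<close>; the exponent is reduced
      because for \<open>m = 1\<close>, that is \<open>a = b\<close>, it has to be 0.\<close>
    proof (rule image_eqI[of _ _ "(1 mod m, True)"])
      have "\<rho> [^] (1 mod m) \<otimes> b = \<rho> \<otimes> b" unfolding powmod using \<rho> by simp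
      then show "a = \<phi> (1 mod m, True)" using ab inv by (simp add: \<phi>_def) (simp add: \<rho>_def m_assoc)
    qed (use m in \<open>simp add: D\<close>)
    have one_img: "\<one> \<in> \<phi> ` carrier ?D"
      using m by (intro image_eqI[of _ _ "(0, False)"]) (auto simp: \<phi>_def D)
    show "generate G {a, b} \<subseteq> \<phi> ` carrier ?D"
    proof
      fix x assume "x \<in> generate G {a, b}"
      then show "x \<in> \<phi> ` carrier ?D"
      proof (induction rule: generate.induct)
        case (inv h)
        then have "inv h = h" using ab assms(4,5) by (auto intro: inv_equality)
        then show ?case using inv a_img b_img by auto
      next
        case (eng h1 h2)
        then obtain p q where pq: "p \<in> carrier ?D" "q \<in> carrier ?D" "h1 = \<phi> p" "h2 = \<phi> q" by blast
        then show ?case using \<phi>_mult[of p q] D_closed[of p q] by (metis imageI)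
      qed (use a_img b_img one_img in auto)
    qed
  qed
  let ?\<psi> = "inv_into (carrier ?D) \<phi>"
  have "?\<psi> \<in> iso (G\<lparr>carrier := generate G {a, b}\<rparr>) ?D"
  proof (rule isoI)
    show bij: "bij_betw ?\<psi> (carrier (G\<lparr>carrier := generate G {a, b}\<rparr>)) (carrier ?D)"
      using bij_betw_inv_into[OF bij_betw_imageI[OF \<phi>_inj refl]] by (simp add: img)
    show "?\<psi> \<in> hom (G\<lparr>carrier := generate G {a, b}\<rparr>) ?D"
    proof (rule homI)
      fix x y assume "x \<in> carrier (G\<lparr>carrier := generate G {a, b}\<rparr>)"
        "y \<in> carrier (G\<lparr>carrier := generate G {a, b}\<rparr>)"
      then have "x \<in> \<phi> ` carrier ?D" "y \<in> \<phi> ` carrier ?D" unfolding img by simp_all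
      then obtain p q where pq: "p \<in> carrier ?D" "q \<in> carrier ?D" "x = \<phi> p" "y = \<phi> q"
        by blast
      then have "x \<otimes>\<^bsub>G\<lparr>carrier := generate G {a, b}\<rparr>\<^esub> y = \<phi> (p \<otimes>\<^bsub>?D\<^esub> q)" by (simp add: \<phi>_mult)
      then show "?\<psi> (x \<otimes>\<^bsub>G\<lparr>carrier := generate G {a, b}\<rparr>\<^esub> y) = ?\<psi> x \<otimes>\<^bsub>?D\<^esub> ?\<psi> y"
        using pq D_closed by (simp add: inv_into_f_f[OF \<phi>_inj])
    qed (use bij in \<open>auto simp: bij_betw_def\<close>)
  qed
  then show ?thesis using m unfolding is_dihedral_def is_iso_def by blast
qed

section \<open>Crowns\<close>

lemma digraph_iso_image:
  assumes h: "bij_betw h V2 V1" and E2: "E2 \<subseteq> V2 \<times> V2" and E1: "E1 = map_prod h h ` E2"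
  shows "digraph_iso V1 E1 V2 E2"
  unfolding digraph_iso_def
proof (intro exI conjI ballI)
  show "bij_betw (inv_into V2 h) V1 V2" by (rule bij_betw_inv_into[OF h])
  fix x y assume "x \<in> V1" "y \<in> V1"
  then obtain a b where ab: "a \<in> V2" "b \<in> V2" "x = h a" "y = h b"
    using h by (auto simp: bij_betw_def)
  have inj: "inj_on h V2" using h by (simp add: bij_betw_def)
  have "(x, y) \<in> E1 \<longleftrightarrow> (a, b) \<in> E2"
  proof
    assume "(x, y) \<in> E1"
    then obtain c d where cd: "(c, d) \<in> E2" "h c = h a" "h d = h b" unfolding E1 ab by auto
    then have "c = a" "d = b" using E2 ab(1,2) inj_onD[OF inj] by blast+
    then show "(a, b) \<in> E2" using cd by simp
  qed (force simp: E1 ab)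
  then show "(x, y) \<in> E1 \<longleftrightarrow> (inv_into V2 h x, inv_into V2 h y) \<in> E2"
    using ab inj by simp
qed

text \<open>A crown on vertices of any type, so that the support graph and the time-support graph
  are two instances of it.\<close>

definition crown_edges :: "'v \<Rightarrow> (nat \<Rightarrow> 'v) \<Rightarrow> (nat \<Rightarrow> 'v) \<Rightarrow> 'v \<Rightarrow> nat \<Rightarrow> ('v \<times> 'v) set" where
  "crown_edges A X Y B k = {(A, X j) | j. j < k} \<union> {(X j, Y j) | j. j < k} \<union>
     {(X j, Y (Suc j mod k)) | j. j < k} \<union> {(Y j, B) | j. j < k}"

text \<open>A middle edge extends to exactly one path from bottom to top, so these edges parametrize
  the paths of the flipclass.\<close>

definition crown_middle :: "(nat \<Rightarrow> 'v) \<Rightarrow> (nat \<Rightarrow> 'v) \<Rightarrow> nat \<Rightarrow> ('v \<times> 'v) set" where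
  "crown_middle X Y k = {(X j, Y j) | j. j < k} \<union> {(X j, Y (Suc j mod k)) | j. j < k}"

definition crown_vertices_distinct :: "'v \<Rightarrow> (nat \<Rightarrow> 'v) \<Rightarrow> (nat \<Rightarrow> 'v) \<Rightarrow> 'v \<Rightarrow> nat \<Rightarrow> bool" where
  "crown_vertices_distinct A X Y B k \<longleftrightarrow> 0 < k \<and> inj_on X {..<k} \<and> inj_on Y {..<k} \<and> A \<noteq> B \<and>
     (\<forall>i<k. X i \<noteq> A \<and> X i \<noteq> B \<and> Y i \<noteq> A \<and> Y i \<noteq> B) \<and> (\<forall>i<k. \<forall>j<k. X i \<noteq> Y j)"

lemma crown_edges_iso:
  assumes "crown_vertices_distinct A X Y B k"
  shows "digraph_iso ({A, B} \<union> X ` {..<k} \<union> Y ` {..<k}) (crown_edges A X Y B k) (crown_V k) (crown_E k)"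
proof -
  define h where "h = (\<lambda>(i::nat, j). if i = 0 then A else if i = 1 then X j else if i = 2 then Y j else B)"
  have h: "h (0, j) = A" "h (1, j) = X j" "h (Suc 0, j) = X j" "h (2, j) = Y j" "h (3, j) = B" for j
    by (simp_all add: h_def)
  have k: "0 < k" and ne: "A \<noteq> B" "\<And>i. i < k \<Longrightarrow> X i \<noteq> A \<and> X i \<noteq> B \<and> Y i \<noteq> A \<and> Y i \<noteq> B"
    "\<And>i j. i < k \<Longrightarrow> j < k \<Longrightarrow> X i \<noteq> Y j"
    and inj: "inj_on X {..<k}" "inj_on Y {..<k}"
    using assms by (auto simp: crown_vertices_distinct_def)
  have m: "Suc j mod k < k" for j using k by simp
  have V: "crown_V k = {(0, 0), (3, 0)} \<union> Pair 1 ` {..<k} \<union> Pair 2 ` {..<k}"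
    by (auto simp: crown_V_def)
  have "inj_on h (crown_V k)"
  proof (rule inj_onI)
    fix p q assume pq: "p \<in> crown_V k" "q \<in> crown_V k" and eq: "h p = h q"
    have ne': "\<And>i. i < k \<Longrightarrow> A \<noteq> X i \<and> B \<noteq> X i \<and> A \<noteq> Y i \<and> B \<noteq> Y i"
      "\<And>i j. i < k \<Longrightarrow> j < k \<Longrightarrow> Y j \<noteq> X i" "B \<noteq> A" using ne by metis+
    have inj': "\<And>i j. i < k \<Longrightarrow> j < k \<Longrightarrow> X i = X j \<longleftrightarrow> i = j"
      "\<And>i j. i < k \<Longrightarrow> j < k \<Longrightarrow> Y i = Y j \<longleftrightarrow> i = j"
      using inj by (simp_all add: inj_on_eq_iff)
    have V': "r = (0, 0) \<or> r = (3, 0) \<or> (\<exists>j<k. r = (1, j)) \<or> (\<exists>j<k. r = (2, j))"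
      if "r \<in> crown_V k" for r using that unfolding V by blast
    show "p = q"
      using V'[OF pq(1)] V'[OF pq(2)] eq
      by (elim disjE exE conjE; simp only: h ne ne' inj' simp_thms)
  qed
  moreover have "h ` crown_V k = {A, B} \<union> X ` {..<k} \<union> Y ` {..<k}"
    by (simp only: V image_Un image_insert image_empty image_image h)
  ultimately have "bij_betw h (crown_V k) ({A, B} \<union> X ` {..<k} \<union> Y ` {..<k})"
    by (simp add: bij_betw_def)
  moreover have "crown_E k \<subseteq> crown_V k \<times> crown_V k" unfolding crown_E_def crown_V_def using m by blast
  moreover have "crown_edges A X Y B k = map_prod h h ` crown_E k"
  proof -
    have "crown_E k = (\<lambda>j. ((0, 0), (1, j))) ` {..<k} \<union> (\<lambda>j. ((1, j), (2, j))) ` {..<k}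
       \<union> (\<lambda>j. ((1, j), (2, Suc j mod k))) ` {..<k} \<union> (\<lambda>j. ((2, j), (3, 0))) ` {..<k}"
      unfolding crown_E_def by blast
    then have "map_prod h h ` crown_E k = (\<lambda>j. (A, X j)) ` {..<k} \<union> (\<lambda>j. (X j, Y j)) ` {..<k}
       \<union> (\<lambda>j. (X j, Y (Suc j mod k))) ` {..<k} \<union> (\<lambda>j. (Y j, B)) ` {..<k}"
      by (simp add: image_Un image_image h)
    then show ?thesis unfolding crown_edges_def by blast
  qed
  ultimately show ?thesis by (rule digraph_iso_image)
qed

text \<open>As all vertices are distinct, edges from \<open>A\<close> lead only to some
  \<open>X i\<close> and edges from there only to some \<open>Y j\<close>, so a path is determined
  by its middle edge. Labels are a function \<open>el\<close> of the endpoints and therefore add no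
  further paths.\<close>

lemma lpaths_crown:
  assumes "crown_vertices_distinct A X Y B k"
  shows "lpaths ((\<lambda>(a, b). (a, el a b, b)) ` crown_edges A X Y B k) 3 A B =
    (\<lambda>(x, y). [(A, el A x, x), (x, el x y, y), (y, el y B, B)]) ` crown_middle X Y k" (is "lpaths ?E 3 A B = ?R")
proof (intro equalityI subsetI)
  have k: "0 < k" and ne: "A \<noteq> B" "\<And>i. i < k \<Longrightarrow> X i \<noteq> A \<and> X i \<noteq> B \<and> Y i \<noteq> A \<and> Y i \<noteq> B"
    "\<And>i j. i < k \<Longrightarrow> j < k \<Longrightarrow> X i \<noteq> Y j"
    and inj: "inj_on X {..<k}" "inj_on Y {..<k}"
    using assms by (auto simp: crown_vertices_distinct_def)
  have m: "Suc j mod k < k" for j using k by simp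
  {
    fix es assume es: "es \<in> lpaths ?E 3 A B"
    then obtain e0 e1 e2 where e: "es = [e0, e1, e2]"
      by (auto simp: lpaths_def eval_nat_numeral length_Suc_conv)
    have E: "e0 \<in> ?E" "e1 \<in> ?E" "e2 \<in> ?E" and A: "fst e0 = A" and B: "snd (snd e2) = B"
      and c: "snd (snd e0) = fst e1" "snd (snd e1) = fst e2"
      using es by (auto simp: lpaths_def e eval_nat_numeral less_Suc_eq all_conj_distrib)
    obtain a0 b0 a1 b1 a2 b2 where ab: "e0 = (a0, el a0 b0, b0)" "e1 = (a1, el a1 b1, b1)"
      "e2 = (a2, el a2 b2, b2)" "(a0, b0) \<in> crown_edges A X Y B k" "(a1, b1) \<in> crown_edges A X Y B k"
      "(a2, b2) \<in> crown_edges A X Y B k"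
      using E by auto
    note ab' = ab(4-6)[unfolded crown_edges_def]
    have eqs: "a0 = A" "b2 = B" "a1 = b0" "a2 = b1" using A B c by (auto simp: ab)
    obtain i where i: "i < k" "b0 = X i" using ab'(1) ne m by (auto simp: eqs)
    have "(a1, b1) \<in> crown_middle X Y k"
      using ab'(2) ne m i unfolding eqs crown_middle_def by fastforce
    then show "es \<in> ?R" by (auto simp: e ab eqs intro!: image_eqI[of _ _ "(a1, b1)"])
  next
    fix es assume "es \<in> ?R"
    then obtain x y where xy: "(x, y) \<in> crown_middle X Y k"
      "es = [(A, el A x, x), (x, el x y, y), (y, el y B, B)]" by auto
    have "(A, x) \<in> crown_edges A X Y B k" "(x, y) \<in> crown_edges A X Y B k" "(y, B) \<in> crown_edges A X Y B k"
      using xy(1) m unfolding crown_edges_def crown_middle_def by blast+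
    then have "(A, el A x, x) \<in> ?E" "(x, el x y, y) \<in> ?E" "(y, el y B, B) \<in> ?E" by force+
    then show "es \<in> lpaths ?E 3 A B"
      by (simp add: lpaths_def xy(2) eval_nat_numeral less_Suc_eq all_conj_distrib)
  }
qed

text \<open>The product of the two flips moves the paths \<open>e1\<close> one step backwards and
  the paths \<open>e2\<close> one step forwards. This is why the order is \<open>k\<close> although
  the cycle of single flips has \<open>2 k\<close> steps. Minimality is read off at
  \<open>e2 0\<close>.\<close>

lemma perm_order_on_crown:
  assumes k: "0 < k" and inj: "inj_on e2 {..<k}" and F: "F = e1 ` {..<k} \<union> e2 ` {..<k}"
    and g1: "\<And>j. j < k \<Longrightarrow> g (e1 (Suc j mod k)) = e1 j"
    and g2: "\<And>j. j < k \<Longrightarrow> g (e2 j) = e2 (Suc j mod k)"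
  shows "perm_order_on F g = k"
  unfolding perm_order_on_def
proof (rule Least_equality)
  have p2: "(g ^^ l) (e2 j) = e2 ((j + l) mod k)" if "j < k" for j l
    using that k by (induction l) (auto simp: g2 mod_Suc_eq)
  have p1: "(g ^^ l) (e1 ((j + l) mod k)) = e1 j" if "j < k" for j l
  proof (induction l)
    case (Suc l)
    have "g (e1 ((j + Suc l) mod k)) = e1 ((j + l) mod k)"
      using g1[of "(j + l) mod k"] k by (simp add: mod_Suc_eq)
    then show ?case using Suc by (simp add: funpow_swap1)
  qed (use that in simp)
  show "0 < k \<and> (\<forall>p\<in>F. (g ^^ k) p = p)"
    using k p1[of _ k] p2[of _ k] by (auto simp: F)
  fix l assume l: "0 < l \<and> (\<forall>p\<in>F. (g ^^ l) p = p)"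
  then have "(g ^^ l) (e2 0) = e2 0" using k by (auto simp: F)
  then have "e2 (l mod k) = e2 0" using p2[of 0 l] k by simp
  then have "l mod k = 0" using inj_onD[OF inj] k by simp
  then show "k \<le> l" using l by (auto dest: dvd_imp_le)
qed

text \<open>Every edge of a crown lies on a full path through some middle edge. This gives the edges
  as a union over paths, the shape of \<open>S_E\<close> and \<open>TS_E\<close>.\<close>

lemma crown_edges_middle:
  assumes "0 < k"
  shows "crown_edges A X Y B k = (\<Union>p\<in>crown_middle X Y k. {(A, fst p), p, (snd p, B)})"
proof -
  have m: "Suc j mod k < k" for j using assms by simp
  show ?thesis
  proof (intro equalityI subsetI)
    fix e assume "e \<in> crown_edges A X Y B k"
    then show "e \<in> (\<Union>p\<in>crown_middle X Y k. {(A, fst p), p, (snd p, B)})"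
      unfolding crown_edges_def crown_middle_def by (elim UnE CollectE exE conjE) force+
  next
    fix e assume "e \<in> (\<Union>p\<in>crown_middle X Y k. {(A, fst p), p, (snd p, B)})"
    then show "e \<in> crown_edges A X Y B k"
      unfolding crown_edges_def crown_middle_def using m
      by (elim UN_E UnE CollectE exE conjE insertE emptyE) (simp only: fst_conv snd_conv; blast)+
  qed
qed

lemma unlab_labelled: "unlab ((\<lambda>(a, b). (a, h a b, b)) ` E) = E"
  by (force simp: unlab_def)

text \<open>In the support graph a vertex could a priori occur at two levels, which
  \<open>dist\<close> excludes; in the time-support graph the second coordinate separates the
  levels. \<open>f1\<close> and \<open>f2\<close> say that the first flip moves along the cycle at a
  fixed \<open>Y\<close> and the second one at a fixed \<open>X\<close>.\<close>

lemma crown_flipclass: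
  assumes dist: "crown_vertices_distinct u X Y v k"
    and F: "F = (\<lambda>(x, y). [u, x, y, v]) ` crown_middle X Y k"
    and f1: "\<And>j. j < k \<Longrightarrow> flip_op n 1 [u, X j, Y (Suc j mod k), v] = [u, X (Suc j mod k), Y (Suc j mod k), v]"
       "\<And>j. j < k \<Longrightarrow> flip_op n 1 [u, X (Suc j mod k), Y (Suc j mod k), v] = [u, X j, Y (Suc j mod k), v]"
    and f2: "\<And>j. j < k \<Longrightarrow> flip_op n 2 [u, X j, Y j, v] = [u, X j, Y (Suc j mod k), v]"
       "\<And>j. j < k \<Longrightarrow> flip_op n 2 [u, X j, Y (Suc j mod k), v] = [u, X j, Y j, v]"
  shows "digraph_iso (S_V F) (unlab (S_E n F)) (crown_V k) (crown_E k)"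
    and "digraph_iso (TS_V F) (unlab (TS_E n F)) (crown_V k) (crown_E k)"
    and "k = perm_order_on F (flip_op n 2 \<circ> flip_op n 1)"
    and "bij_betw (i_S n) F (lpaths (S_E n F) 3 u v)"
    and "bij_betw (i_TS n) F (lpaths (TS_E n F) 3 (u, 0) (v, 3))"
proof -
  define X' Y' where "X' = (\<lambda>j. (X j, 1::nat))" and "Y' = (\<lambda>j. (Y j, 2::nat))"
  have k: "0 < k" and ne: "\<And>i. i < k \<Longrightarrow> X i \<noteq> u \<and> X i \<noteq> v \<and> Y i \<noteq> u \<and> Y i \<noteq> v"
    "\<And>i j. i < k \<Longrightarrow> j < k \<Longrightarrow> X i \<noteq> Y j" and inj: "inj_on X {..<k}" "inj_on Y {..<k}"
    using dist by (auto simp: crown_vertices_distinct_def)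
  have m: "Suc j mod k < k" for j using k by simp
  have dist': "crown_vertices_distinct (u, 0) X' Y' (v, 3) k"
    using k inj by (auto simp: crown_vertices_distinct_def X'_def Y'_def inj_on_def)
  define M where "M = crown_middle X Y k"
  have X_img: "X ` {..<k} = fst ` M"
    unfolding M_def crown_middle_def by (force simp: image_iff)
  have Y_img: "Y ` {..<k} = snd ` M"
    unfolding M_def crown_middle_def by (force simp: image_iff m)
  obtain p0 where p0: "p0 \<in> M" using k unfolding M_def crown_middle_def by blast
  have F': "F = (\<lambda>p. [u, fst p, snd p, v]) ` M" unfolding F M_def by (simp add: case_prod_beta)
  have idx: "{i. i < Suc (Suc (Suc (Suc 0)))} = {0, 1, 2, 3}" "{i. i < Suc (Suc (Suc 0))} = {0, 1, 2}"
    by auto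
  have mid: "crown_middle X' Y' k = (\<lambda>p. ((fst p, 1), (snd p, 2))) ` crown_middle X Y k"
    unfolding crown_middle_def X'_def Y'_def image_Un by (intro arg_cong2[of _ _ _ _ "(\<union>)"]) (simp_all add: setcompr_eq_image image_image)
  have SV: "S_V F = {u, v} \<union> X ` {..<k} \<union> Y ` {..<k}"
  proof -
    have "S_V F = (\<Union>xs\<in>F. (\<lambda>i. xs ! i) ` {i. i < length xs})"
      unfolding S_V_def by blast
    then have "S_V F = (\<Union>p\<in>M. {u, fst p, snd p, v})" unfolding F' by (simp add: idx)
    then show ?thesis unfolding X_img Y_img using p0 by auto
  qed
  have SE: "S_E n F = (\<lambda>(a, b). (a, elabel n a b, b)) ` crown_edges u X Y v k"
  proof -
    have "S_E n F = (\<Union>xs\<in>F. (\<lambda>i. (xs ! i, elabel n (xs ! i) (xs ! Suc i), xs ! Suc i)) ` {i. Suc i < length xs})"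
      unfolding S_E_def by blast
    then show ?thesis
      unfolding F' crown_edges_middle[OF k] M_def[symmetric] by (simp add: idx image_UN case_prod_beta eval_nat_numeral)
  qed
  have TSV: "TS_V F = {(u, 0), (v, 3)} \<union> X' ` {..<k} \<union> Y' ` {..<k}"
  proof -
    have "TS_V F = (\<Union>xs\<in>F. (\<lambda>i. (xs ! i, i)) ` {i. i < length xs})"
      unfolding TS_V_def by blast
    then have TSV: "TS_V F = (\<Union>p\<in>M. {(u, 0), (fst p, 1), (snd p, 2), (v, 3)})"
      unfolding F' by (simp add: idx)
    have "X' ` {..<k} = (\<lambda>x. (x, 1)) ` fst ` M" "Y' ` {..<k} = (\<lambda>y. (y, 2)) ` snd ` M"
      unfolding X_img[symmetric] Y_img[symmetric] X'_def Y'_def image_image by (rule refl)+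
    then show ?thesis unfolding TSV using p0 by auto
  qed
  have TSE: "TS_E n F = (\<lambda>(a, b). (a, elabel n (fst a) (fst b), b)) ` crown_edges (u, 0) X' Y' (v, 3) k"
  proof -
    have "TS_E n F = (\<Union>xs\<in>F. (\<lambda>i. ((xs ! i, i), elabel n (xs ! i) (xs ! Suc i), (xs ! Suc i, Suc i))) ` {i. Suc i < length xs})"
      unfolding TS_E_def by blast
    then show ?thesis
      unfolding F' crown_edges_middle[OF k] mid M_def[symmetric] by (simp add: idx image_UN case_prod_beta eval_nat_numeral)
  qed
  show "digraph_iso (S_V F) (unlab (S_E n F)) (crown_V k) (crown_E k)"
    unfolding SV SE unlab_labelled by (rule crown_edges_iso[OF dist])
  show "digraph_iso (TS_V F) (unlab (TS_E n F)) (crown_V k) (crown_E k)"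
    unfolding TSV TSE unlab_labelled by (rule crown_edges_iso[OF dist'])
  have upt3: "[0..<3] = [0, 1, 2::nat]" by (simp add: upt_rec)
  show "bij_betw (i_S n) F (lpaths (S_E n F) 3 u v)"
    unfolding SE lpaths_crown[OF dist]
  proof (rule bij_betw_imageI)
    show "inj_on (i_S n) F"
      by (rule inj_onI) (auto simp: F i_S_def upt3)
    show "i_S n ` F = (\<lambda>(x, y). [(u, elabel n u x, x), (x, elabel n x y, y), (y, elabel n y v, v)]) ` crown_middle X Y k"
      unfolding F image_image by (intro image_cong) (auto simp: i_S_def upt3)
  qed
  show "bij_betw (i_TS n) F (lpaths (TS_E n F) 3 (u, 0) (v, 3))"
    unfolding TSE lpaths_crown[OF dist']
  proof (rule bij_betw_imageI)
    show "inj_on (i_TS n) F"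
      by (rule inj_onI) (auto simp: F i_TS_def upt3)
    show "i_TS n ` F = (\<lambda>(x, y). [((u, 0), elabel n (fst (u, 0)) (fst x), x), (x, elabel n (fst x) (fst y), y),
        (y, elabel n (fst y) (fst (v, 3)), (v, 3))]) ` crown_middle X' Y' k"
      unfolding F mid image_image by (intro image_cong) (auto simp: i_TS_def upt3)
  qed
  let ?e1 = "\<lambda>j. [u, X j, Y j, v]" and ?e2 = "\<lambda>j. [u, X j, Y (Suc j mod k), v]"
  have "perm_order_on F (flip_op n 2 \<circ> flip_op n 1) = k"
  proof (rule perm_order_on_crown[OF k])
    show "inj_on ?e2 {..<k}" using inj(1) by (auto simp: inj_on_def)
    show "F = ?e1 ` {..<k} \<union> ?e2 ` {..<k}" 
      unfolding F crown_middle_def lessThan_def by (simp only: setcompr_eq_image image_Un image_image prod.case)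
    show "(flip_op n 2 \<circ> flip_op n 1) (?e1 (Suc j mod k)) = ?e1 j" if "j < k" for j
      using f1(2)[OF that] f2(2)[OF that] by simp
    show "(flip_op n 2 \<circ> flip_op n 1) (?e2 j) = ?e2 (Suc j mod k)" if "j < k" for j
      using f1(1)[OF that] f2(1)[OF m, of j] by simp
  qed
  then show "k = perm_order_on F (flip_op n 2 \<circ> flip_op n 1)" by simp
qed

section \<open>The symmetric group on four letters\<close>

primrec iterates :: "('a \<Rightarrow> 'a) \<Rightarrow> nat \<Rightarrow> 'a \<Rightarrow> 'a list" where
  "iterates f 0 x = []"
| "iterates f (Suc k) x = x # iterates f k (f x)"

text \<open>Its iterates together with their \<open>flip2\<close> images list the alternating cycle
  of flips. On valid paths it is the inverse of the product in the theorem, so it has the same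
  order.\<close>

definition flip12 :: "(nat \<Rightarrow> nat) \<Rightarrow> refl3 \<Rightarrow> refl3" where
  "flip12 q p = flip1 q (flip2 q p)"

text \<open>First labels stand for the \<open>k\<close> vertices after \<open>u\<close>, last labels
  for the \<open>k\<close> vertices before \<open>v\<close>; their distinctness makes the closed
  walk a cycle with exactly \<open>k\<close> vertices on each middle level.\<close>

definition flip_cycle :: "(nat \<Rightarrow> nat) \<Rightarrow> nat \<Rightarrow> refl3 \<Rightarrow> bool" where
  "flip_cycle q k p \<longleftrightarrow> (flip12 q ^^ k) p = p \<and> distinct (map fst (iterates (flip12 q) k p)) \<and>
     distinct (map (\<lambda>p. snd (snd p)) (iterates (flip12 q) k p))"

definition flip_orbit :: "(nat \<Rightarrow> nat) \<Rightarrow> nat \<Rightarrow> refl3 \<Rightarrow> refl3 list" where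
  "flip_orbit q k p = iterates (flip12 q) k p @ map (flip2 q) (iterates (flip12 q) k p)"

fun increasing3 :: "(refl \<Rightarrow> refl \<Rightarrow> bool) \<Rightarrow> refl3 \<Rightarrow> bool" where
  "increasing3 R (r, s, t) \<longleftrightarrow> R r s \<and> R s t"

definition count_ok :: "nat \<Rightarrow> refl3 list \<Rightarrow> (refl \<Rightarrow> refl \<Rightarrow> bool) \<Rightarrow> bool" where
  "count_ok k ps R \<longleftrightarrow> length (filter (increasing3 R) ps) = (if k = 5 then 2 else 1)"

text \<open>For \<open>a < b < c\<close> below 4 the bit is true if \<open>(a, b)\<close>,
  \<open>(a, c)\<close>, \<open>(b, c)\<close> come in this order and false if they come in the
  reverse order; the tests single out one of the four triples.\<close>

fun triple_sign :: "bool \<times> bool \<times> bool \<times> bool \<Rightarrow> nat \<Rightarrow> nat \<Rightarrow> nat \<Rightarrow> bool" where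
  "triple_sign (s012, s013, s023, s123) a b c =
     (if c = 2 then s012 else if b = 1 then s013 else if a = 0 then s023 else s123)"

text \<open>There are 15 comparisons between the six reflections. Twelve involve a common letter and
  are governed in threes by the four triple signs; the other three compare the disjoint pairs 01
  with 23, 02 with 13 and 03 with 12. So seven bits encode a candidate ordering.\<close>

fun sign_order :: "(bool \<times> bool \<times> bool \<times> bool) \<times> bool \<times> bool \<times> bool \<Rightarrow> refl \<Rightarrow> refl \<Rightarrow> bool" where
  "sign_order (\<sigma>, d1, d2, d3) (a, b) (c, d) =
    (if a = c then b = d \<or> (if b < d then triple_sign \<sigma> a b d else \<not> triple_sign \<sigma> a d b)
     else if b = d then (if a < c then triple_sign \<sigma> a c b else \<not> triple_sign \<sigma> c a b)
     else if b = c then triple_sign \<sigma> a b d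
     else if a = d then \<not> triple_sign \<sigma> c a b
     else if a = 0 then (if b = 1 then d1 else if b = 2 then d2 else d3)
     else (if d = 1 then \<not> d1 else if d = 2 then \<not> d2 else \<not> d3))"

definition labels4 :: "refl list" where
  "labels4 = [(0, 1), (0, 2), (0, 3), (1, 2), (1, 3), (2, 3)]"

definition transitive_signs :: "(bool \<times> bool \<times> bool \<times> bool) \<times> bool \<times> bool \<times> bool \<Rightarrow> bool" where
  "transitive_signs \<tau> \<longleftrightarrow> list_all (\<lambda>r. list_all (\<lambda>s. sign_order \<tau> r s \<longrightarrow>
      list_all (\<lambda>t. sign_order \<tau> s t \<longrightarrow> sign_order \<tau> r t) labels4) labels4) labels4"

definition all_signs :: "((bool \<times> bool \<times> bool \<times> bool) \<times> bool \<times> bool \<times> bool) list" where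
  "all_signs = List.product
     (List.product [True, False] (List.product [True, False] (List.product [True, False] [True, False])))
     (List.product [True, False] (List.product [True, False] [True, False]))"

lemma mem_all_signs: "\<tau> \<in> set all_signs"
proof -
  have "set [True, False] = UNIV" by auto
  then show ?thesis unfolding all_signs_def set_product by simp
qed

text \<open>The transitive choices among the 128 bit vectors. Reflection orderings of S_4 correspond
  to the reduced words of its longest element, of which there are sixteen.\<close>

definition order_signs :: "((bool \<times> bool \<times> bool \<times> bool) \<times> bool \<times> bool \<times> bool) list" where
  "order_signs =
    [((True, True, True, True), True, True, True),
     ((True, True, True, True), True, True, False),
     ((True, True, True, False), True, True, True),
     ((True, True, False, False), True, True, True),
     ((True, True, False, False), True, False, True),
     ((True, True, False, False), False, True, True),
     ((True, True, False, False), False, False, True),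
     ((True, False, False, False), False, False, True),
     ((False, True, True, True), True, True, False),
     ((False, False, True, True), True, True, False),
     ((False, False, True, True), True, False, False),
     ((False, False, True, True), False, True, False),
     ((False, False, True, True), False, False, False),
     ((False, False, False, True), False, False, False),
     ((False, False, False, False), False, False, True),
     ((False, False, False, False), False, False, False)]"

lemma filter_transitive_signs: "list_all (\<lambda>\<tau>. transitive_signs \<tau> \<longrightarrow> \<tau> \<in> set order_signs) all_signs"
  by code_simp

definition cycle_ok :: "(nat \<Rightarrow> nat) \<Rightarrow> refl3 \<Rightarrow> nat \<Rightarrow> bool" where
  "cycle_ok q p k \<longleftrightarrow> flip_cycle q k p \<and>
     list_all (\<lambda>\<tau>. count_ok k (flip_orbit q k p) (sign_order \<tau>)) order_signs"

text \<open>The checks below are phrased with named functions and conditionals, since the simplifier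
  would otherwise evaluate guarded branches and work under binders.\<close>

definition count_sign_ok :: "nat \<Rightarrow> refl3 list \<Rightarrow> (bool \<times> bool \<times> bool \<times> bool) \<times> bool \<times> bool \<times> bool \<Rightarrow> bool" where
  "count_sign_ok k ps \<tau> = count_ok k ps (sign_order \<tau>)"

primrec find_cycle_ok :: "(nat \<Rightarrow> nat) \<Rightarrow> refl3 \<Rightarrow> nat list \<Rightarrow> bool" where
  "find_cycle_ok q p [] = False"
| "find_cycle_ok q p (k # ks) =
    (if flip_cycle q k p then list_all (count_sign_ok k (flip_orbit q k p)) order_signs
     else find_cycle_ok q p ks)"

definition check3 :: "(nat \<Rightarrow> nat) \<Rightarrow> refl \<Rightarrow> refl \<Rightarrow> refl \<Rightarrow> bool" where
  "check3 q r s t = (if ascent (q \<circ> swap r \<circ> swap s) t then find_cycle_ok q (r, s, t) [2, 3, 4, 5] else True)"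

definition check2 :: "(nat \<Rightarrow> nat) \<Rightarrow> refl \<Rightarrow> refl \<Rightarrow> bool" where
  "check2 q r s = (if ascent (q \<circ> swap r) s then list_all (check3 q r s) labels4 else True)"

definition check1 :: "(nat \<Rightarrow> nat) \<Rightarrow> refl \<Rightarrow> bool" where
  "check1 q r = (if ascent q r then list_all (check2 q r) labels4 else True)"

definition check_word :: "nat list \<Rightarrow> bool" where
  "check_word w = (if distinct w then list_all (check1 (\<lambda>i. w ! i)) labels4 else True)"

lemma find_cycle_ok: "find_cycle_ok q p ks \<Longrightarrow> \<exists>k\<in>set ks. cycle_ok q p k"
  by (induction ks) (auto simp: cycle_ok_def count_sign_ok_def list_all_iff split: if_splits)

text \<open>Of the 256 words the 24 with distinct entries are the position functions on four
  letters: \<open>w ! i\<close> is the position of the letter \<open>i\<close>. Every ascending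
  triple of labels is tested for each of them.\<close>

lemma check_all_words: "list_all check_word (List.n_lists 4 [0, 1, 2, 3])"
  by code_simp

lemma ex_cycle_ok:
  assumes w: "distinct w" "length w = 4" "set w \<subseteq> {0, 1, 2, 3}"
    and rst: "r \<in> set labels4" "s \<in> set labels4" "t \<in> set labels4"
      "ascent2 (\<lambda>i. w ! i) r s" "ascent2 ((\<lambda>i. w ! i) \<circ> swap r) s t"
  shows "\<exists>k\<in>{2, 3, 4, 5}. cycle_ok (\<lambda>i. w ! i) (r, s, t) k"
proof -
  have "w \<in> set (List.n_lists 4 [0, 1, 2, 3])"
    unfolding set_n_lists using w(2,3) by simp
  then have "check_word w" using check_all_words unfolding list_all_iff by blast
  then have "find_cycle_ok (\<lambda>i. w ! i) (r, s, t) [2, 3, 4, 5]"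
    using w(1) rst unfolding check_word_def check1_def check2_def check3_def list_all_iff ascent2_def
    by metis
  then show ?thesis using find_cycle_ok by fastforce
qed

section \<open>Transport from four letters to the actual values\<close>

abbreviation map_refl :: "(nat \<Rightarrow> nat) \<Rightarrow> refl \<Rightarrow> refl" where
  "map_refl \<phi> \<equiv> map_prod \<phi> \<phi>"

abbreviation map_refl3 :: "(nat \<Rightarrow> nat) \<Rightarrow> refl3 \<Rightarrow> refl3" where
  "map_refl3 \<phi> \<equiv> map_prod (map_refl \<phi>) (map_prod (map_refl \<phi>) (map_refl \<phi>))"

text \<open>\<open>\<phi>\<close> places the model letters among the actual values. Order and
  equality of values and order of positions are all that \<open>ascent\<close> and
  \<open>gflip\<close> ever test.\<close>

definition model4 :: "(nat \<Rightarrow> nat) \<Rightarrow> (nat \<Rightarrow> nat) \<Rightarrow> (nat \<Rightarrow> nat) \<Rightarrow> bool" where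
  "model4 \<phi> q q0 \<longleftrightarrow> (\<forall>i<4. \<forall>j<4. (\<phi> i < \<phi> j \<longleftrightarrow> i < j) \<and> (\<phi> i = \<phi> j \<longleftrightarrow> i = j) \<and>
     (q (\<phi> i) < q (\<phi> j) \<longleftrightarrow> q0 i < q0 j))"

definition refl4 :: "refl set" where
  "refl4 = {..<4} \<times> {..<4}"

text \<open>Needed because the second and third label of a path are judged by swapped position
  functions; the swap only permutes the four letters, so the comparison survives.\<close>

lemma model4_swap:
  assumes "model4 \<phi> q q0" "s \<in> refl4"
  shows "model4 \<phi> (q \<circ> swap (map_refl \<phi> s)) (q0 \<circ> swap s)"
proof -
  have s: "fst s < 4" "snd s < 4" using assms(2) by (auto simp: refl4_def)
  have sw: "swap (map_refl \<phi> s) (\<phi> i) = \<phi> (swap s i)" "swap s i < 4" if "i < 4" for i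
    using assms(1) s that by (auto simp: model4_def transpose_def map_prod_def split_beta)
  show ?thesis using assms(1) sw unfolding model4_def by simp
qed

lemma ascent_map:
  assumes "model4 \<phi> q q0" "s \<in> refl4"
  shows "ascent q (map_refl \<phi> s) \<longleftrightarrow> ascent q0 s"
  using assms by (cases s) (simp add: model4_def refl4_def ascent_def)

lemma gflip_map:
  assumes "model4 \<phi> q q0" "s \<in> refl4" "t \<in> refl4"
  shows "gflip q (map_refl \<phi> s) (map_refl \<phi> t) = map_prod (map_refl \<phi>) (map_refl \<phi>) (gflip q0 s t)"
    and "gflip q0 s t \<in> refl4 \<times> refl4"
proof -
  obtain a b c d where st: "s = (a, b)" "t = (c, d)" by (cases s; cases t)
  have lt: "a < 4" "b < 4" "c < 4" "d < 4" using assms(2,3) by (auto simp: refl4_def st)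
  have m: "\<phi> i < \<phi> j \<longleftrightarrow> i < j" "\<phi> i = \<phi> j \<longleftrightarrow> i = j" "q (\<phi> i) < q (\<phi> j) \<longleftrightarrow> q0 i < q0 j"
    if "i < 4" "j < 4" for i j using assms(1) that by (auto simp: model4_def)
  show "gflip q (map_refl \<phi> s) (map_refl \<phi> t) = map_prod (map_refl \<phi>) (map_refl \<phi>) (gflip q0 s t)"
    by (simp add: st m lt)
  show "gflip q0 s t \<in> refl4 \<times> refl4"
    using lt by (simp add: st refl4_def)
qed

lemma flip_map:
  assumes m: "model4 \<phi> q q0" and p: "p \<in> refl4 \<times> refl4 \<times> refl4"
  shows "flip1 q (map_refl3 \<phi> p) = map_refl3 \<phi> (flip1 q0 p) \<and> flip1 q0 p \<in> refl4 \<times> refl4 \<times> refl4"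
    and "flip2 q (map_refl3 \<phi> p) = map_refl3 \<phi> (flip2 q0 p) \<and> flip2 q0 p \<in> refl4 \<times> refl4 \<times> refl4"
proof -
  obtain r s t where p': "p = (r, s, t)" "r \<in> refl4" "s \<in> refl4" "t \<in> refl4" using p by (cases p) auto
  note sw = model4_swap[OF m p'(2)]
  show "flip1 q (map_refl3 \<phi> p) = map_refl3 \<phi> (flip1 q0 p) \<and> flip1 q0 p \<in> refl4 \<times> refl4 \<times> refl4"
    using gflip_map[OF m p'(2,3)] p'(4) by (cases "gflip q0 r s") (simp add: p'(1))
  show "flip2 q (map_refl3 \<phi> p) = map_refl3 \<phi> (flip2 q0 p) \<and> flip2 q0 p \<in> refl4 \<times> refl4 \<times> refl4"
    using gflip_map[OF sw p'(3,4)] p'(2) by (cases "gflip (q0 \<circ> swap r) s t") (simp add: p'(1))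
qed

lemma flip12_map:
  assumes m: "model4 \<phi> q q0" and p: "p \<in> refl4 \<times> refl4 \<times> refl4"
  shows "flip12 q (map_refl3 \<phi> p) = map_refl3 \<phi> (flip12 q0 p)"
    and "flip12 q0 p \<in> refl4 \<times> refl4 \<times> refl4"
proof -
  note f2 = flip_map(2)[OF m p]
  note f1 = flip_map(1)[OF m conjunct2[OF f2]]
  show "flip12 q (map_refl3 \<phi> p) = map_refl3 \<phi> (flip12 q0 p)"
    unfolding flip12_def using f1 f2 by simp
  show "flip12 q0 p \<in> refl4 \<times> refl4 \<times> refl4" unfolding flip12_def using f1 by simp
qed

lemma iterates_map_conj:
  assumes m: "model4 \<phi> q q0"
  shows "p \<in> refl4 \<times> refl4 \<times> refl4 \<Longrightarrow>
    iterates (flip12 q) k (map_refl3 \<phi> p) = map (map_refl3 \<phi>) (iterates (flip12 q0) k p) \<and>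
    set (iterates (flip12 q0) k p) \<subseteq> refl4 \<times> refl4 \<times> refl4 \<and>
    (flip12 q ^^ k) (map_refl3 \<phi> p) = map_refl3 \<phi> ((flip12 q0 ^^ k) p)"
proof (induction k arbitrary: p)
  case (Suc k)
  note IH = Suc.IH[OF flip12_map(2)[OF m Suc.prems]] and eq = flip12_map(1)[OF m Suc.prems]
  show ?case
    using IH Suc.prems
    by (simp only: iterates.simps eq list.map set_simps insert_subset funpow_Suc_right o_apply simp_thms)
qed simp

lemmas iterates_map =
  iterates_map_conj[THEN conjunct1]
  iterates_map_conj[THEN conjunct2, THEN conjunct1]
  iterates_map_conj[THEN conjunct2, THEN conjunct2]

lemma flip_orbit_map:
  assumes m: "model4 \<phi> q q0" and p: "p \<in> refl4 \<times> refl4 \<times> refl4"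
  shows "flip_orbit q k (map_refl3 \<phi> p) = map (map_refl3 \<phi>) (flip_orbit q0 k p)"
    and "set (flip_orbit q0 k p) \<subseteq> refl4 \<times> refl4 \<times> refl4"
proof -
  have "map (\<lambda>x. flip2 q (map_refl3 \<phi> x)) (iterates (flip12 q0) k p) =
      map (\<lambda>x. map_refl3 \<phi> (flip2 q0 x)) (iterates (flip12 q0) k p)"
  proof (rule map_cong[OF refl])
    fix x assume "x \<in> set (iterates (flip12 q0) k p)"
    then have "x \<in> refl4 \<times> refl4 \<times> refl4" using iterates_map(2)[OF m p] by blast
    then show "flip2 q (map_refl3 \<phi> x) = map_refl3 \<phi> (flip2 q0 x)" using flip_map(2)[OF m] by blast
  qed
  then show "flip_orbit q k (map_refl3 \<phi> p) = map (map_refl3 \<phi>) (flip_orbit q0 k p)"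
    unfolding flip_orbit_def iterates_map(1)[OF m p] map_append map_map comp_def by (rule arg_cong)
  show "set (flip_orbit q0 k p) \<subseteq> refl4 \<times> refl4 \<times> refl4"
    using iterates_map(2)[OF m p, of k] flip_map(2)[OF m] unfolding flip_orbit_def set_append set_map
    by blast
qed

lemma flip_cycle_map:
  assumes m: "model4 \<phi> q q0" and p: "p \<in> refl4 \<times> refl4 \<times> refl4" and c: "flip_cycle q0 k p"
  shows "flip_cycle q k (map_refl3 \<phi> p)"
proof -
  have inj: "inj_on (map_refl \<phi>) refl4"
    using m by (auto simp: inj_on_def model4_def refl4_def)
  have d: "distinct (map (\<lambda>x. map_refl \<phi> (f x)) xs)"
    if "distinct (map f xs)" "\<And>x. x \<in> set xs \<Longrightarrow> f x \<in> refl4" for f :: "refl3 \<Rightarrow> refl" and xs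
  proof -
    have "distinct (map (map_refl \<phi>) (map f xs))"
      unfolding distinct_map[of "map_refl \<phi>"]
    proof (intro conjI inj_on_subset[OF inj])
      show "set (map f xs) \<subseteq> refl4" unfolding set_map using that(2) by blast
    qed (rule that(1))
    then show ?thesis by (simp only: map_map comp_def)
  qed
  let ?I = "iterates (flip12 q0) k p"
  have mem: "fst x \<in> refl4 \<and> snd (snd x) \<in> refl4" if "x \<in> set ?I" for x
  proof -
    have "x \<in> refl4 \<times> refl4 \<times> refl4" using that iterates_map(2)[OF m p] by blast
    then show ?thesis by (simp add: mem_Times_iff)
  qed
  have "distinct (map (\<lambda>x. map_refl \<phi> (fst x)) ?I)"
    using c mem by (intro d) (simp_all add: flip_cycle_def)
  moreover have "distinct (map (\<lambda>x. map_refl \<phi> (snd (snd x))) ?I)"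
    using c mem by (intro d) (simp_all add: flip_cycle_def)
  ultimately show ?thesis
    using c unfolding flip_cycle_def iterates_map(1)[OF m p] iterates_map(3)[OF m p] map_map
    by (simp add: comp_def fst_map_prod snd_map_prod)
qed

section \<open>Reflection orderings restricted to four values\<close>

lemma triple_order_eqs:
  assumes R: "R p q \<and> R q w \<or> R w q \<and> R q p" and ne: "p \<noteq> q" "q \<noteq> w" "p \<noteq> w"
    and L: "p \<in> L" "q \<in> L" "w \<in> L"
    and antisym: "\<And>s t. s \<in> L \<Longrightarrow> t \<in> L \<Longrightarrow> R s t \<Longrightarrow> R t s \<Longrightarrow> s = t"
    and trans: "\<And>s t z. s \<in> L \<Longrightarrow> t \<in> L \<Longrightarrow> z \<in> L \<Longrightarrow> R s t \<Longrightarrow> R t z \<Longrightarrow> R s z"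
  shows "R q w \<longleftrightarrow> R p q" "R p w \<longleftrightarrow> R p q" "R q p \<longleftrightarrow> \<not> R p q" "R w q \<longleftrightarrow> \<not> R p q" "R w p \<longleftrightarrow> \<not> R p q"
  using R antisym[OF L(1,2)] antisym[OF L(2,3)] antisym[OF L(1,3)] trans[OF L(1,2,3)] trans[OF L(3,2,1)] ne
  by blast+

text \<open>The seven bits are read off from \<open>R\<close>. The triple condition and antisymmetry
  recover the comparisons with a common letter, totality those of disjoint pairs, and transitivity
  of \<open>R\<close> puts the bit vector into the list.\<close>

lemma sign_order_exists:
  assumes refl: "\<And>s. s \<in> set labels4 \<Longrightarrow> R s s"
    and antisym: "\<And>s t. s \<in> set labels4 \<Longrightarrow> t \<in> set labels4 \<Longrightarrow> R s t \<Longrightarrow> R t s \<Longrightarrow> s = t"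
    and trans: "\<And>s t z. s \<in> set labels4 \<Longrightarrow> t \<in> set labels4 \<Longrightarrow> z \<in> set labels4 \<Longrightarrow> R s t \<Longrightarrow> R t z \<Longrightarrow> R s z"
    and total: "\<And>s t. s \<in> set labels4 \<Longrightarrow> t \<in> set labels4 \<Longrightarrow> R s t \<or> R t s"
    and triple: "\<And>a b c. a < b \<Longrightarrow> b < c \<Longrightarrow> c < 4 \<Longrightarrow>
       R (a, b) (a, c) \<and> R (a, c) (b, c) \<or> R (b, c) (a, c) \<and> R (a, c) (a, b)"
  shows "\<exists>\<tau>\<in>set order_signs. \<forall>s\<in>set labels4. \<forall>t\<in>set labels4. sign_order \<tau> s t \<longleftrightarrow> R s t"
proof -
  define \<tau> where "\<tau> = ((R (0, 1) (0, 2), R (0, 1) (0, 3), R (0, 2) (0, 3), R (1, 2) (1, 3)),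
     R (0, 1) (2, 3), R (0, 2) (1, 3), R (0, 3) (1, 2))"
  note tri = triple_order_eqs[where R = R and L = "set labels4", OF _ _ _ _ _ _ _ antisym trans]
  have swap: "R t s \<longleftrightarrow> \<not> R s t" if "s \<in> set labels4" "t \<in> set labels4" "s \<noteq> t" for s t
    using antisym[OF that(1,2)] total[OF that(1,2)] that(3) by blast
  have t012: "R (0, 2) (1, 2) \<longleftrightarrow> R (0, 1) (0, 2)" "R (0, 1) (1, 2) \<longleftrightarrow> R (0, 1) (0, 2)"
     "R (0, 2) (0, 1) \<longleftrightarrow> \<not> R (0, 1) (0, 2)" "R (1, 2) (0, 2) \<longleftrightarrow> \<not> R (0, 1) (0, 2)"
     "R (1, 2) (0, 1) \<longleftrightarrow> \<not> R (0, 1) (0, 2)"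
    by (rule tri[OF triple[of 0 1 2]]; simp add: labels4_def)+
  have t013: "R (0, 3) (1, 3) \<longleftrightarrow> R (0, 1) (0, 3)" "R (0, 1) (1, 3) \<longleftrightarrow> R (0, 1) (0, 3)"
     "R (0, 3) (0, 1) \<longleftrightarrow> \<not> R (0, 1) (0, 3)" "R (1, 3) (0, 3) \<longleftrightarrow> \<not> R (0, 1) (0, 3)"
     "R (1, 3) (0, 1) \<longleftrightarrow> \<not> R (0, 1) (0, 3)"
    by (rule tri[OF triple[of 0 1 3]]; simp add: labels4_def)+
  have t023: "R (0, 3) (2, 3) \<longleftrightarrow> R (0, 2) (0, 3)" "R (0, 2) (2, 3) \<longleftrightarrow> R (0, 2) (0, 3)"
     "R (0, 3) (0, 2) \<longleftrightarrow> \<not> R (0, 2) (0, 3)" "R (2, 3) (0, 3) \<longleftrightarrow> \<not> R (0, 2) (0, 3)"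
     "R (2, 3) (0, 2) \<longleftrightarrow> \<not> R (0, 2) (0, 3)"
    by (rule tri[OF triple[of 0 2 3]]; simp add: labels4_def)+
  have t123: "R (1, 3) (2, 3) \<longleftrightarrow> R (1, 2) (1, 3)" "R (1, 2) (2, 3) \<longleftrightarrow> R (1, 2) (1, 3)"
     "R (1, 3) (1, 2) \<longleftrightarrow> \<not> R (1, 2) (1, 3)" "R (2, 3) (1, 3) \<longleftrightarrow> \<not> R (1, 2) (1, 3)"
     "R (2, 3) (1, 2) \<longleftrightarrow> \<not> R (1, 2) (1, 3)"
    by (rule tri[OF triple[of 1 2 3]]; simp add: labels4_def)+
  have disj: "R (2, 3) (0, 1) \<longleftrightarrow> \<not> R (0, 1) (2, 3)" "R (1, 3) (0, 2) \<longleftrightarrow> \<not> R (0, 2) (1, 3)"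
     "R (1, 2) (0, 3) \<longleftrightarrow> \<not> R (0, 3) (1, 2)"
    by (rule swap; simp add: labels4_def)+
  have same: "R (0, 1) (0, 1)" "R (0, 2) (0, 2)" "R (0, 3) (0, 3)" "R (1, 2) (1, 2)" "R (1, 3) (1, 3)"
     "R (2, 3) (2, 3)"
    by (rule refl; simp add: labels4_def)+
  have eq: "\<forall>s\<in>set labels4. \<forall>t\<in>set labels4. sign_order \<tau> s t \<longleftrightarrow> R s t"
    unfolding labels4_def \<tau>_def
    by (simp add: t012[simplified] t013[simplified] t023[simplified] t123[simplified] disj[simplified] same[simplified])
  have "transitive_signs \<tau>"
    unfolding transitive_signs_def list_all_iff using eq trans by blast
  then have "\<tau> \<in> set order_signs"
    using filter_transitive_signs mem_all_signs[of \<tau>] unfolding list_all_iff by blast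
  then show ?thesis using eq by blast
qed

lemma count_ok_map:
  assumes "\<And>p. p \<in> set ps \<Longrightarrow> increasing3 R (f p) \<longleftrightarrow> increasing3 R' p"
  shows "count_ok k (map f ps) R \<longleftrightarrow> count_ok k ps R'"
proof -
  have "filter (increasing3 R \<circ> f) ps = filter (increasing3 R') ps"
    using assms by (intro filter_cong) auto
  then show ?thesis unfolding count_ok_def filter_map length_map by simp
qed

lemma label_path_iterates:
  assumes u: "u permutes {1..n}"
  shows "label_path n (pos u) p \<Longrightarrow> \<forall>x\<in>set (iterates (flip12 (pos u)) k p). label_path n (pos u) x"
proof (induction k arbitrary: p)
  case (Suc k)
  have "label_path n (pos u) (flip12 (pos u) p)"
    unfolding flip12_def using label_path_flip1(1)[OF u label_path_flip2(1)[OF u Suc.prems]] .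
  from Suc.IH[OF this] Suc.prems show ?case by simp
qed simp

lemma label_path_flip_orbit:
  assumes u: "u permutes {1..n}" and p: "label_path n (pos u) p"
  shows "\<forall>x\<in>set (flip_orbit (pos u) k p). label_path n (pos u) x"
  using label_path_iterates[OF u p, of k] label_path_flip2(1)[OF u] by (auto simp: flip_orbit_def)

lemma reflection_ordering_props:
  assumes "reflection_ordering n \<rho>"
  shows "\<And>s. s \<in> refl_T n \<Longrightarrow> (s, s) \<in> \<rho>"
    and "\<And>s t. (s, t) \<in> \<rho> \<Longrightarrow> (t, s) \<in> \<rho> \<Longrightarrow> s = t"
    and "\<And>s t z. (s, t) \<in> \<rho> \<Longrightarrow> (t, z) \<in> \<rho> \<Longrightarrow> (s, z) \<in> \<rho>"
    and "\<And>s t. s \<in> refl_T n \<Longrightarrow> t \<in> refl_T n \<Longrightarrow> (s, t) \<in> \<rho> \<or> (t, s) \<in> \<rho>"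
    and "\<And>a b c. 1 \<le> a \<Longrightarrow> a < b \<Longrightarrow> b < c \<Longrightarrow> c \<le> n \<Longrightarrow>
      ((a, b), (a, c)) \<in> \<rho> \<and> ((a, c), (b, c)) \<in> \<rho> \<or> ((b, c), (a, c)) \<in> \<rho> \<and> ((a, c), (a, b)) \<in> \<rho>"
proof -
  have lin: "linear_order_on (refl_T n) \<rho>" using assms by (simp add: reflection_ordering_def)
  then have po: "refl_on (refl_T n) \<rho>" "antisym \<rho>" "trans \<rho>" "total_on (refl_T n) \<rho>"
    by (simp_all add: order_on_defs)
  show r: "(s, s) \<in> \<rho>" if "s \<in> refl_T n" for s using po(1) that by (rule refl_onD)
  show "s = t" if "(s, t) \<in> \<rho>" "(t, s) \<in> \<rho>" for s t using po(2) that by (rule antisymD)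
  show "(s, z) \<in> \<rho>" if "(s, t) \<in> \<rho>" "(t, z) \<in> \<rho>" for s t z using po(3) that by (rule transD)
  show "(s, t) \<in> \<rho> \<or> (t, s) \<in> \<rho>" if "s \<in> refl_T n" "t \<in> refl_T n" for s t
    using po(4) that r by (cases "s = t") (auto simp: total_on_def)
  show "((a, b), (a, c)) \<in> \<rho> \<and> ((a, c), (b, c)) \<in> \<rho> \<or> ((b, c), (a, c)) \<in> \<rho> \<and> ((a, c), (a, b)) \<in> \<rho>"
    if "1 \<le> a" "a < b" "b < c" "c \<le> n" for a b c
    using assms that unfolding reflection_ordering_def by blast
qed

text \<open>A reflection ordering restricted to three or four values is one of the sixteen model orderings;
  with three values the fourth model value is sent outside of [n].\<close>
lemma reflection_ordering_signs:
  assumes ro: "reflection_ordering n \<rho>"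
    and \<phi>: "\<phi> 0 < \<phi> 1" "\<phi> 1 < \<phi> 2" "\<phi> 2 < \<phi> 3" "1 \<le> \<phi> 0" "\<phi> 2 \<le> n"
  shows "\<exists>\<tau>\<in>set order_signs. \<forall>s\<in>set labels4. \<forall>t\<in>set labels4.
    map_refl \<phi> s \<in> refl_T n \<longrightarrow> map_refl \<phi> t \<in> refl_T n \<longrightarrow>
    (sign_order \<tau> s t \<longleftrightarrow> (map_refl \<phi> s, map_refl \<phi> t) \<in> \<rho>)"
proof -
  note ro' = reflection_ordering_props[OF ro]
  have lt: "\<phi> i < \<phi> j" if "i < j" "j < 4" for i j
  proof -
    have "(i, j) \<in> {(0, 1), (0, 2), (0, 3), (1, 2), (1, 3), (2, 3)}" using that by auto
    then show ?thesis using \<phi> by auto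
  qed
  have ge: "1 \<le> \<phi> i" if "i < 4" for i
    using lt[of 0 i] that \<phi>(4) by (cases "i = 0") auto
  have inj: "map_refl \<phi> s = map_refl \<phi> t \<Longrightarrow> s = t" if "s \<in> set labels4" "t \<in> set labels4" for s t
  proof -
    have "inj_on \<phi> {..<4}"
    proof (rule linorder_inj_onI)
      fix i j :: nat assume "i < j" "j \<in> {..<4}"
      then show "\<phi> i \<noteq> \<phi> j" using lt[of i j] by simp
    qed auto
    moreover have "fst s < 4 \<and> snd s < 4" "fst t < 4 \<and> snd t < 4"
      using that by (auto simp: labels4_def)
    ultimately show "map_refl \<phi> s = map_refl \<phi> t \<Longrightarrow> s = t"
      by (cases s; cases t) (simp add: inj_on_eq_iff)
  qed
  show ?thesis
  proof (cases "\<phi> 3 \<le> n")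
    case True
    have T: "map_refl \<phi> s \<in> refl_T n" if "s \<in> set labels4" for s
    proof -
      have "fst s < snd s" "snd s < 4" using that by (auto simp: labels4_def)
      moreover have "\<phi> (snd s) \<le> n" using lt[of "snd s" 3] calculation True by (cases "snd s = 3") auto
      ultimately show ?thesis using lt[of "fst s" "snd s"] ge[of "fst s"]
        by (auto simp: refl_T_def map_prod_def split_beta)
    qed
    have "\<exists>\<tau>\<in>set order_signs. \<forall>s\<in>set labels4. \<forall>t\<in>set labels4.
      sign_order \<tau> s t \<longleftrightarrow> (map_refl \<phi> s, map_refl \<phi> t) \<in> \<rho>"
    proof (rule sign_order_exists)
      fix a b c :: nat assume abc: "a < b" "b < c" "c < 4"
      have "\<phi> c \<le> n" using lt[of c 3] True abc by (cases "c = 3") auto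
      then show "(map_refl \<phi> (a, b), map_refl \<phi> (a, c)) \<in> \<rho> \<and> (map_refl \<phi> (a, c), map_refl \<phi> (b, c)) \<in> \<rho> \<or>
        (map_refl \<phi> (b, c), map_refl \<phi> (a, c)) \<in> \<rho> \<and> (map_refl \<phi> (a, c), map_refl \<phi> (a, b)) \<in> \<rho>"
        using ro'(5)[of "\<phi> a" "\<phi> b" "\<phi> c"] lt[of a b] lt[of b c] ge[of a] abc by simp
    next
      fix s t assume s: "s \<in> set labels4" and t: "t \<in> set labels4"
      show "(map_refl \<phi> s, map_refl \<phi> s) \<in> \<rho>" by (rule ro'(1)[OF T[OF s]])
      show "(map_refl \<phi> s, map_refl \<phi> t) \<in> \<rho> \<or> (map_refl \<phi> t, map_refl \<phi> s) \<in> \<rho>"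
        by (rule ro'(4)[OF T[OF s] T[OF t]])
      assume "(map_refl \<phi> s, map_refl \<phi> t) \<in> \<rho>" "(map_refl \<phi> t, map_refl \<phi> s) \<in> \<rho>"
      then show "s = t" by (intro inj[OF s t] ro'(2))
    next
      fix s t z assume "(map_refl \<phi> s, map_refl \<phi> t) \<in> \<rho>" "(map_refl \<phi> t, map_refl \<phi> z) \<in> \<rho>"
      then show "(map_refl \<phi> s, map_refl \<phi> z) \<in> \<rho>" by (rule ro'(3))
    qed
    then show ?thesis by blast
  next
    case False
    define x where "x \<longleftrightarrow> ((\<phi> 0, \<phi> 1), (\<phi> 0, \<phi> 2)) \<in> \<rho>"
    have L: "s \<in> {(0, 1), (0, 2), (1, 2)}" if "s \<in> set labels4" "map_refl \<phi> s \<in> refl_T n" for s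
      using that False by (auto simp: labels4_def refl_T_def)
    have T: "(\<phi> 0, \<phi> 1) \<in> refl_T n" "(\<phi> 0, \<phi> 2) \<in> refl_T n" "(\<phi> 1, \<phi> 2) \<in> refl_T n"
      using \<phi> by (auto simp: refl_T_def)
    note eqs = triple_order_eqs[where R = "\<lambda>s t. (s, t) \<in> \<rho>" and L = "refl_T n",
        OF ro'(5)[OF \<phi>(4,1,2,5)] _ _ _ T]
    have eqs: "((\<phi> 0, \<phi> 2), (\<phi> 1, \<phi> 2)) \<in> \<rho> \<longleftrightarrow> x" "((\<phi> 0, \<phi> 1), (\<phi> 1, \<phi> 2)) \<in> \<rho> \<longleftrightarrow> x"
      "((\<phi> 0, \<phi> 2), (\<phi> 0, \<phi> 1)) \<in> \<rho> \<longleftrightarrow> \<not> x" "((\<phi> 1, \<phi> 2), (\<phi> 0, \<phi> 2)) \<in> \<rho> \<longleftrightarrow> \<not> x"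
      "((\<phi> 1, \<phi> 2), (\<phi> 0, \<phi> 1)) \<in> \<rho> \<longleftrightarrow> \<not> x"
      unfolding x_def by (rule eqs; use \<phi> ro'(2,3) in \<open>auto\<close>)+
    \<comment> \<open>Only the sign of the triple 0, 1, 2 is constrained; the other bits copy it,
      since both constant bit vectors are in \<open>order_signs\<close>.\<close>
    have "\<forall>s\<in>{(0, 1), (0, 2), (1, 2)}. \<forall>t\<in>{(0, 1), (0, 2), (1, 2)}.
        sign_order ((x, x, x, x), x, x, x) s t \<longleftrightarrow> (map_refl \<phi> s, map_refl \<phi> t) \<in> \<rho>"
      using ro'(1)[OF T(1)] ro'(1)[OF T(2)] ro'(1)[OF T(3)] eqs x_def by simp
    moreover have "((x, x, x, x), x, x, x) \<in> set order_signs" by (cases x) (simp_all add: order_signs_def)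
    ultimately show ?thesis using L by (intro bexI[of _ "((x, x, x, x), x, x, x)"]) blast+
  qed
qed

section \<open>Cycles and counts for paths on three or four values\<close>

definition cycle_counts :: "nat \<Rightarrow> (nat \<Rightarrow> nat) \<Rightarrow> nat \<Rightarrow> refl3 \<Rightarrow> bool" where
  "cycle_counts n q k p \<longleftrightarrow> flip_cycle q k p \<and>
     (\<forall>\<rho>. reflection_ordering n \<rho> \<longrightarrow> count_ok k (flip_orbit q k p) (\<lambda>s t. (s, t) \<in> \<rho>))"

lemma ex_model4:
  assumes q: "inj q" and \<phi>: "\<And>i j. i < j \<Longrightarrow> j < 4 \<Longrightarrow> \<phi> i < \<phi> (j :: nat)"
  obtains w :: "nat list" where "distinct w" "length w = 4" "set w \<subseteq> {0, 1, 2, 3}" "model4 \<phi> q (\<lambda>i. w ! i)"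
proof -
  \<comment> \<open>Positions are replaced by their ranks among the four, starting at 0: this keeps
    their order and yields a word in 0, 1, 2, 3.\<close>
  define rank where "rank i = card {j. j < 4 \<and> q (\<phi> j) < q (\<phi> i)}" for i
  have rank_less: "rank i < rank j" if "q (\<phi> i) < q (\<phi> j)" "i < 4" for i j
    unfolding rank_def using that by (intro psubset_card_mono) (auto intro: psubsetI)
  have ne: "\<phi> i \<noteq> \<phi> j" if "i < 4" "j < 4" "i \<noteq> j" for i j
    using \<phi>[of i j] \<phi>[of j i] that by (cases i j rule: linorder_cases) auto
  have rank: "q (\<phi> i) < q (\<phi> j) \<longleftrightarrow> rank i < rank j" if "i < 4" "j < 4" for i j
  proof (cases "i = j")
    case False
    then have "q (\<phi> i) \<noteq> q (\<phi> j)" using ne[OF that] injD[OF q] by blast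
    then show ?thesis using rank_less[of i j] rank_less[of j i] that by linarith
  qed simp
  have inj: "inj_on rank {..<4}"
  proof (rule linorder_inj_onI)
    fix i j :: nat assume ij: "i < j" "i \<in> {..<4}" "j \<in> {..<4}"
    then have "q (\<phi> i) \<noteq> q (\<phi> j)" using ne[of i j] injD[OF q, of "\<phi> i" "\<phi> j"] by auto
    then show "rank i \<noteq> rank j" using rank_less[of i j] rank_less[of j i] ij by fastforce
  qed auto
  have lt: "rank i < 4" if "i < 4" for i
  proof -
    have "rank i < card {..<4::nat}"
      unfolding rank_def using that by (intro psubset_card_mono) auto
    then show ?thesis by simp
  qed
  have nth: "map rank [0..<4] ! i = rank i" if "i < 4" for i using that by simp
  show ?thesis
  proof (rule that[of "map rank [0..<4]"])
    have "{..<4} = {0..<4::nat}" by auto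
    then show "distinct (map rank [0..<4])" using inj by (simp add: distinct_map)
    show "set (map rank [0..<4]) \<subseteq> {0, 1, 2, 3}"
    proof
      fix x assume "x \<in> set (map rank [0..<4])"
      then have "x < 4" using lt by auto
      then show "x \<in> {0, 1, 2, 3}" by auto
    qed
    have \<phi>': "\<phi> i < \<phi> j \<longleftrightarrow> i < j" if "i < 4" "j < 4" for i j
      using \<phi>[of i j] \<phi>[of j i] that by (cases i j rule: linorder_cases) auto
    show "model4 \<phi> q (\<lambda>i. map rank [0..<4] ! i)"
      unfolding model4_def using ne rank \<phi>' nth by metis
  qed simp
qed

lemma cycle_counts_model:
  assumes u: "u permutes {1..n}" and p: "label_path n (pos u) (map_refl3 \<phi> p)"
    and p4: "p \<in> refl4 \<times> refl4 \<times> refl4"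
    and \<phi>: "\<phi> 0 < \<phi> 1" "\<phi> 1 < \<phi> 2" "\<phi> 2 < \<phi> 3" "1 \<le> \<phi> 0" "\<phi> 2 \<le> n"
  shows "\<exists>k\<in>{2, 3, 4, 5}. cycle_counts n (pos u) k (map_refl3 \<phi> p)"
proof -
  have \<phi>': "\<phi> i < \<phi> j" if "i < j" "j < 4" for i j
  proof -
    have "(i, j) \<in> {(0, 1), (0, 2), (0, 3), (1, 2), (1, 3), (2, 3)}" using that by auto
    then show ?thesis using \<phi> by auto
  qed
  obtain w where w: "distinct w" "length w = 4" "set w \<subseteq> {0, 1, 2, 3}"
    and m: "model4 \<phi> (pos u) (\<lambda>i. w ! i)"
    using ex_model4[where \<phi> = \<phi>, OF inj_pos[OF u] \<phi>'] .
  have lab: "s \<in> set labels4" if "map_refl \<phi> s \<in> refl_T n" "s \<in> refl4" for s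
  proof -
    have "fst s < snd s" "fst s < 4" "snd s < 4"
      using that m by (auto simp: refl_T_def refl4_def model4_def)
    then have "fst s \<in> {0, 1, 2, 3}" "snd s \<in> {0, 1, 2, 3}" "fst s < snd s" by auto
    then show ?thesis by (cases s) (auto simp: labels4_def)
  qed
  have lab3: "map_refl \<phi> (fst x) \<in> refl_T n \<and> fst x \<in> set labels4 \<and>
      map_refl \<phi> (fst (snd x)) \<in> refl_T n \<and> fst (snd x) \<in> set labels4 \<and>
      map_refl \<phi> (snd (snd x)) \<in> refl_T n \<and> snd (snd x) \<in> set labels4"
    if "label_path n (pos u) (map_refl3 \<phi> x)" "x \<in> refl4 \<times> refl4 \<times> refl4" for x
    using that lab by (cases x) simp
  obtain r s t where rst: "p = (r, s, t)" by (cases p)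
  have r4: "r \<in> refl4" "s \<in> refl4" "t \<in> refl4" using p4 by (auto simp: rst)
  have up: "ascent (pos u) (map_refl \<phi> r)" "ascent (pos u \<circ> swap (map_refl \<phi> r)) (map_refl \<phi> s)"
    "ascent (pos u \<circ> swap (map_refl \<phi> r) \<circ> swap (map_refl \<phi> s)) (map_refl \<phi> t)"
    using p unfolding rst map_prod_simp label_path.simps ascent2_def by blast+
  note m' = model4_swap[OF m r4(1)]
  have asc: "ascent2 (\<lambda>i. w ! i) r s" "ascent2 ((\<lambda>i. w ! i) \<circ> swap r) s t"
    using up unfolding ascent2_def ascent_map[OF m r4(1)] ascent_map[OF m' r4(2)]
      ascent_map[OF model4_swap[OF m' r4(2)] r4(3)] by blast+
  obtain k where k: "k \<in> {2, 3, 4, 5}" and ok: "cycle_ok (\<lambda>i. w ! i) p k"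
    using ex_cycle_ok[OF w _ _ _ asc] lab3[OF p p4] unfolding rst by auto
  have cyc: "flip_cycle (pos u) k (map_refl3 \<phi> p)"
    using flip_cycle_map[OF m p4] ok by (simp add: cycle_ok_def)
  have "count_ok k (flip_orbit (pos u) k (map_refl3 \<phi> p)) (\<lambda>s t. (s, t) \<in> \<rho>)"
    if ro: "reflection_ordering n \<rho>" for \<rho>
  proof -
    obtain \<tau> where \<tau>: "\<tau> \<in> set order_signs" and eq: "\<And>s t. s \<in> set labels4 \<Longrightarrow> t \<in> set labels4 \<Longrightarrow>
      map_refl \<phi> s \<in> refl_T n \<Longrightarrow> map_refl \<phi> t \<in> refl_T n \<Longrightarrow>
      (sign_order \<tau> s t \<longleftrightarrow> (map_refl \<phi> s, map_refl \<phi> t) \<in> \<rho>)"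
      using reflection_ordering_signs[OF ro \<phi>] by blast
    have "count_ok k (flip_orbit (\<lambda>i. w ! i) k p) (sign_order \<tau>)"
      using ok \<tau> unfolding cycle_ok_def list_all_iff by blast
    also have "?this \<longleftrightarrow> ?thesis"
      unfolding flip_orbit_map(1)[OF m p4]
    proof (rule count_ok_map[symmetric])
      fix x assume x: "x \<in> set (flip_orbit (\<lambda>i. w ! i) k p)"
      then have x4: "x \<in> refl4 \<times> refl4 \<times> refl4" using flip_orbit_map(2)[OF m p4] by blast
      \<comment> \<open>The model ordering agrees with \<open>\<rho>\<close> only on labels in
        \<open>refl_T n\<close>; all labels of the orbit are such, because flips preserve valid
        label paths.\<close>
      have "label_path n (pos u) (map_refl3 \<phi> x)"
        using label_path_flip_orbit[OF u p, of k] x unfolding flip_orbit_map(1)[OF m p4] by simp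
      note l = lab3[OF this x4]
      show "increasing3 (\<lambda>s t. (s, t) \<in> \<rho>) (map_refl3 \<phi> x) \<longleftrightarrow> increasing3 (sign_order \<tau>) x"
        using l eq by (cases x) simp
    qed
    finally show ?thesis .
  qed
  then show ?thesis using k cyc unfolding cycle_counts_def by blast
qed

abbreviation supp :: "refl \<Rightarrow> nat set" where
  "supp t \<equiv> {fst t, snd t}"

lemma cycle_counts_small_support:
  assumes u: "u permutes {1..n}" and p: "label_path n (pos u) (r, s, t)"
    and card: "card (supp r \<union> supp s \<union> supp t) \<in> {3, 4}"
  shows "\<exists>k\<in>{2, 3, 4, 5}. cycle_counts n (pos u) k (r, s, t)"
proof -
  define A where "A = supp r \<union> supp s \<union> supp t"
  have A: "A \<subseteq> {1..n}" "finite A" using p by (auto simp: A_def refl_T_def)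
  \<comment> \<open>\<open>Suc n\<close> exceeds all letters of \<open>A\<close>, so after sorting
    it can only become \<open>\<phi> 3\<close>. It has a position too, as \<open>pos u\<close> is
    injective on all naturals.\<close>
  define B where "B = (if card A = 4 then A else insert (Suc n) A)"
  have cardA: "card A = 3 \<or> card A = 4" using card unfolding A_def[symmetric] by blast
  have "Suc n \<notin> A" using A by auto
  then have B: "finite B" "card B = 4" "A \<subseteq> B"
    using A cardA by (auto simp: B_def)
  define \<phi> where "\<phi> i = sorted_list_of_set B ! i" for i
  have len: "length (sorted_list_of_set B) = 4" using B by simp
  have \<phi>: "\<phi> i < \<phi> j" if "i < j" "j < 4" for i j
    unfolding \<phi>_def using that len by (intro sorted_wrt_nth_less[of "(<)"]) (simp_all add: strict_sorted_list_of_set)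
  have img: "\<exists>i<4. x = \<phi> i" if "x \<in> B" for x
    using that B len by (metis \<phi>_def in_set_conv_nth set_sorted_list_of_set)
  have mem: "\<phi> i \<in> B" if "i < 4" for i
    using that len B by (metis \<phi>_def nth_mem set_sorted_list_of_set)
  have B1: "B \<subseteq> {1..Suc n}" using A by (auto simp: B_def)
  have "\<phi> 2 < \<phi> 3" "\<phi> 3 \<le> Suc n" using \<phi>[of 2 3] mem[of 3] B1 by auto
  then have \<phi>2: "\<phi> 2 \<le> n" by simp
  have pre: "\<exists>s0\<in>refl4. s = map_refl \<phi> s0" if "supp s \<subseteq> A" for s
  proof -
    have "fst s \<in> B" "snd s \<in> B" using that B by auto
    then obtain i j where "i < 4" "j < 4" "fst s = \<phi> i" "snd s = \<phi> j" using img by meson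
    then show ?thesis by (intro bexI[of _ "(i, j)"]) (auto simp: refl4_def prod_eq_iff)
  qed
  obtain r0 where r: "r0 \<in> refl4" "r = map_refl \<phi> r0" using pre[of r] by (auto simp: A_def)
  obtain s0 where s: "s0 \<in> refl4" "s = map_refl \<phi> s0" using pre[of s] by (auto simp: A_def)
  obtain t0 where t: "t0 \<in> refl4" "t = map_refl \<phi> t0" using pre[of t] by (auto simp: A_def)
  have eq: "(r, s, t) = map_refl3 \<phi> (r0, s0, t0)" by (simp add: r s t)
  show ?thesis unfolding eq
    by (rule cycle_counts_model[OF u p[unfolded eq]])
      (use r s t \<phi>[of 0 1] \<phi>[of 1 2] \<phi>[of 2 3] \<phi>2 mem[of 0] B1 in auto)
qed

section \<open>Flipclasses with a commuting reflection\<close>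

lemma gflip_disjoint: "supp s \<inter> supp t = {} \<Longrightarrow> gflip q s t = (t, s)"
  by (cases s; cases t) auto

lemma reflection_ordering_triple:
  assumes ro: "reflection_ordering n \<rho>" and abc: "1 \<le> a" "a < b" "b < c" "c \<le> n"
  shows "((a, c), (b, c)) \<in> \<rho> \<longleftrightarrow> ((a, b), (a, c)) \<in> \<rho>"
    and "((a, b), (b, c)) \<in> \<rho> \<longleftrightarrow> ((a, b), (a, c)) \<in> \<rho>"
    and "((a, c), (a, b)) \<in> \<rho> \<longleftrightarrow> ((a, b), (a, c)) \<notin> \<rho>"
    and "((b, c), (a, c)) \<in> \<rho> \<longleftrightarrow> ((a, b), (a, c)) \<notin> \<rho>"
    and "((b, c), (a, b)) \<in> \<rho> \<longleftrightarrow> ((a, b), (a, c)) \<notin> \<rho>"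
proof -
  have ne: "(a, b) \<noteq> (a, c)" "(a, c) \<noteq> (b, c)" "(a, b) \<noteq> (b, c)" using abc by auto
  note P = reflection_ordering_props(5)[OF ro abc] ne reflection_ordering_props(2)[OF ro, of "(a, b)" "(a, c)"]
    reflection_ordering_props(2)[OF ro, of "(a, c)" "(b, c)"]
    reflection_ordering_props(2)[OF ro, of "(a, b)" "(b, c)"]
    reflection_ordering_props(3)[OF ro, of "(a, b)" "(a, c)" "(b, c)"]
    reflection_ordering_props(3)[OF ro, of "(b, c)" "(a, c)" "(a, b)"]
  show "((a, c), (b, c)) \<in> \<rho> \<longleftrightarrow> ((a, b), (a, c)) \<in> \<rho>"
    "((a, b), (b, c)) \<in> \<rho> \<longleftrightarrow> ((a, b), (a, c)) \<in> \<rho>"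
    "((a, c), (a, b)) \<in> \<rho> \<longleftrightarrow> ((a, b), (a, c)) \<notin> \<rho>"
    "((b, c), (a, c)) \<in> \<rho> \<longleftrightarrow> ((a, b), (a, c)) \<notin> \<rho>"
    "((b, c), (a, b)) \<in> \<rho> \<longleftrightarrow> ((a, b), (a, c)) \<notin> \<rho>"
    using P by argo+
qed

text \<open>On three letters the ordering is one of two opposite chains, and in each branch of
  \<open>gflip\<close> the old and the new pair point in opposite directions along it.\<close>

lemma gflip_increasing:
  assumes ro: "reflection_ordering n \<rho>" and st: "s \<in> refl_T n" "t \<in> refl_T n" "ascent2 q s t"
    and meet: "supp s \<inter> supp t \<noteq> {}"
  shows "(fst (gflip q s t), snd (gflip q s t)) \<in> \<rho> \<longleftrightarrow> (s, t) \<notin> \<rho>"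
proof -
  obtain a b c d where abcd: "s = (a, b)" "t = (c, d)" by (cases s; cases t)
  have lt: "1 \<le> a" "a < b" "b \<le> n" "1 \<le> c" "c < d" "d \<le> n"
    using st(1,2) by (auto simp: refl_T_def abcd)
  note tri = reflection_ordering_triple[OF ro]
  have "a \<noteq> c \<or> b \<noteq> d" using ascent2_neq[OF st(3)] by (simp add: abcd)
  moreover have "a = c \<or> a = d \<or> b = c \<or> b = d" using meet by (auto simp: abcd)
  ultimately have "a = c \<and> b < d \<or> a = c \<and> d < b \<or> b = d \<and> a < c \<or> b = d \<and> c < a \<or>
      a \<noteq> c \<and> b \<noteq> d \<and> b = c \<or> a \<noteq> c \<and> b \<noteq> d \<and> b \<noteq> c \<and> a = d" by arith
  then consider "a = c" "b < d" | "a = c" "d < b" | "b = d" "a < c" | "b = d" "c < a"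
    | "a \<noteq> c" "b \<noteq> d" "b = c" | "a \<noteq> c" "b \<noteq> d" "b \<noteq> c" "a = d"
    by blast
  then show ?thesis
  proof cases
    case 1 then show ?thesis using lt tri[of a b d] by (simp add: abcd)
  next
    case 2 then show ?thesis using lt tri[of a d b] by (simp add: abcd)
  next
    case 3 then show ?thesis using lt tri[of a c b] by (simp add: abcd)
  next
    case 4 then show ?thesis using lt tri[of c a b] by (simp add: abcd)
  next
    case 5 then show ?thesis using lt tri[of a b d] by (simp add: abcd)
  next
    case 6 then show ?thesis using lt tri[of c a b] by (simp add: abcd)
  qed
qed

text \<open>Flips only exchange neighbours here, so the orbit consists of the six arrangements of
  \<open>r\<close>, \<open>s\<close>, \<open>t\<close>, exactly one of which is sorted.\<close>

lemma cycle_counts_commuting: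
  assumes T: "r \<in> refl_T n" "s \<in> refl_T n" "t \<in> refl_T n"
    and d: "supp r \<inter> supp s = {}" "supp r \<inter> supp t = {}" "supp s \<inter> supp t = {}"
  shows "cycle_counts n q 3 (r, s, t)"
proof -
  have d': "supp s \<inter> supp r = {}" "supp t \<inter> supp r = {}" "supp t \<inter> supp s = {}" using d by auto
  note g = gflip_disjoint[OF d(1)] gflip_disjoint[OF d(2)] gflip_disjoint[OF d(3)]
    gflip_disjoint[OF d'(1)] gflip_disjoint[OF d'(2)] gflip_disjoint[OF d'(3)]
  have ne: "r \<noteq> s" "r \<noteq> t" "s \<noteq> t" using d by auto
  have it: "iterates (flip12 q) 3 (r, s, t) = [(r, s, t), (t, r, s), (s, t, r)]"
    "(flip12 q ^^ 3) (r, s, t) = (r, s, t)"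
    "map (flip2 q) [(r, s, t), (t, r, s), (s, t, r)] = [(r, t, s), (t, s, r), (s, r, t)]"
    by (simp_all add: eval_nat_numeral flip12_def g)
  have "count_ok 3 (flip_orbit q 3 (r, s, t)) (\<lambda>x y. (x, y) \<in> \<rho>)"
    if ro: "reflection_ordering n \<rho>" for \<rho>
  proof -
    note P = reflection_ordering_props[OF ro]
    have sw: "(y, x) \<in> \<rho> \<longleftrightarrow> (x, y) \<notin> \<rho>" if "x \<in> refl_T n" "y \<in> refl_T n" "x \<noteq> y" for x y
      using P(2)[of x y] P(4)[of x y] that by blast
    have sw': "(s, r) \<in> \<rho> \<longleftrightarrow> (r, s) \<notin> \<rho>" "(t, r) \<in> \<rho> \<longleftrightarrow> (r, t) \<notin> \<rho>" "(t, s) \<in> \<rho> \<longleftrightarrow> (s, t) \<notin> \<rho>"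
      using sw T ne by blast+
    have tr: "(r, s) \<in> \<rho> \<Longrightarrow> (s, t) \<in> \<rho> \<Longrightarrow> (r, t) \<in> \<rho>" "(r, s) \<notin> \<rho> \<Longrightarrow> (s, t) \<notin> \<rho> \<Longrightarrow> (r, t) \<notin> \<rho>"
      using P(3)[of r s t] P(3)[of t s r] sw' by blast+
    show ?thesis
      unfolding count_ok_def flip_orbit_def it using sw' tr
      by (cases "(r, s) \<in> \<rho>"; cases "(s, t) \<in> \<rho>"; cases "(r, t) \<in> \<rho>") simp_all
  qed
  moreover have "flip_cycle q 3 (r, s, t)"
    unfolding flip_cycle_def it using ne by simp
  ultimately show ?thesis unfolding cycle_counts_def by blast
qed

lemma gflip_cong:
  assumes "\<And>x. x \<in> supp s \<union> supp t \<Longrightarrow> q x = q' x"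
  shows "gflip q s t = gflip q' s t"
  using assms by (cases s; cases t) simp

text \<open>The six paths arise by inserting \<open>s\<close> at one of three places into the pair
  \<open>(t, t')\<close> or into its flip. Exactly one of these two pairs increases, and
  \<open>s\<close> fits into it at exactly one place.\<close>

lemma cycle_counts_commuting_one:
  assumes u: "u permutes {1..n}" and p: "label_path n (pos u) (s, t, t')"
    and d: "supp s \<inter> supp t = {}" "supp s \<inter> supp t' = {}" and meet: "supp t \<inter> supp t' \<noteq> {}"
  shows "cycle_counts n (pos u) 3 (s, t, t')"
proof -
  let ?q = "pos u"
  have T: "s \<in> refl_T n" "t \<in> refl_T n" "t' \<in> refl_T n" and asc: "ascent2 (?q \<circ> swap s) t t'"
    using p by auto
  have x: "swap s \<circ> u permutes {1..n}" by (rule swap_comp_permutes[OF u T(1)])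
  have pos: "?q \<circ> swap s = pos (swap s \<circ> u)" by (rule pos_swap_comp[OF u, symmetric])
  obtain r r' where g: "gflip (?q \<circ> swap s) t t' = (r, r')" by (cases "gflip (?q \<circ> swap s) t t'")
  note fl = gflip_ascent2[OF inj_pos[OF x] asc[unfolded pos] g[unfolded pos]]
  have Tr: "r \<in> refl_T n" "r' \<in> refl_T n"
    using gflip_refl_T[OF x T(2,3) asc[unfolded pos]] g[unfolded pos] by simp_all
  have supp_eq: "supp r \<union> supp r' = supp t \<union> supp t'" using fl by (simp add: insert_commute)
  then have dr: "supp s \<inter> supp r = {}" "supp s \<inter> supp r' = {}" using d by blast+
  have ds: "supp t \<inter> supp s = {}" "supp t' \<inter> supp s = {}" "supp r \<inter> supp s = {}" "supp r' \<inter> supp s = {}"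
    using d dr by blast+
  \<comment> \<open>\<open>s\<close> moves none of the letters involved, so the pair flips in the
    same way before and after \<open>s\<close>.\<close>
  have fix_s: "(?q \<circ> swap s) x = ?q x" if "x \<in> supp t \<union> supp t'" for x
    using that d by (auto simp: transpose_def)
  have "gflip ?q r r' = gflip (?q \<circ> swap s) r r'"
    by (rule gflip_cong) (use fix_s supp_eq in metis)
  then have gb: "gflip ?q r r' = (t, t')" using fl unfolding pos by simp
  note dis = gflip_disjoint[OF d(1)] gflip_disjoint[OF d(2)] gflip_disjoint[OF dr(1)] gflip_disjoint[OF dr(2)]
    gflip_disjoint[OF ds(1)] gflip_disjoint[OF ds(2)] gflip_disjoint[OF ds(3)] gflip_disjoint[OF ds(4)]
  have ne: "s \<noteq> t" "s \<noteq> t'" "s \<noteq> r" "s \<noteq> r'" using d dr by auto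
  have ne': "r \<noteq> t" "r' \<noteq> t'" using fl by auto
  have it: "iterates (flip12 ?q) 3 (s, t, t') = [(s, t, t'), (r, s, r'), (t, t', s)]"
    "(flip12 ?q ^^ 3) (s, t, t') = (s, t, t')"
    "map (flip2 ?q) [(s, t, t'), (r, s, r'), (t, t', s)] = [(s, r, r'), (r, r', s), (t, s, t')]"
    by (simp_all add: eval_nat_numeral flip12_def g gb dis)
  have "count_ok 3 (flip_orbit ?q 3 (s, t, t')) (\<lambda>x y. (x, y) \<in> \<rho>)"
    if ro: "reflection_ordering n \<rho>" for \<rho>
  proof -
    note P = reflection_ordering_props[OF ro]
    have sw: "(y, x) \<in> \<rho> \<longleftrightarrow> (x, y) \<notin> \<rho>" if "x \<in> refl_T n" "y \<in> refl_T n" "x \<noteq> y" for x y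
      using P(2)[of x y] P(4)[of x y] that by blast
    have sw': "(t, s) \<in> \<rho> \<longleftrightarrow> (s, t) \<notin> \<rho>" "(t', s) \<in> \<rho> \<longleftrightarrow> (s, t') \<notin> \<rho>"
      "(r, s) \<in> \<rho> \<longleftrightarrow> (s, r) \<notin> \<rho>" "(r', s) \<in> \<rho> \<longleftrightarrow> (s, r') \<notin> \<rho>"
      using sw T Tr ne by blast+
    have rk: "(r, r') \<in> \<rho> \<longleftrightarrow> (t, t') \<notin> \<rho>"
      using gflip_increasing[OF ro T(2,3) asc meet] g by simp
    have tr: "(x, y) \<in> \<rho> \<Longrightarrow> (s, x) \<in> \<rho> \<Longrightarrow> (s, y) \<in> \<rho>" for x y using P(3)[of s x y] by blast
    \<comment> \<open>The implications are transitivity within each pair, in the direction in which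
      it is ordered; they exclude the combinations in which \<open>s\<close> would fit nowhere or
      twice.\<close>
    have "(t, t') \<in> \<rho> \<and> (r, r') \<notin> \<rho> \<and> ((s, t) \<in> \<rho> \<longrightarrow> (s, t') \<in> \<rho>) \<and> ((s, r') \<in> \<rho> \<longrightarrow> (s, r) \<in> \<rho>) \<or>
        (t, t') \<notin> \<rho> \<and> (r, r') \<in> \<rho> \<and> ((s, t') \<in> \<rho> \<longrightarrow> (s, t) \<in> \<rho>) \<and> ((s, r) \<in> \<rho> \<longrightarrow> (s, r') \<in> \<rho>)"
      using rk tr P(4)[OF T(2,3)] P(4)[OF Tr] by blast
    then show ?thesis
      unfolding count_ok_def flip_orbit_def it append.simps filter.simps increasing3.simps sw'
      by (elim disjE conjE) (simp_all split: if_splits, argo+)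
  qed
  moreover have "flip_cycle ?q 3 (s, t, t')"
    unfolding flip_cycle_def it using ne ne' by auto
  ultimately show ?thesis unfolding cycle_counts_def by blast
qed

lemma card_supp_Un:
  assumes "r \<in> refl_T n" "s \<in> refl_T n" "r \<noteq> s" "supp r \<inter> supp s \<noteq> {}"
  shows "card (supp r \<union> supp s) = 3"
  using assms by (cases r; cases s) (auto simp: refl_T_def card_insert_if)

text \<open>\<open>r\<close> and \<open>s\<close> span three letters, and \<open>t\<close> meets
  these, so it adds at most one.\<close>

lemma card_supp_Un3:
  assumes T: "r \<in> refl_T n" "s \<in> refl_T n" "t \<in> refl_T n" and rs: "r \<noteq> s" "supp r \<inter> supp s \<noteq> {}"
    and t: "supp t \<inter> (supp r \<union> supp s) \<noteq> {}"
  shows "card (supp r \<union> supp s \<union> supp t) \<in> {3, 4}"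
proof -
  define A where "A = supp r \<union> supp s"
  have A: "finite A" "card A = 3" unfolding A_def by (simp, rule card_supp_Un[OF T(1,2) rs])
  obtain x where x: "supp t - A \<subseteq> {x}" using t unfolding A_def[symmetric] by (cases "fst t \<in> A") blast+
  have "card (A \<union> supp t) \<le> card (insert x A)" using x A by (intro card_mono) auto
  also have "\<dots> \<le> 4" using A by (simp add: card_insert_if)
  finally have "card (A \<union> supp t) \<le> 4" .
  moreover have "3 \<le> card (A \<union> supp t)" using A card_mono[of "A \<union> supp t" A] by auto
  ultimately have "card (A \<union> supp t) \<in> {3, 4}" by auto
  then show ?thesis by (simp only: A_def)
qed

text \<open>The certificate may start at another path of the class: if only one label is disjoint
  from both others, one or two flips bring it to the front, where
  \<open>cycle_counts_commuting_one\<close> expects it. In all remaining cases the labels are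
  connected and move at most four letters, or are pairwise disjoint.\<close>

lemma ex_cycle_counts:
  assumes u: "u permutes {1..n}" and p: "label_path n (pos u) p"
  shows "\<exists>p'\<in>{p, flip1 (pos u) p, flip12 (pos u) p}. \<exists>k\<in>{2, 3, 4, 5}. cycle_counts n (pos u) k p'"
proof -
  obtain r s t where rst: "p = (r, s, t)" by (cases p)
  have T: "r \<in> refl_T n" "s \<in> refl_T n" "t \<in> refl_T n" and ne: "r \<noteq> s" "s \<noteq> t"
    using p ascent2_neq[of "pos u" r s] ascent2_neq[of "pos u \<circ> swap r" s t] unfolding rst label_path.simps
    by blast+
  let ?d = "\<lambda>x y. supp x \<inter> supp y = {}"
  have sym: "?d x y \<longleftrightarrow> ?d y x" for x y :: refl by auto
  consider (all) "?d r s" "?d r t" "?d s t" | (first) "?d r s" "?d r t" "\<not> ?d s t"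
    | (middle) "?d r s" "\<not> ?d r t" "?d s t" | (last) "\<not> ?d r s" "?d r t" "?d s t"
    | (rs) "\<not> ?d r s" "\<not> ?d r t \<or> \<not> ?d s t" | (rt) "?d r s" "\<not> ?d r t" "\<not> ?d s t" by argo
  then show ?thesis
  proof cases
    case all
    then have "cycle_counts n (pos u) 3 p" using cycle_counts_commuting[OF T] by (simp add: rst)
    then show ?thesis by blast
  next
    case first
    then have "cycle_counts n (pos u) 3 p"
      using cycle_counts_commuting_one[OF u p[unfolded rst]] by (simp add: rst)
    then show ?thesis by blast
  next
    case middle
    have f: "flip1 (pos u) p = (s, r, t)" by (simp only: rst flip1.simps gflip_disjoint[OF middle(1)] fst_conv snd_conv)
    have "cycle_counts n (pos u) 3 (flip1 (pos u) p)"
      using label_path_flip1(1)[OF u p] middle sym unfolding f by (intro cycle_counts_commuting_one[OF u]) blast+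
    then show ?thesis by blast
  next
    case last
    have "?d r t" "?d s t" using last by blast+
    then have f: "flip12 (pos u) p = (t, r, s)"
      by (simp only: rst flip12_def flip1.simps flip2.simps gflip_disjoint fst_conv snd_conv)
    have "label_path n (pos u) (flip12 (pos u) p)"
      unfolding flip12_def by (intro label_path_flip1(1)[OF u] label_path_flip2(1)[OF u] p)
    then have "cycle_counts n (pos u) 3 (flip12 (pos u) p)"
      using last sym unfolding f by (intro cycle_counts_commuting_one[OF u]) blast+
    then show ?thesis by blast
  next
    case rs
    have "card (supp r \<union> supp s \<union> supp t) \<in> {3, 4}"
      by (rule card_supp_Un3[OF T ne(1) rs(1)]) (use rs(2) in blast)
    then show ?thesis using cycle_counts_small_support[OF u p[unfolded rst]] by (auto simp: rst)
  next
    case rt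
    have "card (supp s \<union> supp t \<union> supp r) \<in> {3, 4}"
      by (rule card_supp_Un3[OF T(2,3,1) ne(2) rt(3)]) (use rt(2) in blast)
    moreover have "supp s \<union> supp t \<union> supp r = supp r \<union> supp s \<union> supp t" by blast
    ultimately show ?thesis using cycle_counts_small_support[OF u p[unfolded rst]] by (auto simp: rst)
  qed
qed

section \<open>Flipclasses as crowns\<close>

lemma iterates_conv_funpow: "iterates f k x = map (\<lambda>j. (f ^^ j) x) [0..<k]"
proof (induction k arbitrary: x)
  case (Suc k)
  have "iterates f (Suc k) x = x # map (\<lambda>j. (f ^^ Suc j) x) [0..<k]"
    by (simp add: Suc funpow_swap1)
  also have "\<dots> = map (\<lambda>j. (f ^^ j) x) (0 # map Suc [0..<k])" by (simp add: comp_def)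
  also have "0 # map Suc [0..<k] = [0..<Suc k]" by (simp only: map_Suc_upt upt_conv_Cons[of 0 "Suc k"] zero_less_Suc)
  finally show ?case .
qed simp

lemma bpaths_flip_op:
  assumes u: "u permutes {1..n}" and xs: "xs \<in> bpaths n 3 u v" and i: "i \<in> {1, 2}"
  shows "flip_op n i xs \<in> bpaths n 3 u v" and "flip_op n i (flip_op n i xs) = xs" and "flip_op n i xs \<noteq> xs"
proof -
  obtain p where p: "label_path n (pos u) p" and last: "last (vertex_path u p) = v" and xs: "xs = vertex_path u p"
    using xs unfolding bpaths_3_eq[OF u] by blast
  define p' where "p' = (if i = 1 then flip1 (pos u) p else flip2 (pos u) p)"
  have flip: "flip_op n i (vertex_path u p) = vertex_path u p'" "flip_op n i (vertex_path u p') = vertex_path u p"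
    and p': "label_path n (pos u) p'" "p' \<noteq> p"
    using i label_path_flip1[OF u p] label_path_flip2[OF u p]
      label_path_flip1(2)[OF u label_path_flip1(1)[OF u p]] label_path_flip2(2)[OF u label_path_flip2(1)[OF u p]]
    unfolding p'_def by auto
  have nth: "last (vertex_path u q) = vertex_path u q ! 3" for q by (cases q) simp
  have "flip_op n i (vertex_path u p) ! 3 = vertex_path u p ! 3" using i by (auto simp: flip_op_def)
  then have "last (vertex_path u p') = v" using last by (simp only: nth flip)
  then show "flip_op n i xs \<in> bpaths n 3 u v"
    unfolding bpaths_3_eq[OF u] xs flip(1) using p' by blast
  show "flip_op n i (flip_op n i xs) = xs" unfolding xs flip ..
  show "flip_op n i xs \<noteq> xs" unfolding xs flip using vertex_path_inject[OF u p'(1) p] p'(2) by blast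
qed

lemma finite_bpaths_3:
  assumes u: "u permutes {1..n}"
  shows "finite (bpaths n 3 u v)"
proof (rule finite_subset)
  show "bpaths n 3 u v \<subseteq> vertex_path u ` (refl_T n \<times> refl_T n \<times> refl_T n)"
    unfolding bpaths_3_eq[OF u] by force
  have "refl_T n \<subseteq> {1..n} \<times> {1..n}" by (auto simp: refl_T_def)
  then have "finite (refl_T n)" by (rule finite_subset) simp
  then show "finite (vertex_path u ` (refl_T n \<times> refl_T n \<times> refl_T n))" by simp
qed

section \<open>The flip group and its orbits\<close>

lemma carrier_flip_group:
  "carrier (flip_group n 3 u v) =
     generate (BijGroup (bpaths n 3 u v)) {flip_perm n 3 u v 1, flip_perm n 3 u v 2}"
proof -
  have "{1..<3} = {1, 2::nat}" by auto
  then show ?thesis by (simp add: flip_group_def)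
qed

lemma flip_perm_Bij:
  assumes u: "u permutes {1..n}" and i: "i \<in> {1, 2}"
  shows "flip_perm n 3 u v i \<in> Bij (bpaths n 3 u v)"
proof -
  have "bij_betw (flip_op n i) (bpaths n 3 u v) (bpaths n 3 u v)"
    by (rule bij_betw_byWitness[where f' = "flip_op n i"]) (use bpaths_flip_op[OF u _ i] in auto)
  then show ?thesis unfolding Bij_def flip_perm_def by simp
qed

text \<open>If there is no path of length 3, the group is trivial, which \<open>is_dihedral\<close>
  admits as a separate case. Otherwise a flip changes every path, so neither generator is the
  identity.\<close>

lemma is_dihedral_flip_group:
  assumes u: "u permutes {1..n}"
  shows "is_dihedral (flip_group n 3 u v)"
proof -
  let ?P = "bpaths n 3 u v" and ?f = "flip_perm n 3 u v"
  let ?G = "BijGroup ?P"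
  interpret G: group ?G by (rule group_BijGroup)
  have car: "?f i \<in> carrier ?G" if "i \<in> {1, 2}" for i
    using flip_perm_Bij[OF u that] by (simp add: BijGroup_def)
  have Bij_E: "carrier ?G \<subseteq> ?P \<rightarrow>\<^sub>E ?P"
    by (auto simp: BijGroup_def Bij_def bij_betw_def PiE_def extensional_def)
  show ?thesis
  proof (cases "?P = {}")
    case True
    have sub: "carrier (flip_group n 3 u v) \<subseteq> carrier ?G"
      unfolding carrier_flip_group using car by (intro G.generate_incl) auto
    have triv: "carrier ?G \<subseteq> {\<lambda>_. undefined}" using Bij_E unfolding True by simp
    have "\<one>\<^bsub>flip_group n 3 u v\<^esub> \<in> carrier (flip_group n 3 u v)"
      unfolding carrier_flip_group by (simp add: flip_group_def generate.one)
    then have "carrier (flip_group n 3 u v) = {\<one>\<^bsub>flip_group n 3 u v\<^esub>}"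
      using subset_singletonD[OF order_trans[OF sub triv]] by fastforce
    then show ?thesis unfolding is_dihedral_def by blast
  next
    case False
    then obtain xs where xs: "xs \<in> ?P" by blast
    have fin: "finite (carrier ?G)"
      using finite_subset[OF Bij_E] finite_PiE[of ?P "\<lambda>_. ?P"] finite_bpaths_3[OF u] by blast
    have one: "\<one>\<^bsub>?G\<^esub> = (\<lambda>x\<in>?P. x)" by (simp add: BijGroup_def)
    have sq: "?f i \<otimes>\<^bsub>?G\<^esub> ?f i = \<one>\<^bsub>?G\<^esub>" if i: "i \<in> {1, 2}" for i
    proof -
      have "compose ?P (?f i) (?f i) = (\<lambda>x\<in>?P. x)"
        using bpaths_flip_op(1,2)[OF u _ i] by (auto simp: compose_def flip_perm_def fun_eq_iff restrict_def)
      then show ?thesis using flip_perm_Bij[OF u i] unfolding one by (simp add: BijGroup_def)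
    qed
    have ne: "?f i \<noteq> \<one>\<^bsub>?G\<^esub>" if i: "i \<in> {1, 2}" for i
    proof
      assume "?f i = \<one>\<^bsub>?G\<^esub>"
      then have "?f i xs = xs" using xs by (simp add: one)
      then show False using bpaths_flip_op(3)[OF u xs i] xs by (simp add: flip_perm_def)
    qed
    have "is_dihedral (?G\<lparr>carrier := generate ?G {?f 1, ?f 2}\<rparr>)"
      by (rule G.is_dihedral_generate[OF fin]) (use car sq ne in auto)
    moreover have "{1..<3} = {1, 2::nat}" by auto
    ultimately show ?thesis by (simp add: flip_group_def)
  qed
qed

text \<open>Characterizes the orbit as the least set that contains \<open>p\<close> and is closed
  under both flips, so that it can be compared with an explicit list of paths without handling group
  elements.\<close>

lemma flipclass_closed:
  assumes u: "u permutes {1..n}" and F: "F = (\<lambda>g. g p) ` carrier (flip_group n 3 u v)"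
    and p: "p \<in> bpaths n 3 u v"
  shows "p \<in> F"
    and "\<And>xs i. xs \<in> F \<Longrightarrow> i \<in> {1, 2} \<Longrightarrow> flip_op n i xs \<in> F"
    and "\<And>E. p \<in> E \<Longrightarrow> E \<subseteq> bpaths n 3 u v \<Longrightarrow>
      (\<And>xs i. xs \<in> E \<Longrightarrow> i \<in> {1, 2} \<Longrightarrow> flip_op n i xs \<in> E) \<Longrightarrow> F \<subseteq> E"
proof -
  let ?P = "bpaths n 3 u v" and ?f = "flip_perm n 3 u v"
  let ?G = "BijGroup ?P"
  interpret G: group ?G by (rule group_BijGroup)
  have Bij: "?f i \<in> Bij ?P" if "i \<in> {1, 2}" for i by (rule flip_perm_Bij[OF u that])
  then have "{?f 1, ?f 2} \<subseteq> carrier ?G" by (simp add: BijGroup_def)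
  then have gen: "generate ?G {?f 1, ?f 2} \<subseteq> carrier ?G" by (rule G.generate_incl)
  have gen_Bij: "g \<in> Bij ?P" if "g \<in> generate ?G {?f 1, ?f 2}" for g
    using that gen by (auto simp: BijGroup_def)
  have mem: "g x \<in> ?P" if "g \<in> Bij ?P" "x \<in> ?P" for g x
    using that by (auto simp: Bij_def bij_betw_def)
  have mult: "(g \<otimes>\<^bsub>?G\<^esub> h) x = g (h x)" if "g \<in> Bij ?P" "h \<in> Bij ?P" "x \<in> ?P" for g h x
    using that by (simp add: BijGroup_def compose_def)
  have f: "?f i x = flip_op n i x" if "x \<in> ?P" for i x using that by (simp add: flip_perm_def)
  have one_app: "\<one>\<^bsub>?G\<^esub> x = x" if "x \<in> ?P" for x using that by (simp add: BijGroup_def)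
  note F = F[unfolded carrier_flip_group]
  show "p \<in> F" unfolding F by (rule image_eqI[where x = "\<one>\<^bsub>?G\<^esub>"], rule one_app[OF p, symmetric], rule generate.one)
  show "flip_op n i xs \<in> F" if xs: "xs \<in> F" and i: "i \<in> {1, 2}" for xs i
  proof -
    obtain g where g: "g \<in> generate ?G {?f 1, ?f 2}" "xs = g p" using xs unfolding F by blast
    have 1: "?f i \<otimes>\<^bsub>?G\<^esub> g \<in> generate ?G {?f 1, ?f 2}"
      by (rule generate.eng[OF generate.incl g(1)]) (use i in auto)
    have 2: "flip_op n i xs = (?f i \<otimes>\<^bsub>?G\<^esub> g) p"
      using mult[OF Bij[OF i] gen_Bij[OF g(1)] p] f[OF mem[OF gen_Bij[OF g(1)] p]] g(2) by simp
    show ?thesis unfolding F by (rule image_eqI[where x = "?f i \<otimes>\<^bsub>?G\<^esub> g"], rule 2, rule 1)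
  qed
  show "F \<subseteq> E" if pE: "p \<in> E" and E: "E \<subseteq> ?P"
    and cl: "\<And>xs i. xs \<in> E \<Longrightarrow> i \<in> {1, 2} \<Longrightarrow> flip_op n i xs \<in> E" for E
  proof -
    have "\<forall>x\<in>E. g x \<in> E" if "g \<in> generate ?G {?f 1, ?f 2}" for g
      using that
    proof (induction rule: generate.induct)
      case one
      show ?case using E by (auto simp: one_app)
    next
      case (incl h)
      then obtain i where i: "i \<in> {1, 2}" "h = ?f i" by auto
      show ?case
      proof
        fix x assume "x \<in> E"
        then show "h x \<in> E" using cl[OF _ i(1)] f[of x i] E by (auto simp: i(2))
      qed
    next
      case (inv h)
      then obtain i where i: "i \<in> {1, 2}" "h = ?f i" by auto
      have "h \<otimes>\<^bsub>?G\<^esub> h = \<one>\<^bsub>?G\<^esub>"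
      proof
        fix x
        show "(h \<otimes>\<^bsub>?G\<^esub> h) x = \<one>\<^bsub>?G\<^esub> x"
        proof (cases "x \<in> ?P")
          case True
          then show ?thesis
            using mult[OF Bij[OF i(1)] Bij[OF i(1)] True] bpaths_flip_op(1,2)[OF u True i(1)]
            by (simp add: i(2) f one_app)
        qed (use Bij[OF i(1)] in \<open>simp add: i(2) BijGroup_def compose_def\<close>)
      qed
      then have "inv\<^bsub>?G\<^esub> h = h"
        using Bij[OF i(1)] by (intro G.inv_equality) (simp_all add: i(2) BijGroup_def)
      moreover have "\<forall>x\<in>E. h x \<in> E"
      proof
        fix x assume "x \<in> E"
        then show "h x \<in> E" using cl[OF _ i(1)] f[of x i] E by (auto simp: i(2))
      qed
      ultimately show ?case by (simp only:)
    next
      case (eng g h)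
      show ?case
      proof
        fix x assume x: "x \<in> E"
        then have "(g \<otimes>\<^bsub>?G\<^esub> h) x = g (h x)" using E eng.hyps by (intro mult gen_Bij) auto
        then show "(g \<otimes>\<^bsub>?G\<^esub> h) x \<in> E" using eng.IH x by simp
      qed
    qed
    then show ?thesis unfolding F using pE by blast
  qed
qed

section \<open>Closing the cycle into a crown\<close>

lemma sign_swap_comp:
  assumes "x permutes {1..n}" "t \<in> refl_T n"
  shows "sign (swap t \<circ> x) = - sign x"
proof -
  have "permutation x" using assms(1) by (auto simp: permutation_permutes)
  then show ?thesis using assms(2)
    by (subst sign_compose) (auto simp: permutation_swap_id sign_swap_id refl_T_def)
qed

text \<open>Lengths only separate the vertices of a single path. A lower and an upper middle vertex
  taken from different paths of the class are separated by the sign, which alternates along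
  edges.\<close>

lemma bpaths_3_vertices:
  assumes "[u, x, y, v] \<in> bpaths n 3 u v"
  shows "blen n u < blen n x" "blen n x < blen n y" "blen n y < blen n v"
    and "sign x = - sign u" "sign y = sign u" "sign v = - sign u"
proof -
  have e: "bgraph_edge n u x" "bgraph_edge n x y" "bgraph_edge n y v"
    using assms by (auto simp: bpaths_def eval_nat_numeral less_Suc_eq all_conj_distrib)
  then show "blen n u < blen n x" "blen n x < blen n y" "blen n y < blen n v"
    by (auto simp: bgraph_edge_def bedge_def)
  have s: "sign b = - sign a" if "bgraph_edge n a b" for a b
    using that sign_swap_comp unfolding bgraph_edge_def bedge_iff_ascent by blast
  show "sign x = - sign u" "sign y = sign u" "sign v = - sign u"
    using e[THEN s] by simp_all
qed

text \<open>The cyclic sequence of paths e 0, flip2 (e 0), e 1, flip2 (e 1), ... alternates the two flips.\<close>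
lemma flip_cycle_crown:
  assumes u: "u permutes {1..n}" and p: "label_path n (pos u) p" and k: "0 < k"
    and cyc: "flip_cycle (pos u) k p" and v: "v = last (vertex_path u p)"
  obtains X Y where "crown_vertices_distinct u X Y v k"
    and "vertex_path u ` set (flip_orbit (pos u) k p) = (\<lambda>(x, y). [u, x, y, v]) ` crown_middle X Y k"
    and "\<forall>j<k. flip_op n 1 [u, X j, Y (Suc j mod k), v] = [u, X (Suc j mod k), Y (Suc j mod k), v]"
    and "\<forall>j<k. flip_op n 1 [u, X (Suc j mod k), Y (Suc j mod k), v] = [u, X j, Y (Suc j mod k), v]"
    and "\<forall>j<k. flip_op n 2 [u, X j, Y j, v] = [u, X j, Y (Suc j mod k), v]"
    and "\<forall>j<k. flip_op n 2 [u, X j, Y (Suc j mod k), v] = [u, X j, Y j, v]"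
    and "distinct (flip_orbit (pos u) k p)"
proof -
  let ?q = "pos u" and ?W = "vertex_path u"
  define e1 where "e1 j = (flip12 ?q ^^ j) p" for j
  define e2 where "e2 j = flip2 ?q (e1 j)" for j
  define X where "X j = ?W (e1 j) ! 1" for j
  define Y where "Y j = ?W (e1 j) ! 2" for j
  have it: "iterates (flip12 ?q) k p = map e1 [0..<k]"
    by (simp add: iterates_conv_funpow e1_def)
  have orbit: "flip_orbit ?q k p = map e1 [0..<k] @ map e2 [0..<k]"
    by (simp add: flip_orbit_def it e2_def)
  have lp1: "label_path n ?q (e1 j)" for j
    unfolding e1_def
  proof (induction j)
    case (Suc j)
    then show ?case
      unfolding funpow.simps o_apply flip12_def by (intro label_path_flip1(1)[OF u] label_path_flip2(1)[OF u])
  qed (simp add: p)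
  have lp2: "label_path n ?q (e2 j)" for j
    unfolding e2_def by (rule label_path_flip2(1)[OF u lp1])
  have m: "Suc j mod k < k" for j using k by simp
  have e1_k: "e1 k = e1 0" using cyc by (simp add: flip_cycle_def e1_def)
  \<comment> \<open>For \<open>j = k - 1\<close> the index wraps around to 0, which is the return
    condition of the certificate.\<close>
  have next1: "flip1 ?q (e2 j) = e1 (Suc j mod k)" if "j < k" for j
  proof -
    have "flip1 ?q (e2 j) = e1 (Suc j)" by (simp add: e2_def e1_def flip12_def)
    also have "\<dots> = e1 (Suc j mod k)" using that e1_k by (cases "Suc j = k") auto
    finally show ?thesis .
  qed
  have next1': "flip1 ?q (e1 (Suc j mod k)) = e2 j" if "j < k" for j
    using label_path_flip1(3)[OF u lp2, of j] next1[OF that] by simp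
  have back2: "flip2 ?q (e2 j) = e1 j" for j
    unfolding e2_def by (rule label_path_flip2(3)[OF u lp1])
  have op1: "flip_op n 1 (?W (e2 j)) = ?W (e1 (Suc j mod k))"
    "flip_op n 1 (?W (e1 (Suc j mod k))) = ?W (e2 j)" if "j < k" for j
    using label_path_flip1(2)[OF u lp2, of j] label_path_flip1(2)[OF u lp1, of "Suc j mod k"]
      next1[OF that] next1'[OF that] by simp_all
  have op2: "flip_op n 2 (?W (e1 j)) = ?W (e2 j)" "flip_op n 2 (?W (e2 j)) = ?W (e1 j)" for j
    using label_path_flip2(2)[OF u lp1, of j] label_path_flip2(2)[OF u lp2, of j] back2
    by (simp_all add: e2_def)
  have len: "length (?W x) = 4" "?W x ! 0 = u" "last (?W x) = ?W x ! 3" for x by (cases x; simp)+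
  have list4: "xs = [xs ! 0, xs ! 1, xs ! 2, xs ! 3]" if "length xs = 4" for xs :: "'z list"
    using that by (auto simp: eval_nat_numeral length_Suc_conv)
  have other: "flip_op n 1 xs ! 2 = xs ! 2" "flip_op n 1 xs ! 3 = xs ! 3"
    "flip_op n 2 xs ! 1 = xs ! 1" "flip_op n 2 xs ! 3 = xs ! 3" for xs
    by (simp_all add: flip_op_def)
  have W12: "?W (e2 j) ! 3 = ?W (e1 j) ! 3" for j using other(4)[of "?W (e1 j)"] op2(1)[of j] by simp
  have last1: "?W (e1 j) ! 3 = v" if "j < k" for j
    using that
  proof (induction j)
    case 0
    then show ?case using v by (simp add: e1_def len)
  next
    case (Suc j)
    have "?W (e1 (Suc j)) ! 3 = ?W (e2 j) ! 3"
      using other(2)[of "?W (e2 j)"] op1(1)[of j] Suc.prems by simp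
    then show ?case using W12 Suc by simp
  qed
  have W1: "?W (e1 j) = [u, X j, Y j, v]" if "j < k" for j
    using list4[OF len(1), of "e1 j"] last1[OF that] len(2) by (simp add: X_def Y_def)
  have W2: "?W (e2 j) = [u, X j, Y (Suc j mod k), v]" if "j < k" for j
  proof -
    have "?W (e2 j) ! 1 = X j" using other(3)[of "?W (e1 j)"] op2(1)[of j] by (simp add: X_def)
    moreover have "?W (e2 j) ! 2 = Y (Suc j mod k)"
      using other(1)[of "?W (e2 j)"] op1(1)[OF that] by (simp add: Y_def)
    ultimately show ?thesis
      using list4[OF len(1), of "e2 j"] W12[of j] last1[OF that] len(2) by simp
  qed
  have fst_inj: "i = j" if "fst (e1 i) = fst (e1 j)" "i < k" "j < k" for i j
  proof -
    have "distinct (map (\<lambda>j. fst (e1 j)) [0..<k])" using cyc by (simp add: flip_cycle_def it comp_def)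
    then show ?thesis using that by (auto simp: distinct_map dest: inj_onD)
  qed
  have thd_inj: "i = j" if "snd (snd (e1 i)) = snd (snd (e1 j))" "i < k" "j < k" for i j
  proof -
    have "distinct (map (\<lambda>j. snd (snd (e1 j))) [0..<k])" using cyc by (simp add: flip_cycle_def it comp_def)
    then show ?thesis using that by (auto simp: distinct_map dest: inj_onD)
  qed
  have X_inj: "i = j" if "X i = X j" "i < k" "j < k" for i j
  proof (rule fst_inj[OF _ that(2,3)])
    obtain r s t r' s' t' where e: "e1 i = (r, s, t)" "e1 j = (r', s', t')" by (cases "e1 i"; cases "e1 j")
    have "r \<in> refl_T n" "r' \<in> refl_T n" using lp1[of i] lp1[of j] by (simp_all add: e)
    then have "r = r'" using that(1) swap_comp_inject[OF u, of r r'] by (simp add: X_def e refl_T_def split_beta)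
    then show "fst (e1 i) = fst (e1 j)" by (simp add: e)
  qed
  \<comment> \<open>Equal upper vertices reach \<open>v\<close> by the same last label, and the
    certificate makes these labels distinct.\<close>
  have Y_inj: "i = j" if "Y i = Y j" "i < k" "j < k" for i j
  proof (rule thd_inj[OF _ that(2,3)])
    obtain r s t r' s' t' where e: "e1 i = (r, s, t)" "e1 j = (r', s', t')" by (cases "e1 i"; cases "e1 j")
    have T: "r \<in> refl_T n" "s \<in> refl_T n" "t \<in> refl_T n" "t' \<in> refl_T n"
      using lp1[of i] lp1[of j] by (simp_all add: e)
    have Y: "Y i permutes {1..n}"
      using swap_comp_permutes[OF swap_comp_permutes[OF u T(1)] T(2)] by (simp add: Y_def e)
    have "v = swap t \<circ> Y i" using last1[OF that(2)] by (simp add: e Y_def)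
    moreover have "v = swap t' \<circ> Y j" using last1[OF that(3)] by (simp add: e Y_def)
    ultimately have "swap t \<circ> Y i = swap t' \<circ> Y i" using that(1) by simp
    then have "t = t'" using swap_comp_inject[OF Y, of t t'] T by (simp add: refl_T_def split_beta)
    then show "snd (snd (e1 i)) = snd (snd (e1 j))" by (simp add: e)
  qed
  have path: "[u, X j, Y j, v] \<in> bpaths n 3 u v" if "j < k" for j
  proof -
    have "last (?W (e1 j)) = v" using last1[OF that] len(3) by simp
    then show ?thesis unfolding bpaths_3_eq[OF u] W1[OF that, symmetric] using lp1 by blast
  qed
  have sgn: "sign u \<noteq> - sign u" by (simp add: sign_def)
  have XY: "X i \<noteq> Y j" if "i < k" "j < k" for i j
    using bpaths_3_vertices(4)[OF path[OF that(1)]] bpaths_3_vertices(5)[OF path[OF that(2)]] sgn by metis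
  have ne: "X i \<noteq> u \<and> X i \<noteq> v \<and> Y i \<noteq> u \<and> Y i \<noteq> v \<and> u \<noteq> v" if "i < k" for i
    using bpaths_3_vertices(1-3)[OF path[OF that]] by auto
  have dist: "crown_vertices_distinct u X Y v k"
    unfolding crown_vertices_distinct_def inj_on_def using k ne XY X_inj Y_inj by blast
  have "vertex_path u ` set (flip_orbit ?q k p) = (\<lambda>j. ?W (e1 j)) ` {..<k} \<union> (\<lambda>j. ?W (e2 j)) ` {..<k}"
    by (simp only: orbit set_append set_map image_Un image_image set_upt atLeast0LessThan)
  also have "\<dots> = (\<lambda>j. [u, X j, Y j, v]) ` {..<k} \<union> (\<lambda>j. [u, X j, Y (Suc j mod k), v]) ` {..<k}"
    using W1 W2 by (intro arg_cong2[of _ _ _ _ "(\<union>)"] image_cong) auto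
  also have "\<dots> = (\<lambda>(x, y). [u, x, y, v]) ` crown_middle X Y k"
    unfolding crown_middle_def lessThan_def by (simp only: setcompr_eq_image image_Un image_image prod.case)
  finally have img: "vertex_path u ` set (flip_orbit ?q k p) = (\<lambda>(x, y). [u, x, y, v]) ` crown_middle X Y k" .
  have fst2: "fst (e2 j) = fst (e1 j)" and thd2: "snd (snd (e2 j)) \<noteq> snd (snd (e1 j))" for j
    using label_path_flip2(4,5)[OF u lp1, of j] by (simp_all add: e2_def)
  \<comment> \<open>Increasing paths are counted in a list; only its distinctness turns that count
    into the cardinality in \<open>cF\<close>. Equal first labels force equal indices, and then the
    last labels tell \<open>e1\<close> from \<open>e2\<close>.\<close>
  have distinct: "distinct (flip_orbit ?q k p)"
    unfolding orbit distinct_append distinct_map set_map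
  proof (intro conjI)
    show "inj_on e1 (set [0..<k])" using fst_inj by (auto intro!: inj_onI)
    show "inj_on e2 (set [0..<k])" using fst_inj fst2 by (metis atLeastLessThan_iff inj_onI set_upt)
    show "e1 ` set [0..<k] \<inter> e2 ` set [0..<k] = {}"
    proof (rule ccontr)
      assume "e1 ` set [0..<k] \<inter> e2 ` set [0..<k] \<noteq> {}"
      then obtain i j where "i \<in> set [0..<k]" "j \<in> set [0..<k]" and ij: "e1 i = e2 j" by blast
      then have "i < k" "j < k" by simp_all
      moreover have "fst (e1 i) = fst (e1 j)" using ij fst2 by simp
      ultimately have "i = j" using fst_inj by blast
      then show False using ij thd2 by metis
    qed
  qed simp_all
  show ?thesis
  proof (rule that[OF dist img _ _ _ _ distinct])
    show "\<forall>j<k. flip_op n 1 [u, X j, Y (Suc j mod k), v] = [u, X (Suc j mod k), Y (Suc j mod k), v]"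
      "\<forall>j<k. flip_op n 1 [u, X (Suc j mod k), Y (Suc j mod k), v] = [u, X j, Y (Suc j mod k), v]"
      using op1 W1[OF m] W2 by metis+
    show "\<forall>j<k. flip_op n 2 [u, X j, Y j, v] = [u, X j, Y (Suc j mod k), v]"
      "\<forall>j<k. flip_op n 2 [u, X j, Y (Suc j mod k), v] = [u, X j, Y j, v]"
      using op2 W1 W2 by metis+
  qed
qed

lemma cF_orbit:
  assumes u: "u permutes {1..n}" and lp: "\<forall>x\<in>set ps. label_path n (pos u) x" and dist: "distinct ps"
    and F: "F = vertex_path u ` set ps"
  shows "cF n \<rho> F = length (filter (increasing3 (\<lambda>s t. (s, t) \<in> \<rho>)) ps)"
proof -
  have inc: "increasing \<rho> (vlabels n (vertex_path u x)) \<longleftrightarrow> increasing3 (\<lambda>s t. (s, t) \<in> \<rho>) x"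
    if "x \<in> set ps" for x
  proof -
    obtain r s t where x: "x = (r, s, t)" by (cases x)
    have "vlabels n (vertex_path u x) = [r, s, t]"
      using vlabels_vertex_path[OF u] lp that unfolding x by blast
    then show ?thesis by (auto simp: increasing_def x eval_nat_numeral less_Suc_eq all_conj_distrib)
  qed
  have "{p \<in> F. increasing \<rho> (vlabels n p)} =
      vertex_path u ` set (filter (increasing3 (\<lambda>s t. (s, t) \<in> \<rho>)) ps)"
    using inc by (auto simp: F)
  moreover have "inj_on (vertex_path u) (set (filter (increasing3 (\<lambda>s t. (s, t) \<in> \<rho>)) ps))"
    using vertex_path_inject[OF u] lp unfolding set_filter by (intro inj_onI) blast
  ultimately show ?thesis
    unfolding cF_def using distinct_card[OF distinct_filter[OF dist]] by (simp add: card_image)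
qed

lemma elabels_i_S: "elabels (i_S n xs) = vlabels n xs" "elabels (i_TS n xs) = vlabels n xs"
  by (simp_all add: elabels_def i_S_def i_TS_def vlabels_def)

text \<open>The cycle lies in \<open>F\<close> because flips stay in \<open>F\<close>. Conversely
  the crown relations make the cycle closed under both flips, and it contains the path that defines
  \<open>F\<close>, so it contains all of \<open>F\<close> by minimality.\<close>

lemma flipclass_eq_orbit:
  assumes u: "u permutes {1..n}" and F: "F \<in> flipclasses n 3 u v"
  obtains p k where "label_path n (pos u) p" "last (vertex_path u p) = v" "k \<in> {2, 3, 4, 5}"
    "cycle_counts n (pos u) k p" "F = vertex_path u ` set (flip_orbit (pos u) k p)"
proof -
  obtain xs where xs: "xs \<in> bpaths n 3 u v" and F: "F = (\<lambda>g. g xs) ` carrier (flip_group n 3 u v)"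
    using F by (auto simp: flipclasses_def)
  note cl = flipclass_closed[OF u F xs]
  obtain l where l: "label_path n (pos u) l" "last (vertex_path u l) = v" "xs = vertex_path u l"
    using xs unfolding bpaths_3_eq[OF u] by blast
  have FP: "F \<subseteq> bpaths n 3 u v" using cl(3)[OF xs order_refl] bpaths_flip_op(1)[OF u] by blast
  have F1: "vertex_path u (flip1 (pos u) x) \<in> F" if "label_path n (pos u) x" "vertex_path u x \<in> F" for x
    using cl(2)[OF that(2), of 1] label_path_flip1(2)[OF u that(1)] by simp
  have F2: "vertex_path u (flip2 (pos u) x) \<in> F" if "label_path n (pos u) x" "vertex_path u x \<in> F" for x
    using cl(2)[OF that(2), of 2] label_path_flip2(2)[OF u that(1)] by simp
  note lp1 = label_path_flip1(1)[OF u] and lp2 = label_path_flip2(1)[OF u]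
  obtain p k where p: "p \<in> {l, flip1 (pos u) l, flip12 (pos u) l}" and k: "k \<in> {2, 3, 4, 5}"
    and cc: "cycle_counts n (pos u) k p"
    using ex_cycle_counts[OF u l(1)] by blast
  have lF: "vertex_path u l \<in> F" using cl(1) l(3) by simp
  define G where "G x \<longleftrightarrow> label_path n (pos u) x \<and> vertex_path u x \<in> F" for x
  have G1: "G (flip1 (pos u) x)" and G2: "G (flip2 (pos u) x)" if "G x" for x
    using that lp1 lp2 F1 F2 unfolding G_def by blast+
  have G12: "G (flip12 (pos u) x)" if "G x" for x unfolding flip12_def using G1[OF G2[OF that]] .
  have "G l" unfolding G_def using l(1) lF by blast
  then have Gp: "G p" using p G1 G12 by blast
  then have lp: "label_path n (pos u) p" and pF: "vertex_path u p \<in> F" unfolding G_def by blast+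
  have v: "last (vertex_path u p) = v"
  proof -
    have "vertex_path u p \<in> bpaths n 3 u v" using pF FP by blast
    then show ?thesis by (cases p) (simp add: bpaths_def)
  qed
  have k0: "0 < k" using k by auto
  let ?E = "vertex_path u ` set (flip_orbit (pos u) k p)"
  have orb: "label_path n (pos u) x \<and> vertex_path u x \<in> F" if "x \<in> set (flip_orbit (pos u) k p)" for x
  proof -
    have it: "G ((flip12 (pos u) ^^ j) p)" for j
    proof (induction j)
      case (Suc j)
      from G12[OF this] show ?case by (simp only: funpow.simps o_apply)
    qed (simp add: Gp)
    have "G x"
      using that it G2 unfolding flip_orbit_def iterates_conv_funpow set_append set_map by blast
    then show ?thesis unfolding G_def .
  qed
  have cyc: "flip_cycle (pos u) k p" using cc by (simp add: cycle_counts_def)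
  obtain X Y where "crown_vertices_distinct u X Y v k" and E: "?E = (\<lambda>(x, y). [u, x, y, v]) ` crown_middle X Y k"
    and f1: "\<forall>j<k. flip_op n 1 [u, X j, Y (Suc j mod k), v] = [u, X (Suc j mod k), Y (Suc j mod k), v]"
       "\<forall>j<k. flip_op n 1 [u, X (Suc j mod k), Y (Suc j mod k), v] = [u, X j, Y (Suc j mod k), v]"
    and f2: "\<forall>j<k. flip_op n 2 [u, X j, Y j, v] = [u, X j, Y (Suc j mod k), v]"
       "\<forall>j<k. flip_op n 2 [u, X j, Y (Suc j mod k), v] = [u, X j, Y j, v]"
    and "distinct (flip_orbit (pos u) k p)"
    using flip_cycle_crown[OF u lp k0 cyc v[symmetric]] .
  note f1 = f1[rule_format] and f2 = f2[rule_format]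
  have E': "?E = (\<lambda>j. [u, X j, Y j, v]) ` {..<k} \<union> (\<lambda>j. [u, X j, Y (Suc j mod k), v]) ` {..<k}"
    unfolding E crown_middle_def lessThan_def by (simp only: setcompr_eq_image image_Un image_image prod.case)
  have E1: "[u, X j, Y j, v] \<in> ?E" and E2: "[u, X j, Y (Suc j mod k), v] \<in> ?E" if "j < k" for j
    unfolding E' using that by blast+
  have m: "Suc j mod k < k" for j using k0 by simp
  have Ecl: "flip_op n i ys \<in> ?E" if ys: "ys \<in> ?E" and i: "i \<in> {1, 2}" for ys i
  proof -
    consider j where "j < k" "ys = [u, X j, Y j, v]" | j where "j < k" "ys = [u, X j, Y (Suc j mod k), v]"
      using ys unfolding E' by blast
    then show ?thesis
    proof cases
      case 1
      \<comment> \<open>The first flip leads back to the predecessor on the cycle, which for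
        \<open>j = 0\<close> is \<open>k - 1\<close>.\<close>
      have "\<exists>j'<k. j = Suc j' mod k"
      proof (cases j)
        case 0
        then show ?thesis using k0 by (intro exI[of _ "k - 1"]) simp
      next
        case (Suc j')
        then show ?thesis using 1(1) by (intro exI[of _ j']) simp
      qed
      then obtain j' where j': "j' < k" "j = Suc j' mod k" by blast
      have "flip_op n 1 ys \<in> ?E" using f1(2)[OF j'(1)] E2[OF j'(1)] by (simp add: 1(2) j'(2))
      moreover have "flip_op n 2 ys \<in> ?E" using f2(1)[OF 1(1)] E2[OF 1(1)] by (simp add: 1(2))
      ultimately show ?thesis using i by blast
    next
      case 2
      have "flip_op n 1 ys \<in> ?E" using f1(1)[OF 2(1)] E1[OF m] by (simp add: 2(2))
      moreover have "flip_op n 2 ys \<in> ?E" using f2(2)[OF 2(1)] E1[OF 2(1)] by (simp add: 2(2))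
      ultimately show ?thesis using i by blast
    qed
  qed
  have EF: "?E \<subseteq> F" using orb by blast
  have "p \<in> set (flip_orbit (pos u) k p)" using k0 by (cases k) (simp_all add: flip_orbit_def)
  then have pE: "vertex_path u p \<in> ?E" by blast
  \<comment> \<open>\<open>p\<close> arose from \<open>l\<close> by at most two flips; being
    involutions, they can be undone inside the closed set.\<close>
  have "xs \<in> ?E"
  proof -
    have inv1: "vertex_path u x \<in> ?E" if "label_path n (pos u) x" "vertex_path u (flip1 (pos u) x) \<in> ?E" for x
      using Ecl[OF that(2), of 1] label_path_flip1(2)[OF u lp1[OF that(1)]] label_path_flip1(3)[OF u that(1)] by simp
    have inv2: "vertex_path u x \<in> ?E" if "label_path n (pos u) x" "vertex_path u (flip2 (pos u) x) \<in> ?E" for x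
      using Ecl[OF that(2), of 2] label_path_flip2(2)[OF u lp2[OF that(1)]] label_path_flip2(3)[OF u that(1)] by simp
    show ?thesis
      using p pE inv1[OF l(1)] inv1[OF lp2[OF l(1)]] inv2[OF l(1)] unfolding l(3) flip12_def by blast
  qed
  then have "F \<subseteq> ?E" by (rule cl(3)[OF _ order_trans[OF EF FP] Ecl])
  then have "F = ?E" using EF by (rule equalityI)
  then show ?thesis by (rule that[OF lp v k cc])
qed

theorem theorem7p3:
  fixes n :: nat and u v :: "nat \<Rightarrow> nat"
  assumes "bruhat_less n u v"
  shows "is_dihedral (flip_group n 3 u v) \<and>
    (\<forall>F \<in> flipclasses n 3 u v. \<exists>k \<in> {2, 3, 4, 5}.
       digraph_iso (S_V F) (unlab (S_E n F)) (crown_V k) (crown_E k) \<and>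
       digraph_iso (TS_V F) (unlab (TS_E n F)) (crown_V k) (crown_E k) \<and>
       k = perm_order_on F (flip_op n 2 \<circ> flip_op n 1) \<and>
       bij_betw (i_S n) F (lpaths (S_E n F) 3 u v) \<and>
       bij_betw (i_TS n) F (lpaths (TS_E n F) 3 (u, 0) (v, 3)) \<and>
       (\<forall>r. reflection_ordering n r \<longrightarrow>
          (\<forall>p\<in>F. increasing r (vlabels n p) \<longrightarrow>
             increasing r (elabels (i_S n p)) \<and> increasing r (elabels (i_TS n p)))) \<and>
       (\<forall>r. reflection_ordering n r \<longrightarrow>
          cF n r F = (if k \<in> {2, 3, 4} then 1 else 2)))"
proof (intro conjI ballI)
  have u: "u permutes {1..n}" using assms by (simp add: bruhat_less_def bruhat_le_def)
  show "is_dihedral (flip_group n 3 u v)" by (rule is_dihedral_flip_group[OF u])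
  fix F assume "F \<in> flipclasses n 3 u v"
  then obtain p k where p: "label_path n (pos u) p" "last (vertex_path u p) = v" and k: "k \<in> {2, 3, 4, 5}"
    and cc: "cycle_counts n (pos u) k p" and F: "F = vertex_path u ` set (flip_orbit (pos u) k p)"
    using flipclass_eq_orbit[OF u] by blast
  have k0: "0 < k" and cyc: "flip_cycle (pos u) k p" using k cc by (auto simp: cycle_counts_def)
  obtain X Y where dist: "crown_vertices_distinct u X Y v k"
    and E: "vertex_path u ` set (flip_orbit (pos u) k p) = (\<lambda>(x, y). [u, x, y, v]) ` crown_middle X Y k"
    and f: "\<forall>j<k. flip_op n 1 [u, X j, Y (Suc j mod k), v] = [u, X (Suc j mod k), Y (Suc j mod k), v]"
       "\<forall>j<k. flip_op n 1 [u, X (Suc j mod k), Y (Suc j mod k), v] = [u, X j, Y (Suc j mod k), v]"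
       "\<forall>j<k. flip_op n 2 [u, X j, Y j, v] = [u, X j, Y (Suc j mod k), v]"
       "\<forall>j<k. flip_op n 2 [u, X j, Y (Suc j mod k), v] = [u, X j, Y j, v]"
    and distinct: "distinct (flip_orbit (pos u) k p)"
    using flip_cycle_crown[OF u p(1) k0 cyc p(2)[symmetric]] .
  note crown = crown_flipclass[OF dist trans[OF F E] f[rule_format]]
  have "cF n r F = (if k \<in> {2, 3, 4} then 1 else 2)" if "reflection_ordering n r" for r
    using cF_orbit[OF u label_path_flip_orbit[OF u p(1)] distinct F] cc that k
    by (auto simp: cycle_counts_def count_ok_def)
  then show "\<exists>k \<in> {2, 3, 4, 5}.
       digraph_iso (S_V F) (unlab (S_E n F)) (crown_V k) (crown_E k) \<and>
       digraph_iso (TS_V F) (unlab (TS_E n F)) (crown_V k) (crown_E k) \<and>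
       k = perm_order_on F (flip_op n 2 \<circ> flip_op n 1) \<and>
       bij_betw (i_S n) F (lpaths (S_E n F) 3 u v) \<and>
       bij_betw (i_TS n) F (lpaths (TS_E n F) 3 (u, 0) (v, 3)) \<and>
       (\<forall>r. reflection_ordering n r \<longrightarrow>
          (\<forall>p\<in>F. increasing r (vlabels n p) \<longrightarrow>
             increasing r (elabels (i_S n p)) \<and> increasing r (elabels (i_TS n p)))) \<and>
       (\<forall>r. reflection_ordering n r \<longrightarrow>
          cF n r F = (if k \<in> {2, 3, 4} then 1 else 2))"
    using crown k unfolding elabels_i_S by blast
qed

end
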